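(* Let $n\ge2$, let $X$ be a Poisson hyperplane process in $\mathbb{R}^n$ with distance exponent $r>0$ and intensity $\gamma>0$, let $m\in\{1,\ldots,n-1\}$, and let $L$ be an $m$-dimensional linear subspace of $\mathbb{R}^n$. Then the intensity measure $\Theta_L$ of the sectional process $X\cap L$ is $$\Theta_L(\,\cdot\,)=\frac{\gamma_m}{\omega_m}\int_{\mathbb{S}_L}\int_{\mathbb{R}}\mathbf{1}\big\{t\,u+(u^\perp\cap L)\in\,\cdot\,\big\}\,|t|^{r-1}\,dt\,\mathcal{H}^{m-1}(du)$$ with $\gamma_m=\dfrac{\omega_m\,\omega_{n+r}}{\omega_n\,\omega_{m+r}}\,\gamma$.
   Context: For real $s>0$ put $\omega_s=2\pi^{s/2}/\Gamma(s/2)$. $\mathcal{H}^s$ is $s$-dimensional Hausdorff measure; $\mathbb{S}_L$ is the unit sphere of the linear subspace $L$; $u^\perp$ is the hyperplane through $0$ orthogonal to $u$. With $H(u,t)=\{x\in\mathbb{R}^n:\langle x,u\rangle=t\}$, let $\Theta$ be the measure on the space $A(n,n-1)$ of affine hyperplanes of $\mathbb{R}^n$ given by $$\Theta(\,\cdot\,)=\frac{\gamma}{\omega_n}\int_{\mathbb{S}^{n-1}}\int_{\mathbb{R}}\mathbf{1}\{H(u,t)\in\,\cdot\,\}\,|t|^{r-1}\,dt\,\mathcal{H}^{n-1}(du).$$ The Poisson hyperplane process $X$ with distance exponent $r$ and intensity $\gamma$ is the Poisson process on $A(n,n-1)$ with intensity measure $\Theta$. The sectional process is $X\cap L=\sum_{H\in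 X,\,H\cap L\ne\emptyset}\delta_{H\cap L}$, a Poisson process of $(m-1)$-dimensional affine subspaces of $L$ (almost surely); its intensity measure is $\Theta_L=\mathbb{E}(X\cap L)$, a measure on the space of $(m-1)$-dimensional affine subspaces of $L$. *)

theory Defs
  imports "HOL-Probability.Probability"
begin

text \<open>
  Hausdorff measure with the usual normalisation, under which the \<open>k\<close>-dimensional measure agrees
  with Lebesgue measure on \<open>k\<close>-dimensional Euclidean space: a covering set \<open>U\<close> contributes the volume
  of the \<open>s\<close>-dimensional ball of diameter \<open>diam U\<close>. The case \<open>s = 0\<close> is separate because
  \<open>0 powr 0 = 0\<close>; every nonempty set then contributes 1, and one obtains counting measure.
\<close>

definition hausdorff_gauge :: "real \<Rightarrow> 'a::metric_space set \<Rightarrow> ennreal" where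
  "hausdorff_gauge s U =
    (if U = {} then 0
     else if s = 0 then 1
     else ennreal (unit_ball_vol s * (diameter U / 2) powr s))"

text \<open>Boundedness is required since \<^const>\<open>diameter\<close> is unspecified on unbounded sets.\<close>

definition hausdorff_content :: "real \<Rightarrow> real \<Rightarrow> 'a::metric_space set \<Rightarrow> ennreal" where
  "hausdorff_content s \<delta> A =
    (INF U \<in> {U :: nat \<Rightarrow> 'a set. A \<subseteq> (\<Union>i. U i) \<and> (\<forall>i. bounded (U i) \<and> diameter (U i) \<le> \<delta>)}.
       \<Sum>i. hausdorff_gauge s (U i))"

definition hausdorff_outer :: "real \<Rightarrow> 'a::metric_space set \<Rightarrow> ennreal" where
  "hausdorff_outer s A = (SUP \<delta> \<in> {0<..}. hausdorff_content s \<delta> A)"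

definition hausdorff_measure :: "real \<Rightarrow> 'a::metric_space measure" where
  "hausdorff_measure s = measure_of UNIV (sets borel) (hausdorff_outer s)"

text \<open>
  The outer measure is countably additive on the Borel sets (Caratheodory's criterion for metric
  outer measures), so that \<^const>\<open>measure_of\<close> above is not degenerate; see
  \<open>emeasure_hausdorff_measure\<close> below.
\<close>

lemma hausdorff_gauge_empty [simp]: "hausdorff_gauge s {} = 0"
  by (simp add: hausdorff_gauge_def)

lemma hausdorff_content_le:
  assumes "A \<subseteq> (\<Union>i. U i)" "\<And>i. bounded (U i)" "\<And>i. diameter (U i) \<le> \<delta>"
  shows "hausdorff_content s \<delta> A \<le> (\<Sum>i::nat. hausdorff_gauge s (U i))"
  unfolding hausdorff_content_def by (rule INF_lower) (use assms in auto)

lemma hausdorff_content_mono: "A \<subseteq> B \<Longrightarrow> hausdorff_content s \<delta> A \<le> hausdorff_content s \<delta> B"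
  unfolding hausdorff_content_def by (rule INF_superset_mono) auto

lemma hausdorff_content_antimono:
  "\<delta>' \<le> \<delta> \<Longrightarrow> hausdorff_content s \<delta> A \<le> hausdorff_content s \<delta>' A"
  unfolding hausdorff_content_def by (rule INF_superset_mono) (auto intro: order_trans)

lemma hausdorff_content_empty: "0 < \<delta> \<Longrightarrow> hausdorff_content s \<delta> {} = 0"
  using hausdorff_content_le[of "{}" "\<lambda>_. {}" \<delta> s] by simp

lemma hausdorff_content_subadditive:
  "hausdorff_content s \<delta> (\<Union>n::nat. A n) \<le> (\<Sum>n. hausdorff_content s \<delta> (A n))"
proof (rule ennreal_le_epsilon)
  fix e :: real assume e: "0 < e" and fin: "(\<Sum>n. hausdorff_content s \<delta> (A n)) < top"
  have "\<exists>U. A n \<subseteq> (\<Union>i. U i) \<and> (\<forall>i. bounded (U i) \<and> diameter (U i) \<le> \<delta>) \<and>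
      (\<Sum>i::nat. hausdorff_gauge s (U i)) \<le> hausdorff_content s \<delta> (A n) + e * (1/2)^Suc n" for n
  proof -
    have "hausdorff_content s \<delta> (A n) < hausdorff_content s \<delta> (A n) + e * (1/2)^Suc n"
      using e fin by (auto simp add: less_top dest!: ennreal_suminf_lessD)
    then show ?thesis
      unfolding hausdorff_content_def[of s \<delta> "A n"] INF_less_iff by (auto intro: less_imp_le)
  qed
  then obtain U where U: "\<And>n. A n \<subseteq> (\<Union>i. U n i)" "\<And>n i. bounded (U n i)"
      "\<And>n i. diameter (U n i) \<le> \<delta>"
      "\<And>n. (\<Sum>i::nat. hausdorff_gauge s (U n i)) \<le> hausdorff_content s \<delta> (A n) + e * (1/2)^Suc n"
    by metis
  define C where "C = case_prod U o prod_decode"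
  have "(\<Union>n. A n) \<subseteq> (\<Union>i. C i)"
    using U(1) by (auto simp add: C_def subset_eq) (metis prod.case prod_encode_inverse)
  then have "hausdorff_content s \<delta> (\<Union>n. A n) \<le> (\<Sum>i. hausdorff_gauge s (C i))"
    by (rule hausdorff_content_le) (auto simp: C_def U split: prod.split)
  also have "\<dots> = (\<Sum>n. \<Sum>i. hausdorff_gauge s (U n i))"
    unfolding C_def comp_def by (intro suminf_ennreal_2dimen) auto
  also have "\<dots> \<le> (\<Sum>n. hausdorff_content s \<delta> (A n) + e * (1/2) ^ Suc n)"
    by (intro suminf_le allI U) auto
  also have "\<dots> = (\<Sum>n. hausdorff_content s \<delta> (A n)) + (\<Sum>n. ennreal e * ennreal ((1/2) ^ Suc n))"
    using e by (subst suminf_add[symmetric])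
               (auto simp del: ennreal_suminf_cmult simp add: ennreal_mult[symmetric])
  also have "\<dots> = (\<Sum>n. hausdorff_content s \<delta> (A n)) + e"
    unfolding ennreal_suminf_cmult
    by (subst suminf_ennreal_eq[OF zero_le_power power_half_series]) auto
  finally show "hausdorff_content s \<delta> (\<Union>n. A n) \<le> (\<Sum>n. hausdorff_content s \<delta> (A n)) + e" .
qed

lemma hausdorff_content_le_outer: "0 < \<delta> \<Longrightarrow> hausdorff_content s \<delta> A \<le> hausdorff_outer s A"
  unfolding hausdorff_outer_def by (rule SUP_upper) auto

lemma hausdorff_outer_mono: "A \<subseteq> B \<Longrightarrow> hausdorff_outer s A \<le> hausdorff_outer s B"
  unfolding hausdorff_outer_def by (intro SUP_mono) (auto intro: hausdorff_content_mono)

lemma hausdorff_outer_empty [simp]: "hausdorff_outer s {} = 0"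
  unfolding hausdorff_outer_def by (auto simp: hausdorff_content_empty)

lemma hausdorff_outer_subadditive:
  "hausdorff_outer s (\<Union>n::nat. A n) \<le> (\<Sum>n. hausdorff_outer s (A n))"
proof -
  have "hausdorff_content s \<delta> (\<Union>n. A n) \<le> (\<Sum>n. hausdorff_outer s (A n))" if "0 < \<delta>" for \<delta>
    by (rule order_trans[OF hausdorff_content_subadditive])
       (intro suminf_le hausdorff_content_le_outer that summableI)
  then show ?thesis
    unfolding hausdorff_outer_def[of s "\<Union>n. A n"] by (intro SUP_least) auto
qed

lemma outer_measure_space_hausdorff_outer:
  "outer_measure_space UNIV (hausdorff_outer s)"
  by (auto simp: outer_measure_space_def positive_def increasing_def countably_subadditive_def
      intro: hausdorff_outer_mono hausdorff_outer_subadditive)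

lemma hausdorff_outer_Un: "hausdorff_outer s (A \<union> B) \<le> hausdorff_outer s A + hausdorff_outer s B"
proof -
  have "subadditive UNIV (hausdorff_outer s)"
    using outer_measure_space_hausdorff_outer[of s]
      ring_of_sets.countably_subadditive_subadditive[of UNIV UNIV "hausdorff_outer s"]
    by (metis Pow_UNIV outer_measure_space_def algebra_Pow algebra.axioms(1))
  have "hausdorff_outer s (A \<union> B) = hausdorff_outer s (A \<union> (B - A))" by simp
  also have "\<dots> \<le> hausdorff_outer s A + hausdorff_outer s (B - A)"
    using \<open>subadditive UNIV (hausdorff_outer s)\<close> unfolding subadditive_def by blast
  also have "\<dots> \<le> hausdorff_outer s A + hausdorff_outer s B"
    by (intro add_left_mono hausdorff_outer_mono) auto
  finally show ?thesis .
qed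

lemma hausdorff_outer_separated:
  assumes d: "0 < d" and sep: "\<And>x y. x \<in> A \<Longrightarrow> y \<in> B \<Longrightarrow> d \<le> dist x y"
  shows "hausdorff_outer s A + hausdorff_outer s B \<le> hausdorff_outer s (A \<union> B)"
proof -
  have *: "hausdorff_content s \<delta> A + hausdorff_content s \<delta> B \<le> hausdorff_content s \<delta> (A \<union> B)"
    if \<delta>: "0 < \<delta>" "\<delta> < d" for \<delta>
    unfolding hausdorff_content_def[of s \<delta> "A \<union> B"]
  proof (safe intro!: INF_greatest)
    fix U :: "nat \<Rightarrow> 'a set"
    assume cov: "A \<union> B \<subseteq> (\<Union>i. U i)" and U: "\<forall>i. bounded (U i) \<and> diameter (U i) \<le> \<delta>"
    define V where "V i = (if U i \<inter> A = {} then {} else U i)" for i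
    define W where "W i = (if U i \<inter> B = {} then {} else U i)" for i
    have VW: "V i = {} \<or> W i = {}" for i
    proof (rule ccontr)
      assume "\<not> ?thesis"
      then obtain x y where "x \<in> U i" "x \<in> A" "y \<in> U i" "y \<in> B"
        by (auto simp: V_def W_def split: if_splits)
      with sep have "d \<le> dist x y" "dist x y \<le> diameter (U i)"
        using U by (auto intro: diameter_bounded_bound)
      with U \<delta> show False by (smt (verit))
    qed
    have "A \<subseteq> (\<Union>i. V i)" "B \<subseteq> (\<Union>i. W i)" using cov by (fastforce simp: V_def W_def)+
    then have "hausdorff_content s \<delta> A \<le> (\<Sum>i. hausdorff_gauge s (V i))"
        "hausdorff_content s \<delta> B \<le> (\<Sum>i. hausdorff_gauge s (W i))"
      using U \<delta> by (intro hausdorff_content_le; simp add: V_def W_def)+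
    then have "hausdorff_content s \<delta> A + hausdorff_content s \<delta> B
        \<le> (\<Sum>i. hausdorff_gauge s (V i)) + (\<Sum>i. hausdorff_gauge s (W i))"
      by (rule add_mono)
    also have "\<dots> = (\<Sum>i. hausdorff_gauge s (V i) + hausdorff_gauge s (W i))"
      by (rule suminf_add) auto
    also have "\<dots> \<le> (\<Sum>i. hausdorff_gauge s (U i))"
    proof (rule suminf_le)
      show "hausdorff_gauge s (V i) + hausdorff_gauge s (W i) \<le> hausdorff_gauge s (U i)" for i
        using VW[of i] by (cases "U i \<inter> A = {}"; cases "U i \<inter> B = {}"; simp add: V_def W_def)
    qed auto
    finally show "hausdorff_content s \<delta> A + hausdorff_content s \<delta> B
        \<le> (\<Sum>i. hausdorff_gauge s (U i))" .
  qed
  have "hausdorff_content s \<delta> A + hausdorff_content s \<epsilon> B \<le> hausdorff_outer s (A \<union> B)"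
    if "0 < \<delta>" "0 < \<epsilon>" for \<delta> \<epsilon>
  proof -
    define \<eta> where "\<eta> = min (d/2) (min \<delta> \<epsilon>)"
    have \<eta>: "0 < \<eta>" "\<eta> < d" "\<eta> \<le> \<delta>" "\<eta> \<le> \<epsilon>" using that d by (auto simp: \<eta>_def)
    have "hausdorff_content s \<delta> A + hausdorff_content s \<epsilon> B
        \<le> hausdorff_content s \<eta> A + hausdorff_content s \<eta> B"
      by (intro add_mono hausdorff_content_antimono \<eta>)
    also have "\<dots> \<le> hausdorff_content s \<eta> (A \<union> B)" by (rule *[OF \<eta>(1,2)])
    also have "\<dots> \<le> hausdorff_outer s (A \<union> B)" by (rule hausdorff_content_le_outer[OF \<eta>(1)])
    finally show ?thesis .
  qed
  then have "(SUP \<epsilon>\<in>{0<..}. hausdorff_content s \<delta> A + hausdorff_content s \<epsilon> B)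
      \<le> hausdorff_outer s (A \<union> B)" if "0 < \<delta>" for \<delta>
    using that by (intro SUP_least) auto
  moreover have "hausdorff_content s \<delta> A + hausdorff_outer s B
      = (SUP \<epsilon>\<in>{0<..}. hausdorff_content s \<delta> A + hausdorff_content s \<epsilon> B)" for \<delta>
    unfolding hausdorff_outer_def[of s B] by (rule ennreal_SUP_add_right) simp
  ultimately have "(SUP \<delta>\<in>{0<..}. hausdorff_content s \<delta> A + hausdorff_outer s B)
      \<le> hausdorff_outer s (A \<union> B)"
    by (intro SUP_least) simp
  also have "(SUP \<delta>\<in>{0<..}. hausdorff_content s \<delta> A + hausdorff_outer s B)
      = hausdorff_outer s A + hausdorff_outer s B"
    unfolding hausdorff_outer_def[of s A] by (rule ennreal_SUP_add_left) simp
  finally show ?thesis .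
qed

lemma hausdorff_outer_caratheodory:
  fixes F T :: "'a::metric_space set"
  assumes F: "closed F"
  shows "hausdorff_outer s (T \<inter> F) + hausdorff_outer s (T - F) \<le> hausdorff_outer s T"
proof (cases "F = {} \<or> hausdorff_outer s T = top")
  case True
  then show ?thesis by auto
next
  case False
  then have ne: "F \<noteq> {}" and fin: "hausdorff_outer s T < top" by (auto simp: less_top)
  let ?h = "hausdorff_outer s"
  define S where "S k = {x \<in> T. 1 / real (Suc k) \<le> infdist x F}" for k
  define R where "R k = {x \<in> T. 1 / real (k+2) \<le> infdist x F \<and> infdist x F < 1 / real (k+1)}" for k
  have dR: "1 / real (i+2) - 1 / real (j+1) \<le> dist x y"
    if "x \<in> R i" "y \<in> R j" for i j x y
    using that infdist_triangle[of x F y] by (auto simp: R_def)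
  have bound: "(\<Sum>j<N. ?h (R (2*j+p))) \<le> ?h T" for N p
  proof -
    have "(\<Sum>j<N. ?h (R (2*j+p))) \<le> ?h (\<Union>j<N. R (2*j+p))"
    proof (induction N)
      case 0 then show ?case by simp
    next
      case (Suc N)
      have "(\<Sum>j<Suc N. ?h (R (2*j+p))) \<le> ?h (\<Union>j<N. R (2*j+p)) + ?h (R (2*N+p))"
        using Suc by (simp add: add_right_mono)
      also have "\<dots> \<le> ?h ((\<Union>j<N. R (2*j+p)) \<union> R (2*N+p))"
      proof (cases "N = 0")
        case True then show ?thesis by simp
      next
        case False
        show ?thesis
        proof (rule hausdorff_outer_separated)
          show "0 < 1 / real (2*(N-1)+p+2) - 1 / real (2*N+p+1)"
            using False by (simp add: frac_less2 of_nat_diff)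
          fix x y assume "x \<in> (\<Union>j<N. R (2*j+p))" "y \<in> R (2*N+p)"
          then obtain j where j: "j < N" "x \<in> R (2*j+p)" by auto
          have "1 / real (2*(N-1)+p+2) \<le> 1 / real (2*j+p+2)"
            using j(1) by (intro divide_left_mono) auto
          with dR[OF j(2) \<open>y \<in> R (2*N+p)\<close>]
          show "1 / real (2*(N-1)+p+2) - 1 / real (2*N+p+1) \<le> dist x y" by linarith
        qed
      qed
      also have "(\<Union>j<N. R (2*j+p)) \<union> R (2*N+p) = (\<Union>j<Suc N. R (2*j+p))"
        by (auto simp: less_Suc_eq)
      finally show ?case .
    qed
    also have "\<dots> \<le> ?h T" by (rule hausdorff_outer_mono) (auto simp: R_def)
    finally show ?thesis .
  qed
  have sum_fin: "(\<Sum>j. ?h (R j)) < top"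
  proof -
    have "(\<Sum>j<N. ?h (R j)) \<le> ?h T + ?h T" for N
    proof -
      have "(\<Sum>j<N. ?h (R j)) \<le> (\<Sum>j<2*N. ?h (R j))" by (rule sum_mono2) auto
      also have "\<dots> = (\<Sum>j<N. ?h (R (2*j+0))) + (\<Sum>j<N. ?h (R (2*j+1)))"
        by (induction N) (auto simp: add_ac)
      also have "\<dots> \<le> ?h T + ?h T" by (intro add_mono bound)
      finally show ?thesis .
    qed
    then have "(\<Sum>j. ?h (R j)) \<le> ?h T + ?h T" by (intro suminf_le_const) auto
    also have "\<dots> < top" using fin by simp
    finally show ?thesis .
  qed
  have sep: "?h (T \<inter> F) + ?h (S k) \<le> ?h T" for k
  proof -
    have "?h (T \<inter> F) + ?h (S k) \<le> ?h ((T \<inter> F) \<union> S k)"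
    proof (rule hausdorff_outer_separated)
      show "0 < 1 / real (Suc k)" by simp
      fix x y assume "x \<in> T \<inter> F" "y \<in> S k"
      then show "1 / real (Suc k) \<le> dist x y"
        using infdist_le[of x F y] by (auto simp: S_def dist_commute)
    qed
    also have "\<dots> \<le> ?h T" by (rule hausdorff_outer_mono) (auto simp: S_def)
    finally show ?thesis .
  qed
  have "?h (T \<inter> F) + ?h (T - F) \<le> ?h T + (\<Sum>j. ?h (R (j+k)))" for k
  proof -
    have "T - F \<subseteq> S k \<union> (\<Union>j. R (j+k))"
    proof
      fix x assume x: "x \<in> T - F"
      then have pos: "0 < infdist x F"
        using F ne in_closed_iff_infdist_zero[of F x] infdist_nonneg[of x F] by (auto simp: less_le)
      show "x \<in> S k \<union> (\<Union>j. R (j+k))"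
      proof (cases "1 / real (Suc k) \<le> infdist x F")
        case True then show ?thesis using x by (auto simp: S_def)
      next
        case False
        define n where "n = (LEAST n. 1 / real (Suc n) \<le> infdist x F)"
        have ex: "\<exists>n. 1 / real (Suc n) \<le> infdist x F"
          using nat_approx_posE[OF pos] by (metis less_imp_le)
        have n: "1 / real (Suc n) \<le> infdist x F" unfolding n_def by (rule LeastI_ex[OF ex])
        have "\<not> n \<le> k"
        proof
          assume "n \<le> k"
          then have "1 / real (Suc k) \<le> 1 / real (Suc n)" by (intro divide_left_mono) auto
          with n False show False by linarith
        qed
        then obtain j where j: "n = Suc (j + k)" by (metis add.commute less_imp_Suc_add not_le)
        have "\<not> 1 / real (Suc (j + k)) \<le> infdist x F"
          using not_less_Least[of "j + k" "\<lambda>n. 1 / real (Suc n) \<le> infdist x F"] j by (simp add: n_def)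
        then have "x \<in> R (j+k)" using n j x by (auto simp: R_def)
        then show ?thesis by auto
      qed
    qed
    then have "?h (T - F) \<le> ?h (S k \<union> (\<Union>j. R (j+k)))" by (rule hausdorff_outer_mono)
    also have "\<dots> \<le> ?h (S k) + ?h (\<Union>j. R (j+k))" by (rule hausdorff_outer_Un)
    also have "\<dots> \<le> ?h (S k) + (\<Sum>j. ?h (R (j+k)))"
      by (intro add_left_mono hausdorff_outer_subadditive)
    finally have "?h (T \<inter> F) + ?h (T - F) \<le> ?h (T \<inter> F) + (?h (S k) + (\<Sum>j. ?h (R (j+k))))"
      by (rule add_left_mono)
    also have "\<dots> = (?h (T \<inter> F) + ?h (S k)) + (\<Sum>j. ?h (R (j+k)))" by (simp add: add_ac)
    also have "\<dots> \<le> ?h T + (\<Sum>j. ?h (R (j+k)))" by (intro add_right_mono sep)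
    finally show ?thesis .
  qed
  moreover have "(\<lambda>k. ?h T + (\<Sum>j. ?h (R (j+k)))) \<longlonglongrightarrow> ?h T + 0"
  proof (intro tendsto_add tendsto_const)
    define r where "r j = enn2real (?h (R j))" for j
    have lt: "?h (R j) < top" for j using ennreal_suminf_lessD[OF sum_fin] .
    have r: "?h (R j) = ennreal (r j)" "0 \<le> r j" for j using lt[of j] by (auto simp: r_def)
    have "summable r" using sum_fin r by (intro summable_suminf_not_top) auto
    have "(\<lambda>k. ennreal (\<Sum>j. r (j+k))) \<longlonglongrightarrow> ennreal 0"
      using suminf_exist_split2[OF \<open>summable r\<close>] by (intro tendsto_ennrealI)
    moreover have "(\<Sum>j. ?h (R (j+k))) = ennreal (\<Sum>j. r (j+k))" for k
      unfolding r using r(2) \<open>summable r\<close> by (intro suminf_ennreal2) auto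
    ultimately show "(\<lambda>k. \<Sum>j. ?h (R (j+k))) \<longlonglongrightarrow> 0" by simp
  qed
  ultimately show ?thesis by (auto intro: LIMSEQ_le_const)
qed

lemma measure_space_hausdorff_outer:
  "measure_space UNIV (sets borel) (hausdorff_outer s :: 'a::metric_space set \<Rightarrow> ennreal)"
proof -
  let ?L = "lambda_system UNIV UNIV (hausdorff_outer s :: 'a set \<Rightarrow> ennreal)"
  interpret P: sigma_algebra UNIV "UNIV :: 'a set set" using sigma_algebra_Pow[of UNIV] by simp
  have L: "measure_space UNIV ?L (hausdorff_outer s)"
    by (rule P.caratheodory_lemma[OF outer_measure_space_hausdorff_outer])
  then interpret L: sigma_algebra UNIV ?L by (simp add: measure_space_def)
  have "F \<in> ?L" if "closed F" for F
  proof -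
    have "hausdorff_outer s (T \<inter> F) + hausdorff_outer s (T - F) = hausdorff_outer s T" for T
      using hausdorff_outer_caratheodory[OF that, of s T]
        hausdorff_outer_Un[of s "T \<inter> F" "T - F"] by (simp add: Int_Diff_Un order.antisym)
    then show ?thesis by (simp add: P.lambda_system_eq)
  qed
  then have "sigma_sets UNIV (Collect closed) \<subseteq> ?L"
    by (intro L.sigma_sets_subset subsetI) simp
  then have "sets borel \<subseteq> ?L"
    unfolding borel_eq_closed by simp
  then show ?thesis
    using measure_down[OF L] sets.sigma_algebra_axioms[of borel] by simp
qed

lemma sets_hausdorff_measure [simp, measurable_cong]: "sets (hausdorff_measure s) = sets borel"
  using sets.sets_measure_of_eq[of borel] by (simp add: hausdorff_measure_def)

lemma space_hausdorff_measure [simp]: "space (hausdorff_measure s) = UNIV"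
  by (simp add: hausdorff_measure_def)

lemma emeasure_hausdorff_measure:
  "A \<in> sets borel \<Longrightarrow> emeasure (hausdorff_measure s) A = hausdorff_outer s A"
  unfolding hausdorff_measure_def
  by (rule emeasure_measure_of_sigma)
     (use measure_space_hausdorff_outer[of s] in \<open>auto simp: measure_space_def\<close>)


subsection \<open>Spaces of flats\<close>

definition affine_flats :: "'a::euclidean_space set \<Rightarrow> nat \<Rightarrow> 'a set set" where
  "affine_flats V k = {E. affine E \<and> E \<subseteq> V \<and> aff_dim E = int k}"

text \<open>
  The Borel \<open>\<sigma>\<close>-algebra of the space of \<open>k\<close>-flats in \<open>V\<close> is the trace of the Borel \<open>\<sigma>\<close>-algebra of
  the Fell topology on closed sets, which is generated by the sets of those \<open>E\<close> that hit a given
  compact set.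
\<close>

definition flat_space :: "'a::euclidean_space set \<Rightarrow> nat \<Rightarrow> 'a set measure" where
  "flat_space V k =
    sigma (affine_flats V k) {{E \<in> affine_flats V k. E \<inter> C \<noteq> {}} | C. compact C}"

abbreviation hyperplane_space :: "'a::euclidean_space set measure" where
  "hyperplane_space \<equiv> flat_space UNIV (DIM('a) - 1)"

definition hyperplane :: "'a::euclidean_space \<Rightarrow> real \<Rightarrow> 'a set" where
  "hyperplane u t = {x. x \<bullet> u = t}"


subsection \<open>Poisson hyperplane processes\<close>

text \<open>The surface area of the unit sphere of \<open>s\<close>-dimensional space, for real \<open>s\<close>.\<close>

definition sphere_const :: "real \<Rightarrow> real" where
  "sphere_const s = 2 * pi powr (s / 2) / Gamma (s / 2)"

definition hyperplane_intensity :: "real \<Rightarrow> real \<Rightarrow> 'a::euclidean_space set measure" where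
  "hyperplane_intensity \<gamma> r =
    measure_of (space hyperplane_space) (sets hyperplane_space)
      (\<lambda>B. ennreal (\<gamma> / sphere_const (real DIM('a))) *
        (\<integral>\<^sup>+u\<in>sphere 0 1.
           (\<integral>\<^sup>+t. indicator B (hyperplane u t) * ennreal (\<bar>t\<bar> powr (r - 1)) \<partial>lborel)
         \<partial>hausdorff_measure (real (DIM('a) - 1))))"

text \<open>
  A point process on the measurable space \<open>S\<close> is a random counting measure: \<open>X \<omega>\<close> takes values in
  the natural numbers and infinity, each point having mass equal to its multiplicity.
\<close>

definition point_process :: "'w measure \<Rightarrow> 'b measure \<Rightarrow> ('w \<Rightarrow> 'b measure) \<Rightarrow> bool" where
  "point_process M S X \<longleftrightarrow>
     prob_space M \<and>
     (\<forall>\<omega>\<in>space M. sets (X \<omega>) = sets S) \<and>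
     (\<forall>\<omega>\<in>space M. \<forall>B\<in>sets S. emeasure (X \<omega>) B \<in> insert \<infinity> (range of_nat)) \<and>
     (\<forall>B\<in>sets S. (\<lambda>\<omega>. emeasure (X \<omega>) B) \<in> borel_measurable M)"

definition poisson_process :: "'w measure \<Rightarrow> 'b measure \<Rightarrow> ('w \<Rightarrow> 'b measure) \<Rightarrow> bool" where
  "poisson_process M \<Theta> X \<longleftrightarrow>
     point_process M \<Theta> X \<and>
     (\<forall>B\<in>sets \<Theta>. emeasure \<Theta> B < \<infinity> \<longrightarrow>
        (\<forall>k::nat. measure M {\<omega> \<in> space M. emeasure (X \<omega>) B = of_nat k} =
                  exp (- measure \<Theta> B) * measure \<Theta> B ^ k / fact k)) \<and>
     (\<forall>(B :: nat \<Rightarrow> 'b set) k. (\<forall>i<k. B i \<in> sets \<Theta>) \<longrightarrow> disjoint_family_on B {..<k} \<longrightarrow>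
        prob_space.indep_vars M (\<lambda>_. borel) (\<lambda>i \<omega>. emeasure (X \<omega>) (B i)) {..<k})"

definition intensity_measure :: "'w measure \<Rightarrow> 'b measure \<Rightarrow> ('w \<Rightarrow> 'b measure) \<Rightarrow> 'b measure" where
  "intensity_measure M S X =
    measure_of (space S) (sets S) (\<lambda>B. \<integral>\<^sup>+\<omega>. emeasure (X \<omega>) B \<partial>M)"

text \<open>The second condition is local finiteness: only finitely many hyperplanes hit a compact set.\<close>

definition poisson_hyperplane_process ::
    "'w measure \<Rightarrow> real \<Rightarrow> real \<Rightarrow> ('w \<Rightarrow> 'a::euclidean_space set measure) \<Rightarrow> bool" where
  "poisson_hyperplane_process M \<gamma> r X \<longleftrightarrow>
     poisson_process M (hyperplane_intensity \<gamma> r) X \<and>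
     (\<forall>\<omega>\<in>space M. \<forall>C. compact C \<longrightarrow> emeasure (X \<omega>) {H \<in> space hyperplane_space. H \<inter> C \<noteq> {}} < \<infinity>)"

text \<open>
  The section of a configuration \<open>N\<close> of hyperplanes by \<open>L\<close> is the sum of the Dirac measures at
  \<open>H \<inter> L\<close> over the points \<open>H\<close> of \<open>N\<close> that hit \<open>L\<close>; the sum over the points of \<open>N\<close>, with
  multiplicity, is the integral with respect to \<open>N\<close>. A hyperplane \<open>H\<close> containing \<open>L\<close> has
  \<open>H \<inter> L = L\<close>, which is not an element of the space of \<open>(dim L - 1)\<close>-flats, and hence does not
  contribute (this happens with probability 0).
\<close>

definition section_space :: "'a::euclidean_space set \<Rightarrow> 'a set measure" where
  "section_space L = flat_space L (dim L - 1)"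

definition section_measure ::
    "'a::euclidean_space set \<Rightarrow> 'a set measure \<Rightarrow> 'a set measure" where
  "section_measure L N =
    measure_of (space (section_space L)) (sets (section_space L))
      (\<lambda>B. \<integral>\<^sup>+H. indicator {H. H \<inter> L \<noteq> {}} H * emeasure (return (section_space L) (H \<inter> L)) B \<partial>N)"

definition sectional_process ::
    "'a::euclidean_space set \<Rightarrow> ('w \<Rightarrow> 'a set measure) \<Rightarrow> 'w \<Rightarrow> 'a set measure" where
  "sectional_process L X = (\<lambda>\<omega>. section_measure L (X \<omega>))"

end

theory Submission
  imports Defs
begin

text \<open>
  For a unit vector \<open>u\<close> with orthogonal projection \<open>p\<close> to \<open>L\<close>, the hyperplane \<open>x \<bullet> u = t\<close> meets \<open>L\<close>
  in the flat with normal direction \<open>p / |p|\<close> and distance parameter \<open>t / |p|\<close>, so that substitution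
  in \<open>t\<close> reduces the claim to the identity
  \<open>\<integral> |p|\<^sup>r g (p / |p|) du = \<omega>(n+r) / \<omega>(m+r) \<integral> g dv\<close> between integrals over the unit spheres of the
  whole space and of \<open>L\<close>. It follows by evaluating a Gaussian integral both in polar coordinates
  and as a product over \<open>L\<close> and its complement.

  Polar coordinates require that Hausdorff measure on the sphere is the cone measure, and hence the
  exact normalisation of Hausdorff measure on subspaces. There the isodiametric inequality (by
  Steiner symmetrization) gives the lower bound and Vitali coverings give the upper bound; small
  caps of the sphere are compared with their tangent spaces by central projection.
\<close>

subsection \<open>Steiner symmetrization and the isodiametric inequality\<close>

text \<open>The Gaussian is chosen because exp (- |x|^2) is at once radial and a product over
  orthogonal subspaces. Its radial integral with weight t^(s-1) is Gamma (s/2) / 2 = pi^(s/2) /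
  \<omega>_s, and homogeneity of degree r raises s from n to n + r on the whole sphere and from m to
  m + r on that of L. The powers of pi cancel, which leaves the quotient in \<gamma>_m. The two
  spheres carry Hausdorff measures of different dimensions, whose normalisations would not cancel;
  this forces the exact comparison with Lebesgue measure. A second obstacle lies in the definitions.
  The intensity and section measures come from \<open>measure_of\<close>, which has the stated
  values only once these are known to be countably additive, and this needs measurability of the
  sets of parameters of flats. The Poisson property prescribes distributions only on sets of finite
  intensity, so expectations are obtained by exhaustion with the hyperplanes that hit a ball; their
  intensity is finite because r > 0.\<close>

definition steiner :: "'i set \<Rightarrow> 'i \<Rightarrow> ('i \<Rightarrow> real) set \<Rightarrow> ('i \<Rightarrow> real) set" where
  "steiner I i A =
    {f \<in> space (Pi\<^sub>M I (\<lambda>_. lborel)). ennreal (2 * \<bar>f i\<bar>) < emeasure lborel {t. f(i := t) \<in> A}}"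

lemma fun_upd_in_space_PiM:
  assumes "f \<in> space (Pi\<^sub>M I (\<lambda>_. lborel :: real measure))" "i \<in> I"
  shows "f(i := t) \<in> space (Pi\<^sub>M I (\<lambda>_. lborel))"
  using assms by (auto simp: space_PiM PiE_def extensional_def)

lemma measurable_line_section:
  assumes "i \<in> I" and A: "A \<in> sets (Pi\<^sub>M I (\<lambda>_. lborel :: real measure))"
  shows "(\<lambda>f. emeasure lborel {t. f(i := t) \<in> A}) \<in> borel_measurable (Pi\<^sub>M I (\<lambda>_. lborel))"
    and "f \<in> space (Pi\<^sub>M I (\<lambda>_. lborel)) \<Longrightarrow> {t. f(i := t) \<in> A} \<in> sets lborel"
proof -
  let ?P = "Pi\<^sub>M I (\<lambda>_. lborel :: real measure)"
  let ?u = "\<lambda>(f, t). f(i := t)"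
  \<comment> \<open>Since \<open>i\<close> already lies in \<open>I\<close>, adding the coordinate
    \<open>i\<close> overwrites its value.\<close>
  have m: "?u \<in> measurable (?P \<Otimes>\<^sub>M lborel) ?P"
    using measurable_add_dim[of i I "\<lambda>_. lborel"] \<open>i \<in> I\<close> by (simp add: insert_absorb)
  let ?Q = "?u -` A \<inter> space (?P \<Otimes>\<^sub>M lborel)"
  have Q: "?Q \<in> sets (?P \<Otimes>\<^sub>M lborel)" by (rule measurable_sets[OF m A])
  have eq: "Pair f -` ?Q = {t. f(i := t) \<in> A}" if "f \<in> space ?P" for f
    using that by (auto simp: space_pair_measure)
  have "(\<lambda>f. emeasure lborel (Pair f -` ?Q)) \<in> borel_measurable ?P"
    by (rule sigma_finite_measure.measurable_emeasure_Pair[OF sigma_finite_lborel Q])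
  then show "(\<lambda>f. emeasure lborel {t. f(i := t) \<in> A}) \<in> borel_measurable ?P"
    by (rule measurable_cong[THEN iffD1, rotated]) (simp only: eq)
  show "{t. f(i := t) \<in> A} \<in> sets lborel" if "f \<in> space ?P"
    using sets_Pair1[OF Q, of f] eq[OF that] by simp
qed

lemma sets_steiner:
  assumes "i \<in> I" "A \<in> sets (Pi\<^sub>M I (\<lambda>_. lborel :: real measure))"
  shows "steiner I i A \<in> sets (Pi\<^sub>M I (\<lambda>_. lborel))"
proof -
  have [measurable]: "(\<lambda>f. emeasure lborel {t. f(i := t) \<in> A})
      \<in> borel_measurable (Pi\<^sub>M I (\<lambda>_. lborel))"
    using measurable_line_section(1)[OF assms] .
  have [measurable]: "(\<lambda>f. f i) \<in> borel_measurable (Pi\<^sub>M I (\<lambda>_. lborel :: real measure))"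
    using measurable_component_singleton[of i I "\<lambda>_. lborel :: real measure"] \<open>i \<in> I\<close>
    by simp
  show ?thesis unfolding steiner_def by measurable
qed

text \<open>The strict inequality in \<open>steiner\<close> lets one formula serve all section
  lengths: length 0 yields the empty set, infinite length the whole line.\<close>

lemma emeasure_centered_interval:
  "emeasure lborel {t::real. ennreal (2 * \<bar>t\<bar>) < a} = a"
proof (cases a)
  case (real b)
  have "{t::real. ennreal (2 * \<bar>t\<bar>) < a} = {- b/2 <..< b/2}"
    using real by (auto simp: ennreal_less_iff)
  then show ?thesis using real by simp
next
  case top
  then show ?thesis by simp
qed

lemma emeasure_PiM_insert:
  assumes "finite J" "i \<notin> J" and A: "A \<in> sets (Pi\<^sub>M (insert i J) (\<lambda>_. lborel :: real measure))"
  shows "emeasure (Pi\<^sub>M (insert i J) (\<lambda>_. lborel)) A =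
    (\<integral>\<^sup>+f. emeasure lborel {t. f(i := t) \<in> A} \<partial>Pi\<^sub>M J (\<lambda>_. lborel))"
proof -
  interpret product_sigma_finite "\<lambda>_. lborel :: real measure" by standard
  have "emeasure (Pi\<^sub>M (insert i J) (\<lambda>_. lborel)) A =
      (\<integral>\<^sup>+f. indicator A f \<partial>Pi\<^sub>M (insert i J) (\<lambda>_. lborel))"
    using A by simp
  also have "\<dots> = (\<integral>\<^sup>+f. (\<integral>\<^sup>+t. indicator A (f(i := t)) \<partial>lborel) \<partial>Pi\<^sub>M J (\<lambda>_. lborel))"
    using assms by (intro product_nn_integral_insert) auto
  also have "\<dots> = (\<integral>\<^sup>+f. emeasure lborel {t. f(i := t) \<in> A} \<partial>Pi\<^sub>M J (\<lambda>_. lborel))"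
  proof (rule nn_integral_cong)
    fix f :: "'a \<Rightarrow> real" assume f: "f \<in> space (Pi\<^sub>M J (\<lambda>_. lborel))"
    \<comment> \<open>\<open>f\<close> has no coordinate \<open>i\<close>; any value there makes the
      lemma on line sections applicable, because the section overwrites it.\<close>
    have "f(i := 0) \<in> space (Pi\<^sub>M (insert i J) (\<lambda>_. lborel :: real measure))"
      using f by (auto simp: space_PiM PiE_def extensional_def)
    from measurable_line_section(2)[OF _ A this, of i]
    have "{t. f(i := t) \<in> A} \<in> sets lborel" by simp
    then have "emeasure lborel {t. f(i := t) \<in> A} =
        (\<integral>\<^sup>+t. indicator {t. f(i := t) \<in> A} t \<partial>lborel)" by simp
    then show "(\<integral>\<^sup>+t. indicator A (f(i := t)) \<partial>lborel) = emeasure lborel {t. f(i := t) \<in> A}"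
      by (simp add: indicator_def)
  qed
  finally show ?thesis .
qed

text \<open>Fubini in the direction \<open>i\<close>: each line section is replaced by a centred
  interval of the same length.\<close>

lemma emeasure_steiner:
  assumes "finite I" "i \<in> I" and A: "A \<in> sets (Pi\<^sub>M I (\<lambda>_. lborel :: real measure))"
  shows "emeasure (Pi\<^sub>M I (\<lambda>_. lborel)) (steiner I i A) = emeasure (Pi\<^sub>M I (\<lambda>_. lborel)) A"
proof -
  define J where "J = I - {i}"
  have J: "finite J" "i \<notin> J" "I = insert i J" using assms by (auto simp: J_def)
  have "{t. f(i := t) \<in> steiner I i A} = {t. ennreal (2 * \<bar>t\<bar>) < emeasure lborel {t. f(i := t) \<in> A}}"
    if "f \<in> space (Pi\<^sub>M J (\<lambda>_. lborel))" for f
    using that by (auto simp: steiner_def J space_PiM PiE_def extensional_def)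
  then show ?thesis
    using sets_steiner[OF \<open>i \<in> I\<close> A] A J
    by (simp add: emeasure_PiM_insert emeasure_centered_interval cong: nn_integral_cong)
qed

text \<open>If \<open>T\<close> spans an interval of length \<open>l\<close>, the intervals of radius \<open>R\<close> about the points of \<open>T\<close>
  intersect in an interval of length \<open>2 * R - l\<close>, which contains \<open>S\<close>.\<close>

lemma emeasure_add_le_of_dist_le:
  fixes S T :: "real set"
  assumes "\<And>s t. s \<in> S \<Longrightarrow> t \<in> T \<Longrightarrow> \<bar>s - t\<bar> \<le> R" and "S \<noteq> {}" "T \<noteq> {}" and "0 \<le> R"
  shows "emeasure lborel S + emeasure lborel T \<le> ennreal (2 * R)"
proof -
  obtain s0 t0 where s0: "s0 \<in> S" and t0: "t0 \<in> T" using assms by auto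
  have bdd: "bdd_above T" "bdd_below T"
    using assms(1)[OF s0] by (auto intro!: bdd_aboveI[of _ "s0 + R"] bdd_belowI[of _ "s0 - R"])
      (smt (verit))+
  have T: "T \<subseteq> {Inf T..Sup T}" using bdd by (auto intro: cInf_lower cSup_upper)
  have "s \<le> Inf T + R" if "s \<in> S" for s
  proof -
    have "s - R \<le> Inf T" by (rule cInf_greatest[OF assms(3)]) (use assms(1)[OF that] in force)
    then show ?thesis by simp
  qed
  moreover have "Sup T - R \<le> s" if "s \<in> S" for s
  proof -
    have "Sup T \<le> s + R" by (rule cSup_least[OF assms(3)]) (use assms(1)[OF that] in force)
    then show ?thesis by simp
  qed
  ultimately have S: "S \<subseteq> {Sup T - R..Inf T + R}" by auto
  have le: "Sup T - R \<le> Inf T + R" "Inf T \<le> Sup T" using S T s0 t0 by force+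
  have "emeasure lborel S + emeasure lborel T
      \<le> emeasure lborel {Sup T - R..Inf T + R} + emeasure lborel {Inf T..Sup T}"
    by (intro add_mono emeasure_mono S T) auto
  also have "\<dots> = ennreal (2 * R)"
    using le by (simp flip: ennreal_plus)
  finally show ?thesis .
qed

text \<open>Off the coordinate \<open>i\<close> the two points contribute a fixed amount q, so
  points of the line sections of \<open>A\<close> through \<open>f\<close> and \<open>g\<close>
  differ by at most R = sqrt (D^2 - q). The section lengths therefore add up to at most 2 R, and the
  centred intervals reach half these lengths, which gives |f i| + |g i| \<le> R.\<close>

lemma steiner_dist_le:
  assumes "finite I" "i \<in> I" "0 \<le> D"
    and diam: "\<And>f g. f \<in> A \<Longrightarrow> g \<in> A \<Longrightarrow> (\<Sum>j\<in>I. (f j - g j)\<^sup>2) \<le> D\<^sup>2"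
    and f: "f \<in> steiner I i A" and g: "g \<in> steiner I i A"
  shows "(\<Sum>j\<in>I. (f j - g j)\<^sup>2) \<le> D\<^sup>2"
proof -
  define q where "q = (\<Sum>j\<in>I - {i}. (f j - g j)\<^sup>2)"
  have split: "(\<Sum>j\<in>I. (h j - k j)\<^sup>2) = (h i - k i)\<^sup>2 + (\<Sum>j\<in>I - {i}. (h j - k j)\<^sup>2)"
    for h k :: "'a \<Rightarrow> real"
    using assms by (simp add: sum.remove)
  define S where "S = {t. f(i := t) \<in> A}"
  define T where "T = {t. g(i := t) \<in> A}"
  have fS: "ennreal (2 * \<bar>f i\<bar>) < emeasure lborel S" and gT: "ennreal (2 * \<bar>g i\<bar>) < emeasure lborel T"
    using f g by (auto simp: steiner_def S_def T_def)
  then have ne: "S \<noteq> {}" "T \<noteq> {}" by auto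
  have *: "(s - t)\<^sup>2 \<le> D\<^sup>2 - q" if "s \<in> S" "t \<in> T" for s t
  proof -
    have "(\<Sum>j\<in>I - {i}. ((f(i := s)) j - (g(i := t)) j)\<^sup>2) = q"
      unfolding q_def by (rule sum.cong) auto
    then show ?thesis
      using diam[of "f(i := s)" "g(i := t)"] that split[of "f(i := s)" "g(i := t)"]
      by (simp add: S_def T_def)
  qed
  define R where "R = sqrt (D\<^sup>2 - q)"
  have q: "0 \<le> D\<^sup>2 - q" using * ne by (metis all_not_in_conv order_trans zero_le_power2)
  have "\<bar>s - t\<bar> \<le> R" if "s \<in> S" "t \<in> T" for s t
    using *[OF that] unfolding R_def by (metis real_sqrt_abs real_sqrt_le_iff)
  then have "emeasure lborel S + emeasure lborel T \<le> ennreal (2 * R)"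
    using ne q by (intro emeasure_add_le_of_dist_le) (auto simp: R_def)
  moreover have "ennreal (2 * \<bar>f i\<bar>) + ennreal (2 * \<bar>g i\<bar>) \<le> emeasure lborel S + emeasure lborel T"
    using fS gT by (intro add_mono) auto
  ultimately have "ennreal (2 * \<bar>f i\<bar> + 2 * \<bar>g i\<bar>) \<le> ennreal (2 * R)"
    by simp
  then have "2 * \<bar>f i\<bar> + 2 * \<bar>g i\<bar> \<le> 2 * R"
    by (subst (asm) ennreal_le_iff) (use q in \<open>auto simp: R_def\<close>)
  then have "\<bar>f i - g i\<bar> \<le> R" by linarith
  then have "(f i - g i)\<^sup>2 \<le> D\<^sup>2 - q"
    using q unfolding R_def by (metis abs_ge_zero power2_abs power_mono real_sqrt_pow2)
  then show ?thesis by (simp add: split q_def)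
qed

definition flip_coord :: "'i \<Rightarrow> ('i \<Rightarrow> real) \<Rightarrow> ('i \<Rightarrow> real)" where
  "flip_coord i f = f(i := - f i)"

lemma flip_coord_steiner_self: "i \<in> I \<Longrightarrow> f \<in> steiner I i A \<Longrightarrow> flip_coord i f \<in> steiner I i A"
  by (simp add: steiner_def flip_coord_def fun_upd_in_space_PiM)

text \<open>Symmetries gained earlier survive a later symmetrization: for a set invariant under the
  flip of \<open>j\<close>, the sections in direction \<open>i\<close> at \<open>f\<close> and at
  its mirror image coincide.\<close>

lemma flip_coord_steiner:
  assumes "i \<in> I" "j \<in> I" "i \<noteq> j" and "\<And>f. f \<in> A \<Longrightarrow> flip_coord j f \<in> A" and f: "f \<in> steiner I i A"
  shows "flip_coord j f \<in> steiner I i A"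
proof -
  have "flip_coord j (flip_coord j h) = h" for h by (simp add: flip_coord_def)
  then have iff: "flip_coord j h \<in> A \<longleftrightarrow> h \<in> A" for h using assms(4) by metis
  have "(flip_coord j f)(i := t) = flip_coord j (f(i := t))" for t
    using \<open>i \<noteq> j\<close> by (auto simp: flip_coord_def fun_eq_iff)
  then have "{t. (flip_coord j f)(i := t) \<in> A} = {t. f(i := t) \<in> A}" using iff by simp
  then show ?thesis using f assms(1-3)
    by (auto simp: steiner_def flip_coord_def fun_upd_in_space_PiM)
qed

lemma exists_symmetrization:
  assumes "finite I" "K \<subseteq> I" "0 \<le> D"
    and A: "A \<in> sets (Pi\<^sub>M I (\<lambda>_. lborel :: real measure))"
    and diam: "\<And>f g. f \<in> A \<Longrightarrow> g \<in> A \<Longrightarrow> (\<Sum>j\<in>I. (f j - g j)\<^sup>2) \<le> D\<^sup>2"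
  shows "\<exists>B \<in> sets (Pi\<^sub>M I (\<lambda>_. lborel)).
    emeasure (Pi\<^sub>M I (\<lambda>_. lborel)) B = emeasure (Pi\<^sub>M I (\<lambda>_. lborel)) A \<and>
    (\<forall>f\<in>B. \<forall>g\<in>B. (\<Sum>j\<in>I. (f j - g j)\<^sup>2) \<le> D\<^sup>2) \<and> (\<forall>k\<in>K. \<forall>f\<in>B. flip_coord k f \<in> B)"
proof -
  have "finite K" using assms(1,2) by (rule finite_subset[rotated])
  then show ?thesis using \<open>K \<subseteq> I\<close>
  proof (induction K)
    case empty
    then show ?case using A diam by auto
  next
    case (insert i K)
    then obtain B where B: "B \<in> sets (Pi\<^sub>M I (\<lambda>_. lborel))"
      "emeasure (Pi\<^sub>M I (\<lambda>_. lborel)) B = emeasure (Pi\<^sub>M I (\<lambda>_. lborel)) A"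
      "\<And>f g. f \<in> B \<Longrightarrow> g \<in> B \<Longrightarrow> (\<Sum>j\<in>I. (f j - g j)\<^sup>2) \<le> D\<^sup>2"
      "\<And>k f. k \<in> K \<Longrightarrow> f \<in> B \<Longrightarrow> flip_coord k f \<in> B" by auto
    have i: "i \<in> I" using insert by auto
    show ?case
    proof (intro bexI[of _ "steiner I i B"] conjI ballI)
      show "emeasure (Pi\<^sub>M I (\<lambda>_. lborel)) (steiner I i B) = emeasure (Pi\<^sub>M I (\<lambda>_. lborel)) A"
        using emeasure_steiner[OF \<open>finite I\<close> i B(1)] B(2) by simp
      show "(\<Sum>j\<in>I. (f j - g j)\<^sup>2) \<le> D\<^sup>2" if "f \<in> steiner I i B" "g \<in> steiner I i B" for f g
        using steiner_dist_le[OF \<open>finite I\<close> i \<open>0 \<le> D\<close> B(3)] that by blast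
      show "flip_coord k f \<in> steiner I i B" if "k \<in> insert i K" "f \<in> steiner I i B" for k f
        using that flip_coord_steiner_self[OF i] flip_coord_steiner[OF i, of k B f] B(4) insert
        by (cases "k = i") auto
      show "steiner I i B \<in> sets (Pi\<^sub>M I (\<lambda>_. lborel))" by (rule sets_steiner[OF i B(1)])
    qed
  qed
qed

text \<open>A set of diameter D need not fit into a ball of radius D/2, but a symmetric one does:
  once every coordinate has been symmetrized, the set contains with \<open>f\<close> also its
  negative, and these are 2 |f| apart.\<close>

lemma isodiametric_PiM:
  assumes "finite I" "0 \<le> D"
    and A: "A \<in> sets (Pi\<^sub>M I (\<lambda>_. lborel :: real measure))"
    and diam: "\<And>f g. f \<in> A \<Longrightarrow> g \<in> A \<Longrightarrow> (\<Sum>j\<in>I. (f j - g j)\<^sup>2) \<le> D\<^sup>2"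
  shows "emeasure (Pi\<^sub>M I (\<lambda>_. lborel)) A \<le> ennreal (unit_ball_vol (real (card I)) * (D / 2) ^ card I)"
proof -
  let ?P = "Pi\<^sub>M I (\<lambda>_. lborel :: real measure)"
  obtain B where B: "B \<in> sets ?P" "emeasure ?P B = emeasure ?P A"
    "\<And>f g. f \<in> B \<Longrightarrow> g \<in> B \<Longrightarrow> (\<Sum>j\<in>I. (f j - g j)\<^sup>2) \<le> D\<^sup>2"
    "\<And>k f. k \<in> I \<Longrightarrow> f \<in> B \<Longrightarrow> flip_coord k f \<in> B"
    using exists_symmetrization[OF assms(1) subset_refl assms(2-4)] by blast
  \<comment> \<open>Only flips of single coordinates are available; composing them up to
    \<open>K = I\<close> gives the negative of \<open>f\<close> on \<open>I\<close>, with the values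
    outside \<open>I\<close> untouched.\<close>
  have neg: "(\<lambda>j. if j \<in> K then - f j else f j) \<in> B" if "f \<in> B" "finite K" "K \<subseteq> I" for f K
    using that(2,3)
  proof (induction K)
    case empty
    then show ?case using that by simp
  next
    case (insert k K)
    then have "flip_coord k (\<lambda>j. if j \<in> K then - f j else f j) \<in> B" using B(4) by auto
    also have "flip_coord k (\<lambda>j. if j \<in> K then - f j else f j) = (\<lambda>j. if j \<in> insert k K then - f j else f j)"
      using insert by (auto simp: flip_coord_def fun_eq_iff)
    finally show ?case .
  qed
  have norm: "sqrt (\<Sum>j\<in>I. (f j)\<^sup>2) \<le> D / 2" if "f \<in> B" for f
  proof -
    have "4 * (\<Sum>j\<in>I. (f j)\<^sup>2) = (\<Sum>j\<in>I. (f j - (if j \<in> I then - f j else f j))\<^sup>2)"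
      by (simp add: sum_distrib_left power2_eq_square algebra_simps)
    also have "\<dots> \<le> D\<^sup>2" using B(3)[OF that neg[OF that \<open>finite I\<close> subset_refl]] .
    finally have "(\<Sum>j\<in>I. (f j)\<^sup>2) \<le> (D / 2)\<^sup>2" by (simp add: power_divide)
    then show ?thesis using \<open>0 \<le> D\<close> by (intro real_le_lsqrt) (auto intro: sum_nonneg)
  qed
  \<comment> \<open>The volume formula for balls requires a positive radius, while \<open>D\<close>
    may be 0; hence larger radii and a limit.\<close>
  have le: "emeasure ?P B \<le> ennreal (unit_ball_vol (real (card I)) * \<rho> ^ card I)"
    if "D / 2 < \<rho>" for \<rho>
  proof -
    have "B \<subseteq> {f. sqrt (\<Sum>i\<in>I. (f i)\<^sup>2) \<le> \<rho>} \<inter> space ?P"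
      using norm that sets.sets_into_space[OF B(1)] by fastforce
    then have "emeasure ?P B \<le> emeasure ?P ({f. sqrt (\<Sum>i\<in>I. (f i)\<^sup>2) \<le> \<rho>} \<inter> space ?P)"
      by (rule emeasure_mono) measurable
    also have "\<dots> = ennreal (unit_ball_vol (real (card I)) * \<rho> ^ card I)"
      using that \<open>0 \<le> D\<close> by (intro emeasure_cball_aux[OF \<open>finite I\<close>]) auto
    finally show ?thesis .
  qed
  have "((\<lambda>\<rho>. ennreal (unit_ball_vol (real (card I)) * \<rho> ^ card I)) \<longlongrightarrow>
      ennreal (unit_ball_vol (real (card I)) * (D / 2) ^ card I)) (at_right (D / 2))"
    by (intro tendsto_ennrealI tendsto_intros)
  then have "emeasure ?P B \<le> ennreal (unit_ball_vol (real (card I)) * (D / 2) ^ card I)"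
    by (rule tendsto_lowerbound) (auto simp: eventually_at_right_less intro!: le eventually_mono[OF eventually_at_right_less])
  then show ?thesis using B(2) by simp
qed

subsection \<open>Lebesgue measure on a subspace as Hausdorff measure\<close>

definition orthonormal :: "'a::euclidean_space set \<Rightarrow> bool" where
  "orthonormal I \<longleftrightarrow> finite I \<and> pairwise orthogonal I \<and> (\<forall>b\<in>I. norm b = 1)"

definition coord_comb :: "'a::euclidean_space set \<Rightarrow> ('a \<Rightarrow> real) \<Rightarrow> 'a" where
  "coord_comb I f = (\<Sum>b\<in>I. f b *\<^sub>R b)"

text \<open>Lebesgue measure of the subspace \<open>span I\<close>, as a Borel measure on the whole
  space that is concentrated on \<open>span I\<close>; the basis vectors index their own
  coordinates. For \<open>I = {}\<close> it is the unit mass at 0. It depends on the span only, by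
  \<open>span_lborel_cong_span\<close>.\<close>

definition span_lborel :: "'a::euclidean_space set \<Rightarrow> 'a measure" where
  "span_lborel I = distr (Pi\<^sub>M I (\<lambda>_. lborel)) borel (coord_comb I)"

lemma sets_span_lborel [simp, measurable_cong]: "sets (span_lborel I) = sets borel"
  by (simp add: span_lborel_def)

lemma space_span_lborel [simp]: "space (span_lborel I) = UNIV"
  by (simp add: span_lborel_def)

lemma measurable_coord_comb [measurable]:
  "coord_comb I \<in> borel_measurable (Pi\<^sub>M I (\<lambda>_. lborel))"
proof -
  have [measurable]: "(\<lambda>f. f b) \<in> borel_measurable (Pi\<^sub>M I (\<lambda>_. lborel :: real measure))"
    if "b \<in> I" for b
    using measurable_component_singleton[of b I "\<lambda>_. lborel :: real measure"] that by simp
  show ?thesis unfolding coord_comb_def[abs_def] by measurable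
qed

lemma orthonormal_inner:
  assumes "orthonormal I" "b \<in> I" "c \<in> I"
  shows "b \<bullet> c = (if b = c then 1 else 0)"
  using assms by (auto simp: orthonormal_def pairwise_def orthogonal_def norm_eq_1)

lemma orthonormal_independent: "orthonormal I \<Longrightarrow> independent I"
  by (rule pairwise_orthogonal_independent) (auto simp: orthonormal_def)

lemma orthonormal_dim: "orthonormal I \<Longrightarrow> dim (span I) = card I"
  by (simp add: orthonormal_independent dim_eq_card_independent)

lemma coord_comb_in_span: "coord_comb I f \<in> span I"
  unfolding coord_comb_def by (intro span_sum span_scale span_base)

lemma coord_comb_inner:
  assumes "orthonormal I" "b \<in> I"
  shows "coord_comb I f \<bullet> b = f b"
proof -
  have "coord_comb I f \<bullet> b = (\<Sum>c\<in>I. if c = b then f c else 0)"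
    unfolding coord_comb_def inner_sum_left
    by (rule sum.cong) (simp_all add: orthonormal_inner[OF assms(1) _ assms(2)])
  also have "\<dots> = f b" using assms by (simp add: orthonormal_def)
  finally show ?thesis .
qed

lemma coord_comb_of_span:
  assumes "orthonormal I" "x \<in> span I"
  shows "coord_comb I (\<lambda>b. x \<bullet> b) = x"
  unfolding coord_comb_def using assms by (intro orthonormal_basis_expand) (auto simp: orthonormal_def)

lemma norm_coord_comb:
  assumes "orthonormal I"
  shows "(norm (coord_comb I f))\<^sup>2 = (\<Sum>b\<in>I. (f b)\<^sup>2)"
proof -
  have "(norm (coord_comb I f))\<^sup>2 = (\<Sum>b\<in>I. f b * (coord_comb I f \<bullet> b))"
    unfolding power2_norm_eq_inner by (subst (2) coord_comb_def) (simp add: inner_sum_right)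
  also have "\<dots> = (\<Sum>b\<in>I. (f b)\<^sup>2)"
    by (rule sum.cong) (simp_all add: coord_comb_inner[OF assms] power2_eq_square)
  finally show ?thesis .
qed

lemma coord_comb_diff: "coord_comb I f - coord_comb I g = coord_comb I (\<lambda>b. f b - g b)"
  by (simp add: coord_comb_def sum_subtractf scaleR_diff_left)

lemma dist_coord_comb:
  "orthonormal I \<Longrightarrow> (dist (coord_comb I f) (coord_comb I g))\<^sup>2 = (\<Sum>b\<in>I. (f b - g b)\<^sup>2)"
  by (simp add: dist_norm coord_comb_diff norm_coord_comb)

lemma emeasure_span_lborel:
  "A \<in> sets borel \<Longrightarrow> emeasure (span_lborel I) A =
    emeasure (Pi\<^sub>M I (\<lambda>_. lborel)) (coord_comb I -` A \<inter> space (Pi\<^sub>M I (\<lambda>_. lborel)))"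
  unfolding span_lborel_def by (rule emeasure_distr) auto

lemma borel_span [measurable, simp]: "span (S :: 'a::euclidean_space set) \<in> sets borel"
  by (intro borel_closed closed_subspace) auto

lemma emeasure_span_lborel_Int_span:
  assumes "A \<in> sets borel"
  shows "emeasure (span_lborel I) (A \<inter> span I) = emeasure (span_lborel I) A"
proof -
  have "coord_comb I -` (A \<inter> span I) = coord_comb I -` A"
    using coord_comb_in_span by auto
  moreover have "A \<inter> span I \<in> sets borel" using assms by (intro sets.Int borel_span)
  ultimately show ?thesis using assms by (simp add: emeasure_span_lborel)
qed

lemma distr_PiM_lborel_translate:
  fixes c :: "'i \<Rightarrow> real"
  assumes "finite I"
  shows "distr (Pi\<^sub>M I (\<lambda>_. lborel)) (Pi\<^sub>M I (\<lambda>_. lborel)) (\<lambda>f. \<lambda>i\<in>I. f i + c i) = Pi\<^sub>M I (\<lambda>_. lborel)"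
proof -
  interpret product_sigma_finite "\<lambda>_::'i. lborel :: real measure" by standard
  have m [measurable]: "(\<lambda>f. \<lambda>i\<in>I. f i + c i) \<in> measurable (Pi\<^sub>M I (\<lambda>_. lborel)) (Pi\<^sub>M I (\<lambda>_. lborel))"
    by measurable
  show ?thesis
  proof (rule PiM_eqI[OF assms])
    fix A :: "'i \<Rightarrow> real set" assume A: "\<And>i. i \<in> I \<Longrightarrow> A i \<in> sets lborel"
    have eq: "(\<lambda>f. \<lambda>i\<in>I. f i + c i) -` Pi\<^sub>E I A \<inter> space (Pi\<^sub>M I (\<lambda>_. lborel)) =
        Pi\<^sub>E I (\<lambda>i. (\<lambda>x. x + c i) -` A i)"
      by (auto simp: space_PiM PiE_def Pi_def extensional_def restrict_def)
    have A': "(\<lambda>x. x + c i) -` A i \<in> sets lborel" if "i \<in> I" for i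
      using measurable_sets[of "\<lambda>x. x + c i" lborel lborel "A i"] A[OF that] by simp
    have "emeasure (distr (Pi\<^sub>M I (\<lambda>_. lborel)) (Pi\<^sub>M I (\<lambda>_. lborel)) (\<lambda>f. \<lambda>i\<in>I. f i + c i)) (Pi\<^sub>E I A)
        = (\<Prod>i\<in>I. emeasure lborel ((\<lambda>x. x + c i) -` A i))"
      using A A' assms by (subst emeasure_distr[OF m]) (auto simp: eq intro: emeasure_PiM)
    also have "\<dots> = (\<Prod>i\<in>I. emeasure lborel (A i))"
    proof (rule prod.cong)
      fix i assume "i \<in> I"
      have "emeasure lborel (A i) = emeasure (distr lborel borel ((+) (c i))) (A i)"
        by (simp add: lborel_distr_plus)
      also have "\<dots> = emeasure lborel ((\<lambda>x. x + c i) -` A i)"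
        using A[OF \<open>i \<in> I\<close>] by (subst emeasure_distr) (auto simp: add.commute vimage_def)
      finally show "emeasure lborel ((\<lambda>x. x + c i) -` A i) = emeasure lborel (A i)" ..
    qed simp
    finally show "emeasure (distr (Pi\<^sub>M I (\<lambda>_. lborel)) (Pi\<^sub>M I (\<lambda>_. lborel)) (\<lambda>f. \<lambda>i\<in>I. f i + c i)) (Pi\<^sub>E I A)
        = (\<Prod>i\<in>I. emeasure lborel (A i))" .
  qed simp
qed

lemma emeasure_span_lborel_cball:
  assumes I: "orthonormal I" and x: "x \<in> span I" and "0 < \<rho>"
  shows "emeasure (span_lborel I) (cball x \<rho>) = ennreal (unit_ball_vol (real (card I)) * \<rho> ^ card I)"
proof -
  let ?P = "Pi\<^sub>M I (\<lambda>_. lborel :: real measure)"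
  let ?T = "\<lambda>f. \<lambda>b\<in>I. f b + (- (x \<bullet> b))"
  have fin: "finite I" using I by (simp add: orthonormal_def)
  let ?B = "{f. sqrt (\<Sum>i\<in>I. (f i)\<^sup>2) \<le> \<rho>} \<inter> space ?P"
  have B: "?B \<in> sets ?P" by measurable
  have T: "?T \<in> measurable ?P ?P" by measurable
  have "coord_comb I -` cball x \<rho> \<inter> space ?P = ?T -` ?B \<inter> space ?P"
  proof -
    have "coord_comb I f \<in> cball x \<rho> \<longleftrightarrow> sqrt (\<Sum>b\<in>I. (?T f b)\<^sup>2) \<le> \<rho>" for f
    proof -
      have "dist x (coord_comb I f) = sqrt ((dist (coord_comb I (\<lambda>b. x \<bullet> b)) (coord_comb I f))\<^sup>2)"
        by (simp add: coord_comb_of_span[OF I x])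
      also have "\<dots> = sqrt (\<Sum>b\<in>I. (?T f b)\<^sup>2)"
        unfolding dist_coord_comb[OF I]
        by (intro arg_cong[where f=sqrt] sum.cong) (auto simp: power2_eq_square algebra_simps)
      finally show ?thesis by simp
    qed
    moreover have "?T f \<in> space ?P" for f by (auto simp: space_PiM)
    ultimately show ?thesis by auto
  qed
  then have "emeasure (span_lborel I) (cball x \<rho>) = emeasure ?P (?T -` ?B \<inter> space ?P)"
    by (simp add: emeasure_span_lborel)
  also have "\<dots> = emeasure (distr ?P ?P ?T) ?B"
    by (rule emeasure_distr[OF T B, symmetric])
  also have "\<dots> = emeasure ?P ?B" unfolding distr_PiM_lborel_translate[OF fin] ..
  also have "\<dots> = ennreal (unit_ball_vol (real (card I)) * \<rho> ^ card I)"
    by (rule emeasure_cball_aux[OF fin \<open>0 < \<rho>\<close>])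
  finally show ?thesis .
qed

section \<open>Lower bound for Hausdorff measure by the isodiametric inequality\<close>

lemma hausdorff_gauge_nat:
  assumes "bounded U" "U \<noteq> {}"
  shows "hausdorff_gauge (real k) U = ennreal (unit_ball_vol (real k) * (diameter U / 2) ^ k)"
\<comment> \<open>Natural powers absorb the separate case of the gauge, as \<open>0 ^ 0 = 1\<close>
  and the unit ball of dimension 0 has volume 1.\<close>
proof (cases "k = 0")
  case True
  then show ?thesis using assms by (simp add: hausdorff_gauge_def unit_ball_vol_def)
next
  case False
  then show ?thesis using assms diameter_ge_0[OF assms(1)]
    by (simp add: hausdorff_gauge_def powr_realpow')
qed

lemma isodiametric_span_lborel:
  assumes I: "orthonormal I" and A: "A \<in> sets borel" "bounded A"
  shows "emeasure (span_lborel I) A \<le> hausdorff_gauge (real (card I)) A"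
proof (cases "A = {}")
  case False
  let ?P = "Pi\<^sub>M I (\<lambda>_. lborel :: real measure)"
  have "emeasure ?P (coord_comb I -` A \<inter> space ?P)
      \<le> ennreal (unit_ball_vol (real (card I)) * (diameter A / 2) ^ card I)"
  proof (rule isodiametric_PiM)
    show "coord_comb I -` A \<inter> space ?P \<in> sets ?P"
      using measurable_sets[OF measurable_coord_comb A(1)] .
    fix f g assume "f \<in> coord_comb I -` A \<inter> space ?P" "g \<in> coord_comb I -` A \<inter> space ?P"
    then have "dist (coord_comb I f) (coord_comb I g) \<le> diameter A"
      using A(2) by (auto intro: diameter_bounded_bound)
    then show "(\<Sum>j\<in>I. (f j - g j)\<^sup>2) \<le> (diameter A)\<^sup>2"
      unfolding dist_coord_comb[OF I, symmetric] by (intro power_mono) auto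
  qed (use I A in \<open>auto simp: orthonormal_def diameter_ge_0\<close>)
  then show ?thesis using A False by (simp add: emeasure_span_lborel hausdorff_gauge_nat)
qed simp

lemma span_lborel_le_hausdorff_outer:
  assumes I: "orthonormal I" and A: "A \<in> sets borel"
  shows "emeasure (span_lborel I) A \<le> hausdorff_outer (real (card I)) A"
proof -
  \<comment> \<open>The isodiametric inequality holds for sets of every size, so any mesh serves; 1
    is arbitrary.\<close>
  have "emeasure (span_lborel I) A \<le> hausdorff_content (real (card I)) 1 A"
    unfolding hausdorff_content_def
  proof (safe intro!: INF_greatest)
    fix U :: "nat \<Rightarrow> 'a set"
    assume cov: "A \<subseteq> (\<Union>i. U i)" and U: "\<forall>i. bounded (U i) \<and> diameter (U i) \<le> 1"
    \<comment> \<open>Covering sets need not be Borel; their closures are, and have the same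
      diameter.\<close>
    have "emeasure (span_lborel I) A \<le> emeasure (span_lborel I) (\<Union>i. closure (U i))"
      using order_trans[OF cov UN_mono[OF subset_refl closure_subset]]
      by (intro emeasure_mono) auto
    also have "\<dots> \<le> (\<Sum>i. emeasure (span_lborel I) (closure (U i)))"
      by (rule emeasure_subadditive_countably) auto
    also have "\<dots> \<le> (\<Sum>i. hausdorff_gauge (real (card I)) (U i))"
    proof (rule suminf_le)
      fix i
      have "emeasure (span_lborel I) (closure (U i)) \<le> hausdorff_gauge (real (card I)) (closure (U i))"
        using U by (intro isodiametric_span_lborel[OF I]) auto
      also have "\<dots> = hausdorff_gauge (real (card I)) (U i)"
        using U by (simp add: hausdorff_gauge_def diameter_closure)
      finally show "emeasure (span_lborel I) (closure (U i)) \<le> hausdorff_gauge (real (card I)) (U i)" .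
    qed auto
    finally show "emeasure (span_lborel I) A \<le> (\<Sum>i. hausdorff_gauge (real (card I)) (U i))" .
  qed
  also have "\<dots> \<le> hausdorff_outer (real (card I)) A" by (rule hausdorff_content_le_outer) simp
  finally show ?thesis .
qed

section \<open>Upper bound for Hausdorff measure by Vitali coverings\<close>

text \<open>Radius \<open>-1\<close> pads the sequence with empty balls.\<close>

lemma Vitali_sequence:
  fixes U V :: "'a::euclidean_space set"
  assumes "open U" "0 < \<delta>"
  obtains a :: "nat \<Rightarrow> 'a" and r :: "nat \<Rightarrow> real"
  where "\<And>n. r n = -1 \<or> (a n \<in> V \<and> 0 < r n \<and> r n \<le> \<delta> \<and> cball (a n) (r n) \<subseteq> U)"
    "disjoint_family (\<lambda>n. cball (a n) (r n))" "U \<inter> V \<subseteq> (\<Union>n. cball (a n) (5 * r n))"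
proof -
  define K where "K = {(x, \<rho>). x \<in> V \<and> 0 < \<rho> \<and> \<rho> \<le> \<delta> \<and> cball x \<rho> \<subseteq> U}"
  have "U \<inter> V \<subseteq> (\<Union>i\<in>K. cball (fst i) (snd i))"
  proof
    fix x assume x: "x \<in> U \<inter> V"
    then obtain e where "0 < e" "cball x e \<subseteq> U" using \<open>open U\<close> open_contains_cball by blast
    then have "(x, min e \<delta>) \<in> K" using x \<open>0 < \<delta>\<close> by (auto simp: K_def)
    moreover have "x \<in> cball x (min e \<delta>)" using \<open>0 < e\<close> \<open>0 < \<delta>\<close> by simp
    ultimately show "x \<in> (\<Union>i\<in>K. cball (fst i) (snd i))" by force
  qed
  moreover have "0 < snd i \<and> snd i \<le> \<delta>" if "i \<in> K" for i using that by (auto simp: K_def)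
  ultimately obtain C where C: "countable C" "C \<subseteq> K"
      "pairwise (\<lambda>i j. disjnt (cball (fst i) (snd i)) (cball (fst j) (snd j))) C"
      "U \<inter> V \<subseteq> (\<Union>i\<in>C. cball (fst i) (5 * snd i))"
    by (rule Vitali_covering_lemma_cballs)
  define c where "c = from_nat_into C"
  define N where "N = to_nat_on C ` C"
  have c: "c n \<in> C" "to_nat_on C (c n) = n" if "n \<in> N" for n
    using that C(1) by (auto simp: N_def c_def)
  have cc: "c (to_nat_on C i) = i" if "i \<in> C" for i
    using that C(1) by (simp add: c_def)
  define a where "a n = fst (c n)" for n
  define r where "r n = (if n \<in> N then snd (c n) else -1)" for n
  show ?thesis
  proof (rule that[of r a])
    show "r n = -1 \<or> (a n \<in> V \<and> 0 < r n \<and> r n \<le> \<delta> \<and> cball (a n) (r n) \<subseteq> U)" for n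
          proof (cases "n \<in> N")
      case True
      then have "c n \<in> K" using c(1) C(2) by blast
      then show ?thesis using True by (auto simp: r_def a_def K_def)
    qed (simp add: r_def)
    show "disjoint_family (\<lambda>n. cball (a n) (r n))"
      unfolding disjoint_family_on_def
    proof (intro ballI impI)
      fix m n :: nat assume "m \<noteq> n"
      show "cball (a m) (r m) \<inter> cball (a n) (r n) = {}"
      proof (cases "m \<in> N \<and> n \<in> N")
        case True
        then have "c m \<noteq> c n" using c(2) \<open>m \<noteq> n\<close> by metis
        then show ?thesis using C(3) c(1) True
          by (auto simp: pairwise_def disjnt_def a_def r_def)
      qed (auto simp: r_def)
    qed
    show "U \<inter> V \<subseteq> (\<Union>n. cball (a n) (5 * r n))"
    proof
      fix x assume "x \<in> U \<inter> V"
      then obtain i where i: "i \<in> C" "x \<in> cball (fst i) (5 * snd i)" using C(4) by blast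
      then have "x \<in> cball (a (to_nat_on C i)) (5 * r (to_nat_on C i))"
        by (simp add: a_def r_def cc N_def)
      then show "x \<in> (\<Union>n. cball (a n) (5 * r n))" by blast
    qed
  qed
qed

text \<open>One round of the iteration below: the sets \<open>B n\<close> are the selected balls and
  \<open>C\<close> is the part still to be covered.\<close>

lemma hausdorff_content_le_finite:
  fixes N :: nat
  assumes "A \<subseteq> (\<Union>n<N. B n) \<union> C" "0 < \<delta>"
    and "\<And>n. n < N \<Longrightarrow> bounded (B n) \<and> diameter (B n) \<le> \<delta>"
  shows "hausdorff_content s \<delta> A \<le> (\<Sum>n<N. hausdorff_gauge s (B n)) + hausdorff_content s \<delta> C"
proof -
  define D where "D n = (if n < N then B n else if n = N then C else {})" for n
  have "A \<subseteq> (\<Union>n. D n)"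
  proof
    fix x assume "x \<in> A"
    then consider n where "n < N" "x \<in> B n" | "x \<in> C" using assms(1) by blast
    then show "x \<in> (\<Union>n. D n)"
    proof cases
      case 1
      then have "x \<in> D n" by (simp add: D_def)
      then show ?thesis by blast
    next
      case 2
      then have "x \<in> D N" by (simp add: D_def)
      then show ?thesis by blast
    qed
  qed
  then have "hausdorff_content s \<delta> A \<le> hausdorff_content s \<delta> (\<Union>n. D n)"
    by (rule hausdorff_content_mono)
  also have "\<dots> \<le> (\<Sum>n. hausdorff_content s \<delta> (D n))" by (rule hausdorff_content_subadditive)
  also have "\<dots> = (\<Sum>n\<in>{..N}. hausdorff_content s \<delta> (D n))"
    by (rule suminf_finite) (auto simp: D_def hausdorff_content_empty \<open>0 < \<delta>\<close>)
  also have "\<dots> = (\<Sum>n<N. hausdorff_content s \<delta> (B n)) + hausdorff_content s \<delta> C"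
    by (simp add: lessThan_Suc_atMost[symmetric] D_def)
  also have "\<dots> \<le> (\<Sum>n<N. hausdorff_gauge s (B n)) + hausdorff_content s \<delta> C"
  proof (intro add_right_mono sum_mono)
    fix n assume "n \<in> {..<N}"
    then have "hausdorff_content s \<delta> (B n) \<le> (\<Sum>i. hausdorff_gauge s (if i = 0 then B n else {}))"
      using assms(2,3) by (intro hausdorff_content_le) auto
    also have "\<dots> = hausdorff_gauge s (B n)"
      by (subst suminf_finite[of "{0::nat}"]) auto
    finally show "hausdorff_content s \<delta> (B n) \<le> hausdorff_gauge s (B n)" .
  qed
  finally show ?thesis .
qed

text \<open>
  Each Vitali selection fills at least the fraction \<open>q\<close> of an open set by small disjoint balls,
  for which the gauge and \<open>\<mu>\<close> agree; iterating on the remainder makes the error term arbitrarily small.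
\<close>

lemma hausdorff_content_open_le:
  fixes \<mu> :: "'a::euclidean_space measure"
  assumes sets: "sets \<mu> = sets borel"
    and conc: "V \<in> sets borel" "\<And>A. A \<in> sets borel \<Longrightarrow> emeasure \<mu> (A \<inter> V) = emeasure \<mu> A"
    and ball: "\<And>x \<rho>. x \<in> V \<Longrightarrow> 0 < \<rho> \<Longrightarrow> emeasure \<mu> (cball x \<rho>) = ennreal (unit_ball_vol (real k) * \<rho> ^ k)"
    and fin: "\<And>A. A \<in> sets borel \<Longrightarrow> bounded A \<Longrightarrow> emeasure \<mu> A < \<infinity>"
    and U: "open U" "bounded U" and "0 < \<delta>"
  shows "hausdorff_content (real k) \<delta> (U \<inter> V) \<le> emeasure \<mu> U"
proof -
  \<comment> \<open>The balls enlarged by the factor 5 cover, so the disjoint balls carry at least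
    the fraction 1 / 5^k of the measure. The additional factor 1/2 makes the inequality strict, so
    that a finite partial sum already attains it.\<close>
  define q :: real where "q = 1 / (2 * 5 ^ k)"
  have q: "0 < q" "q < 1" by (auto simp: q_def field_simps intro: less_le_trans[of _ 2])
  have gauge5: "hausdorff_gauge (real k) (cball x (5 * \<rho>)) \<le> ennreal (5 ^ k) * emeasure \<mu> (cball x \<rho>)"
      "emeasure \<mu> (cball x (5 * \<rho>)) \<le> ennreal (5 ^ k) * emeasure \<mu> (cball x \<rho>)"
      "hausdorff_gauge (real k) (cball x \<rho>) = emeasure \<mu> (cball x \<rho>)"
    if "\<rho> = -1 \<or> x \<in> V \<and> 0 < \<rho>" for x \<rho>
    using that by (auto simp: hausdorff_gauge_nat ball power_mult_distrib ennreal_mult'[symmetric] mult_ac)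
  have step: "\<exists>N (B :: nat \<Rightarrow> 'a set). (\<forall>n<N. bounded (B n) \<and> closed (B n) \<and> diameter (B n) \<le> \<delta> \<and> B n \<subseteq> U \<and>
        hausdorff_gauge (real k) (B n) = emeasure \<mu> (B n)) \<and>
      disjoint_family_on B {..<N} \<and> q * measure \<mu> U \<le> measure \<mu> (\<Union>n<N. B n)"
    and crude: "hausdorff_content (real k) \<delta> (U \<inter> V) \<le> ennreal (5 ^ k) * emeasure \<mu> U"
    if U: "open U" "bounded U" for U
  proof -
    \<comment> \<open>The enlarged balls have diameter at most ten times the radius of the original
      ones, and this has to stay below the mesh.\<close>
    have d10: "0 < \<delta> / 10" using \<open>0 < \<delta>\<close> by simp
    obtain a r where ar: "\<And>n. r n = -1 \<or> (a n \<in> V \<and> 0 < r n \<and> r n \<le> \<delta>/10 \<and> cball (a n) (r n) \<subseteq> U)"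
      and disj: "disjoint_family (\<lambda>n::nat. cball (a n) (r n))"
      and cov: "U \<inter> V \<subseteq> (\<Union>n. cball (a n) (5 * r n))"
      by (rule Vitali_sequence[OF U(1) d10, of V]) (rule that, assumption+)
    let ?B = "\<lambda>n. cball (a n) (r n)"
    have ar': "r n = -1 \<or> a n \<in> V \<and> 0 < r n" for n using ar by blast
    have sub: "?B n \<subseteq> U" for n using ar[of n] by auto
    have sum: "(\<Sum>n. emeasure \<mu> (?B n)) = emeasure \<mu> (\<Union>n. ?B n)"
      using disj by (intro suminf_emeasure) (auto simp: sets)
    also have "\<dots> \<le> emeasure \<mu> U" using sub U by (intro emeasure_mono) (auto simp: sets)
    finally have sum_le: "(\<Sum>n. emeasure \<mu> (?B n)) \<le> emeasure \<mu> U" .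
    have "hausdorff_content (real k) \<delta> (U \<inter> V) \<le> (\<Sum>n. hausdorff_gauge (real k) (cball (a n) (5 * r n)))"
    proof (rule hausdorff_content_le[OF cov])
      show "diameter (cball (a n) (5 * r n)) \<le> \<delta>" for n
        using ar[of n] \<open>0 < \<delta>\<close> by auto
    qed auto
    also have "\<dots> \<le> (\<Sum>n. ennreal (5 ^ k) * emeasure \<mu> (?B n))"
      using gauge5(1)[OF ar'] by (intro suminf_le) auto
    also have "\<dots> \<le> ennreal (5 ^ k) * emeasure \<mu> U"
      using sum_le by (simp add: mult_left_mono)
    finally show "hausdorff_content (real k) \<delta> (U \<inter> V) \<le> ennreal (5 ^ k) * emeasure \<mu> U" .
    have fU: "emeasure \<mu> U = ennreal (measure \<mu> U)"
      using fin[of U] U by (simp add: emeasure_eq_ennreal_measure)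
    have "emeasure \<mu> U = emeasure \<mu> (U \<inter> V)" using conc(2)[of U] U by simp
    also have "\<dots> \<le> emeasure \<mu> (\<Union>n. cball (a n) (5 * r n))"
      by (rule emeasure_mono[OF cov]) (auto simp: sets)
    also have "\<dots> \<le> (\<Sum>n. emeasure \<mu> (cball (a n) (5 * r n)))"
      by (intro emeasure_subadditive_countably) (auto simp: sets)
    also have "\<dots> \<le> (\<Sum>n. ennreal (5 ^ k) * emeasure \<mu> (?B n))"
      using gauge5(2)[OF ar'] by (intro suminf_le) auto
    finally have ge: "emeasure \<mu> U \<le> ennreal (5 ^ k) * (\<Sum>n. emeasure \<mu> (?B n))" by simp
    \<comment> \<open>Finitely many balls are wanted because removing finitely many closed balls
      leaves an open set, to which the selection can be applied again.\<close>
    have "\<exists>N. ennreal (q * measure \<mu> U) \<le> (\<Sum>n<N. emeasure \<mu> (?B n))"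
    proof (cases "measure \<mu> U = 0")
      case False
      then have pos: "0 < measure \<mu> U" by (simp add: zero_less_measure_iff)
      have "ennreal (q * measure \<mu> U) < (\<Sum>n. emeasure \<mu> (?B n))"
      proof (rule ccontr)
        assume "\<not> ?thesis"
        then have "(\<Sum>n. emeasure \<mu> (?B n)) \<le> ennreal (q * measure \<mu> U)" by simp
        with ge have "emeasure \<mu> U \<le> ennreal (5 ^ k) * ennreal (q * measure \<mu> U)"
          by (meson mult_left_mono order_trans zero_le)
        also have "\<dots> = ennreal (measure \<mu> U / 2)"
          by (simp add: ennreal_mult'[symmetric] q_def)
        finally show False using pos unfolding fU by (simp add: ennreal_le_iff2)
      qed
      then have "\<exists>N. ennreal (q * measure \<mu> U) < (\<Sum>n<N. emeasure \<mu> (?B n))"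
        by (subst (asm) suminf_eq_SUP) (auto simp: less_SUP_iff)
      then show ?thesis by (auto intro: less_imp_le)
    qed auto
    then obtain N where N: "ennreal (q * measure \<mu> U) \<le> (\<Sum>n<N. emeasure \<mu> (?B n))" by blast
    have dN: "disjoint_family_on ?B {..<N}" using disj by (auto simp: disjoint_family_on_def)
    have eqN: "(\<Sum>n<N. emeasure \<mu> (?B n)) = emeasure \<mu> (\<Union>n<N. ?B n)"
      using dN by (intro sum_emeasure) (auto simp: sets)
    have "emeasure \<mu> (\<Union>n<N. ?B n) < \<infinity>" by (intro fin) auto
    then have "emeasure \<mu> (\<Union>n<N. ?B n) = ennreal (measure \<mu> (\<Union>n<N. ?B n))"
      by (simp add: emeasure_eq_ennreal_measure)
    with N eqN have "q * measure \<mu> U \<le> measure \<mu> (\<Union>n<N. ?B n)"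
      by (metis ennreal_le_iff measure_nonneg)
    moreover have "diameter (?B n) \<le> \<delta>" for n using ar[of n] \<open>0 < \<delta>\<close> by auto
    ultimately show "\<exists>N (B :: nat \<Rightarrow> 'a set). (\<forall>n<N. bounded (B n) \<and> closed (B n) \<and> diameter (B n) \<le> \<delta> \<and> B n \<subseteq> U \<and>
        hausdorff_gauge (real k) (B n) = emeasure \<mu> (B n)) \<and>
      disjoint_family_on B {..<N} \<and> q * measure \<mu> U \<le> measure \<mu> (\<Union>n<N. B n)"
      using sub gauge5(3)[OF ar'] dN by (intro exI[of _ N] exI[of _ ?B]) auto
  qed
  \<comment> \<open>Selected balls are counted exactly; only what remains after \<open>j\<close>
    rounds, at most the fraction (1 - q)^j, is charged with the crude factor 5^k.\<close>
  have iter: "hausdorff_content (real k) \<delta> (U \<inter> V) \<le> ennreal ((1 + 5 ^ k * (1 - q) ^ j) * measure \<mu> U)"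
    if "open U" "bounded U" for U j
    using that
  proof (induction j arbitrary: U)
    case 0
    have "emeasure \<mu> U = ennreal (measure \<mu> U)"
      using fin[of U] 0 by (simp add: emeasure_eq_ennreal_measure)
    then have "ennreal (5 ^ k) * emeasure \<mu> U \<le> ennreal ((1 + 5 ^ k * (1 - q) ^ 0) * measure \<mu> U)"
      by (simp add: ennreal_mult'[symmetric] ennreal_le_iff algebra_simps)
    with crude[OF 0] show ?case by (rule order_trans)
  next
    case (Suc j)
    obtain N and B :: "nat \<Rightarrow> 'a set"
      where B: "\<And>n. n < N \<Longrightarrow> bounded (B n) \<and> closed (B n) \<and> diameter (B n) \<le> \<delta> \<and> B n \<subseteq> U \<and>
        hausdorff_gauge (real k) (B n) = emeasure \<mu> (B n)"
      and dN: "disjoint_family_on B {..<N}" and ge: "q * measure \<mu> U \<le> measure \<mu> (\<Union>n<N. B n)"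
      using step[OF Suc.prems] by blast
    define W where "W = (\<Union>n<N. B n)"
    have W: "closed W" "W \<subseteq> U" using B by (auto simp: W_def)
    have Wb: "bounded W" using W(2) Suc.prems(2) by (rule bounded_subset[rotated])
    have U': "open (U - W)" "bounded (U - W)"
      using Suc.prems W by (auto intro: open_Diff bounded_subset)
    have mW: "emeasure \<mu> W = ennreal (measure \<mu> W)"
      using fin[of W] W Wb by (simp add: emeasure_eq_ennreal_measure)
    have mD: "measure \<mu> (U - W) = measure \<mu> U - measure \<mu> W"
      using W Suc.prems fin[of U] by (intro measure_Diff) (auto simp: sets)
    have "hausdorff_content (real k) \<delta> (U \<inter> V)
        \<le> (\<Sum>n<N. hausdorff_gauge (real k) (B n)) + hausdorff_content (real k) \<delta> ((U - W) \<inter> V)"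
      using B \<open>0 < \<delta>\<close> by (intro hausdorff_content_le_finite) (auto simp: W_def)
    also have "(\<Sum>n<N. hausdorff_gauge (real k) (B n)) = (\<Sum>n<N. emeasure \<mu> (B n))"
      using B by (intro sum.cong) auto
    also have "\<dots> = emeasure \<mu> W"
      unfolding W_def using dN B by (intro sum_emeasure) (auto simp: sets)
    also have "hausdorff_content (real k) \<delta> ((U - W) \<inter> V)
        \<le> ennreal ((1 + 5 ^ k * (1 - q) ^ j) * measure \<mu> (U - W))"
      by (rule Suc.IH[OF U'])
    finally have "hausdorff_content (real k) \<delta> (U \<inter> V)
        \<le> ennreal (measure \<mu> W) + ennreal ((1 + 5 ^ k * (1 - q) ^ j) * measure \<mu> (U - W))"
      by (simp add: mW add_left_mono)
    also have "\<dots> = ennreal (measure \<mu> W + (1 + 5 ^ k * (1 - q) ^ j) * measure \<mu> (U - W))"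
      using q by (intro ennreal_plus[symmetric]) auto
    also have "\<dots> \<le> ennreal ((1 + 5 ^ k * (1 - q) ^ Suc j) * measure \<mu> U)"
    proof (rule ennreal_leI)
      have "measure \<mu> U - measure \<mu> W \<le> (1 - q) * measure \<mu> U"
        using ge by (simp add: W_def algebra_simps)
      then have "5 ^ k * (1 - q) ^ j * (measure \<mu> U - measure \<mu> W)
          \<le> 5 ^ k * (1 - q) ^ j * ((1 - q) * measure \<mu> U)"
        using q by (intro mult_left_mono) auto
      then show "measure \<mu> W + (1 + 5 ^ k * (1 - q) ^ j) * measure \<mu> (U - W)
          \<le> (1 + 5 ^ k * (1 - q) ^ Suc j) * measure \<mu> U"
        unfolding mD by (simp add: algebra_simps)
    qed
    finally show ?case .
  qed
  have "(\<lambda>j. (1 + 5 ^ k * (1 - q) ^ j) * measure \<mu> U) \<longlonglongrightarrow> (1 + 5 ^ k * 0) * measure \<mu> U"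
    using q by (intro tendsto_intros LIMSEQ_power_zero) auto
  then have "(\<lambda>j. ennreal ((1 + 5 ^ k * (1 - q) ^ j) * measure \<mu> U)) \<longlonglongrightarrow> ennreal (measure \<mu> U)"
    using tendsto_ennrealI by fastforce
  then have "hausdorff_content (real k) \<delta> (U \<inter> V) \<le> ennreal (measure \<mu> U)"
    by (rule LIMSEQ_le_const) (use iter[OF U] in auto)
  also have "\<dots> = emeasure \<mu> U" using fin[of U] U by (simp add: emeasure_eq_ennreal_measure)
  finally show ?thesis .
qed

lemma emeasure_span_lborel_bounded:
  assumes I: "orthonormal I" and "bounded A"
  shows "emeasure (span_lborel I) A < \<infinity>"
proof -
  obtain e where "A \<subseteq> cball 0 e" "0 < e"
    using bounded_subset_ballD[OF \<open>bounded A\<close>, of 0] ball_subset_cball by (metis order_trans)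
  then have "emeasure (span_lborel I) A \<le> emeasure (span_lborel I) (cball 0 e)"
    by (intro emeasure_mono) auto
  also have "\<dots> < \<infinity>" using I \<open>0 < e\<close> by (simp add: emeasure_span_lborel_cball span_zero)
  finally show ?thesis .
qed

text \<open>Two measures are compared on open boxes: openness admits the Vitali selection for one
  inequality, and the isodiametric inequality gives the other.\<close>

theorem hausdorff_outer_span:
  assumes I: "orthonormal (I :: 'a::euclidean_space set)" and A: "A \<in> sets borel"
  shows "hausdorff_outer (real (card I)) (A \<inter> span I) = emeasure (span_lborel I) A"
proof -
  \<comment> \<open>The restriction to \<open>span I\<close> is finite on bounded boxes, as
    uniqueness of measures requires. The unrestricted measure of a nonempty box is infinite when the
    span is a proper subspace.\<close>
  let ?H = "density (hausdorff_measure (real (card I))) (indicator (span I)) :: 'a measure"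
  have H: "emeasure ?H B = hausdorff_outer (real (card I)) (B \<inter> span I)" if "B \<in> sets borel" for B
  proof -
    have "span I \<inter> B \<in> sets borel" using that by (intro sets.Int borel_span)
    then show ?thesis using that
      by (subst emeasure_restricted) (auto simp: emeasure_hausdorff_measure Int_commute)
  qed
  let ?E = "range (\<lambda>(a, b). box a b :: 'a set)"
  have "?H = span_lborel I"
  proof (rule measure_eqI_generator_eq[of ?E UNIV])
    show "Int_stable ?E" by (auto simp: Int_stable_def box_Int_box)
    show "sets ?H = sigma_sets UNIV ?E" "sets (span_lborel I) = sigma_sets UNIV ?E"
      by (simp_all add: borel_eq_box)
    have eq: "emeasure ?H U = emeasure (span_lborel I) U" if "open U" "bounded U" for U
    proof (rule antisym)
      have "hausdorff_outer (real (card I)) (U \<inter> span I) \<le> emeasure (span_lborel I) U"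
        unfolding hausdorff_outer_def
        using that I
        by (intro SUP_least hausdorff_content_open_le)
           (auto simp: emeasure_span_lborel_Int_span emeasure_span_lborel_cball
             emeasure_span_lborel_bounded[simplified])
      then show "emeasure ?H U \<le> emeasure (span_lborel I) U" using that by (simp add: H)
      have "emeasure (span_lborel I) (U \<inter> span I) \<le> hausdorff_outer (real (card I)) (U \<inter> span I)"
        using that by (intro span_lborel_le_hausdorff_outer[OF I] sets.Int borel_span) auto
      then show "emeasure (span_lborel I) U \<le> emeasure ?H U"
        using that by (simp add: H emeasure_span_lborel_Int_span)
    qed
    show "emeasure ?H X = emeasure (span_lborel I) X" if "X \<in> ?E" for X
    proof -
      obtain a b where "X = box a b" using \<open>X \<in> ?E\<close> by auto
      then show ?thesis using eq[of "box a b"] by (simp add: bounded_box open_box)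
    qed
    show "range (\<lambda>n::nat. box (- (real n *\<^sub>R One)) (real n *\<^sub>R One)) \<subseteq> ?E" by auto
    show "(\<Union>n::nat. box (- (real n *\<^sub>R One)) (real n *\<^sub>R One)) = (UNIV :: 'a set)"
      by (rule UN_box_eq_UNIV)
    show "emeasure ?H (box (- (real n *\<^sub>R One)) (real n *\<^sub>R One)) \<noteq> \<infinity>" for n :: nat
      using eq[of "box (- (real n *\<^sub>R One)) (real n *\<^sub>R One)"]
        emeasure_span_lborel_bounded[OF I, of "box (- (real n *\<^sub>R One)) (real n *\<^sub>R One)"]
      by (simp add: bounded_box open_box)
  qed auto
  then show ?thesis using H[OF A] by simp
qed

section \<open>Hausdorff measure under Lipschitz maps\<close>

lemma hausdorff_outer_Lipschitz_image:
  fixes f :: "'a::metric_space \<Rightarrow> 'b::metric_space"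
  assumes K: "0 < K" and lip: "\<And>x y. x \<in> A \<Longrightarrow> y \<in> A \<Longrightarrow> dist (f x) (f y) \<le> K * dist x y"
  shows "hausdorff_outer (real k) (f ` A) \<le> ennreal (K ^ k) * hausdorff_outer (real k) A"
proof -
  have "hausdorff_content (real k) \<delta> (f ` A) \<le> ennreal (K ^ k) * hausdorff_content (real k) (\<delta> / K) A"
    if "0 < \<delta>" for \<delta>
  proof -
    have "hausdorff_content (real k) \<delta> (f ` A) \<le> ennreal (K ^ k) * (\<Sum>i. hausdorff_gauge (real k) (U i))"
      if cov: "A \<subseteq> (\<Union>i. U i)" and U: "\<And>i. bounded (U i)" "\<And>i. diameter (U i) \<le> \<delta> / K"
      for U :: "nat \<Rightarrow> 'a set"
    proof -
      \<comment> \<open>The Lipschitz bound holds on \<open>A\<close> only, so the covering sets are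
        cut down to \<open>A\<close> before mapping.\<close>
      let ?W = "\<lambda>i. f ` (U i \<inter> A)"
      have d: "dist x y \<le> K * diameter (U i)" if "x \<in> ?W i" "y \<in> ?W i" for x y i
      proof -
        obtain x' y' where xy: "x' \<in> U i \<inter> A" "y' \<in> U i \<inter> A" "x = f x'" "y = f y'"
          using \<open>x \<in> ?W i\<close> \<open>y \<in> ?W i\<close> by blast
        have "dist x y \<le> K * dist x' y'" using lip xy by auto
        also have "\<dots> \<le> K * diameter (U i)"
          using diameter_bounded_bound[OF U(1), of x' i y'] xy K by (intro mult_left_mono) auto
        finally show ?thesis .
      qed
      have bW: "bounded (?W i)" for i
        using d[of _ i] by (auto simp: bounded_two_points)
      have dW: "diameter (?W i) \<le> K * diameter (U i)" for i
      proof (cases "?W i = {}")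
        case True
        then show ?thesis using K diameter_ge_0[OF U(1)] by (simp add: diameter_def)
      next
        case False
        then have "(SUP (x, y) \<in> ?W i \<times> ?W i. dist x y) \<le> K * diameter (U i)"
          by (intro cSUP_least) (auto intro!: d[of _ i])
        then show ?thesis using False by (simp add: diameter_def[of "?W i"] del: image_is_empty)
      qed
      have gW: "hausdorff_gauge (real k) (?W i) \<le> ennreal (K ^ k) * hausdorff_gauge (real k) (U i)" for i
      proof (cases "?W i = {}")
        case False
        then have "U i \<noteq> {}" by auto
        have "(diameter (?W i) / 2) ^ k \<le> (K * diameter (U i) / 2) ^ k"
          using dW[of i] diameter_ge_0[OF bW[of i]] by (intro power_mono) auto
        then have "ennreal (unit_ball_vol (real k) * (diameter (?W i) / 2) ^ k)
            \<le> ennreal (unit_ball_vol (real k) * (K * diameter (U i) / 2) ^ k)"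
          by (intro ennreal_leI mult_left_mono) auto
        also have "\<dots> = ennreal (K ^ k) * ennreal (unit_ball_vol (real k) * (diameter (U i) / 2) ^ k)"
          using K by (simp add: ennreal_mult'[symmetric] power_mult_distrib power_divide mult_ac)
        finally show ?thesis
          unfolding hausdorff_gauge_nat[OF bW False] hausdorff_gauge_nat[OF U(1) \<open>U i \<noteq> {}\<close>] .
      qed auto
      have "hausdorff_content (real k) \<delta> (f ` A) \<le> (\<Sum>i. hausdorff_gauge (real k) (?W i))"
      proof (rule hausdorff_content_le[OF _ bW])
        show "f ` A \<subseteq> (\<Union>i. ?W i)" using cov by blast
        show "diameter (?W i) \<le> \<delta>" for i
          using dW[of i] U(2)[of i] K by (simp add: field_simps)
      qed
      also have "\<dots> \<le> (\<Sum>i. ennreal (K ^ k) * hausdorff_gauge (real k) (U i))"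
        by (intro suminf_le gW) auto
      finally show ?thesis by simp
    qed
    \<comment> \<open>Division frees the other side of the constant, so that the infimum over all
      covers can be taken there.\<close>
    then have "hausdorff_content (real k) \<delta> (f ` A) / ennreal (K ^ k) \<le> hausdorff_content (real k) (\<delta> / K) A"
      unfolding hausdorff_content_def[of _ _ A] using K
      by (intro INF_greatest) (auto simp: divide_le_posI_ennreal)
    then have "ennreal (K ^ k) * (hausdorff_content (real k) \<delta> (f ` A) / ennreal (K ^ k))
        \<le> ennreal (K ^ k) * hausdorff_content (real k) (\<delta> / K) A"
      by (intro mult_left_mono) auto
    moreover have "ennreal (K ^ k) * (hausdorff_content (real k) \<delta> (f ` A) / ennreal (K ^ k)) =
        hausdorff_content (real k) \<delta> (f ` A)"
      using K by (simp add: ennreal_times_divide mult_divide_eq_ennreal mult.commute[of "ennreal (K ^ k)"])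
    ultimately show ?thesis by simp
  qed
  then have "hausdorff_content (real k) \<delta> (f ` A) \<le> ennreal (K ^ k) * hausdorff_outer (real k) A"
    if "0 < \<delta>" for \<delta>
    using that K
    by (meson divide_pos_pos hausdorff_content_le_outer mult_left_mono order_trans zero_le)
  then show ?thesis unfolding hausdorff_outer_def[of _ "f ` A"] by (intro SUP_least) auto
qed

subsection \<open>Hausdorff measure on the sphere\<close>

lemma sigma_finite_span_lborel:
  assumes "orthonormal (I :: 'a::euclidean_space set)"
  shows "sigma_finite_measure (span_lborel I)"
proof
  show "\<exists>A. countable A \<and> A \<subseteq> sets (span_lborel I) \<and> \<Union> A = space (span_lborel I) \<and>
      (\<forall>a\<in>A. emeasure (span_lborel I) a \<noteq> \<infinity>)"
  proof (intro exI[of _ "range (\<lambda>n::nat. cball 0 (real n))"] conjI ballI)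
    have "\<exists>n::nat. x \<in> cball 0 (real n)" for x :: 'a
      using real_arch_simple[of "norm x"] by auto
    then show "\<Union> (range (\<lambda>n::nat. cball 0 (real n))) = space (span_lborel I)" by auto
    fix a :: "'a set" assume "a \<in> range (\<lambda>n::nat. cball 0 (real n))"
    then have "bounded a" by auto
    then show "emeasure (span_lborel I) a \<noteq> \<infinity>"
      using emeasure_span_lborel_bounded[OF assms, of a] by simp
  qed auto
qed

lemma nn_integral_span_lborel_Un:
  assumes I: "orthonormal (I :: 'a::euclidean_space set)" and J: "orthonormal J" and "I \<inter> J = {}"
    and [measurable]: "f \<in> borel_measurable borel"
  shows "(\<integral>\<^sup>+x. f x \<partial>span_lborel (I \<union> J)) =
    (\<integral>\<^sup>+x. \<integral>\<^sup>+y. f (x + y) \<partial>span_lborel J \<partial>span_lborel I)"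
proof -
  interpret product_sigma_finite "\<lambda>_::'a. lborel :: real measure" by standard
  have fin: "finite I" "finite J" using I J by (auto simp: orthonormal_def)
  have m: "coord_comb (I \<union> J) (merge I J (x, y)) = coord_comb I x + coord_comb J y" for x y
    unfolding coord_comb_def using \<open>I \<inter> J = {}\<close> fin
    by (subst sum.union_disjoint) (auto simp: merge_def intro!: arg_cong2[of _ _ _ _ "(+)"] sum.cong)
  have [measurable]: "(\<lambda>x. \<integral>\<^sup>+y. f (x + y) \<partial>span_lborel J) \<in> borel_measurable borel"
    by (rule sigma_finite_measure.borel_measurable_nn_integral[OF sigma_finite_span_lborel[OF J]])
       measurable
  have "(\<integral>\<^sup>+x. f x \<partial>span_lborel (I \<union> J)) =
      (\<integral>\<^sup>+h. f (coord_comb (I \<union> J) h) \<partial>Pi\<^sub>M (I \<union> J) (\<lambda>_. lborel))"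
    unfolding span_lborel_def by (rule nn_integral_distr) auto
  also have "\<dots> = (\<integral>\<^sup>+x. \<integral>\<^sup>+y. f (coord_comb (I \<union> J) (merge I J (x, y)))
      \<partial>Pi\<^sub>M J (\<lambda>_. lborel) \<partial>Pi\<^sub>M I (\<lambda>_. lborel))"
    using fin \<open>I \<inter> J = {}\<close> by (intro product_nn_integral_fold) auto
  also have "\<dots> = (\<integral>\<^sup>+x. \<integral>\<^sup>+y. f (coord_comb I x + y) \<partial>span_lborel J \<partial>Pi\<^sub>M I (\<lambda>_. lborel))"
    unfolding m span_lborel_def by (subst nn_integral_distr) auto
  also have "\<dots> = (\<integral>\<^sup>+x. \<integral>\<^sup>+y. f (x + y) \<partial>span_lborel J \<partial>span_lborel I)"
    by (subst (2) span_lborel_def, subst nn_integral_distr) auto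
  finally show ?thesis .
qed

lemma nn_integral_span_lborel_singleton:
  assumes [measurable]: "f \<in> borel_measurable borel"
  shows "(\<integral>\<^sup>+x. f x \<partial>span_lborel {p}) = (\<integral>\<^sup>+t. f (t *\<^sub>R p) \<partial>lborel)"
proof -
  interpret product_sigma_finite "\<lambda>_::'a. lborel :: real measure" by standard
  have "(\<integral>\<^sup>+x. f x \<partial>span_lborel {p}) =
      (\<integral>\<^sup>+h. f (coord_comb {p} h) \<partial>Pi\<^sub>M {p} (\<lambda>_. lborel))"
    unfolding span_lborel_def by (rule nn_integral_distr) auto
  also have "\<dots> = (\<integral>\<^sup>+h. f (h p *\<^sub>R p) \<partial>Pi\<^sub>M {p} (\<lambda>_. lborel))"
    by (simp add: coord_comb_def)
  also have "\<dots> = (\<integral>\<^sup>+t. f (t *\<^sub>R p) \<partial>lborel)"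
    by (rule product_nn_integral_singleton[of "\<lambda>t. f (t *\<^sub>R p)"]) measurable
  finally show ?thesis .
qed

text \<open>Both measures are the Hausdorff measure of the common span, which replaces a change of
  variables between the bases.\<close>

lemma span_lborel_cong_span:
  assumes "orthonormal I" "orthonormal J" "span I = span J"
  shows "span_lborel I = span_lborel J"
proof (rule measure_eqI)
  fix A assume "A \<in> sets (span_lborel I)"
  moreover have "card I = card J" using assms by (metis orthonormal_dim)
  ultimately show "emeasure (span_lborel I) A = emeasure (span_lborel J) A"
    using hausdorff_outer_span[OF assms(1), of A] hausdorff_outer_span[OF assms(2), of A] assms(3)
    by simp
qed simp

lemma borel_scaleR_image:
  fixes A :: "'a::euclidean_space set"
  assumes "A \<in> sets borel" "c \<noteq> 0"
  shows "(\<lambda>x. c *\<^sub>R x) ` A \<in> sets borel"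
proof -
  have "(\<lambda>x. c *\<^sub>R x) ` A = (\<lambda>x. (1 / c) *\<^sub>R x) -` A \<inter> space borel"
    using \<open>c \<noteq> 0\<close> by (force simp: image_iff)
  also have "\<dots> \<in> sets borel" using assms(1) measurable_sets[of "\<lambda>x. (1 / c) *\<^sub>R x" borel borel A] by simp
  finally show ?thesis .
qed

text \<open>The dilation by \<open>c\<close> and its inverse are Lipschitz with constants c and 1/c,
  so each inequality is the Lipschitz bound for Hausdorff measure.\<close>

lemma emeasure_span_lborel_scaleR:
  assumes I: "orthonormal (I :: 'a::euclidean_space set)" and A: "A \<in> sets borel" and "0 < c"
  shows "emeasure (span_lborel I) ((\<lambda>x. c *\<^sub>R x) ` A) = ennreal (c ^ card I) * emeasure (span_lborel I) A"
proof -
  have le: "emeasure (span_lborel I) ((\<lambda>x. c *\<^sub>R x) ` A) \<le> ennreal (c ^ card I) * emeasure (span_lborel I) A"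
    if "0 < c" "A \<in> sets borel" for c and A :: "'a set"
  proof -
    have "(\<lambda>x. c *\<^sub>R x) ` A \<inter> span I = (\<lambda>x. c *\<^sub>R x) ` (A \<inter> span I)"
    proof -
      have "x \<in> span I" if "c *\<^sub>R x \<in> span I" for x
        using span_scale[OF that, of "1 / c"] \<open>0 < c\<close> by simp
      then show ?thesis by (auto intro: span_scale)
    qed
    moreover have "hausdorff_outer (real (card I)) ((\<lambda>x. c *\<^sub>R x) ` (A \<inter> span I))
        \<le> ennreal (c ^ card I) * hausdorff_outer (real (card I)) (A \<inter> span I)"
      using \<open>0 < c\<close> by (intro hausdorff_outer_Lipschitz_image) (auto simp: dist_norm simp flip: scaleR_diff_right)
    ultimately show ?thesis
      using that borel_scaleR_image[of A c] hausdorff_outer_span[OF I] by (metis less_irrefl)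
  qed
  show ?thesis
  proof (rule antisym[OF le[OF \<open>0 < c\<close> A]])
    have "A = (\<lambda>x. (1 / c) *\<^sub>R x) ` (\<lambda>x. c *\<^sub>R x) ` A"
      using \<open>0 < c\<close> by (simp add: image_image)
    then have "emeasure (span_lborel I) A
        \<le> ennreal ((1 / c) ^ card I) * emeasure (span_lborel I) ((\<lambda>x. c *\<^sub>R x) ` A)"
      using le[of "1 / c" "(\<lambda>x. c *\<^sub>R x) ` A"] \<open>0 < c\<close> borel_scaleR_image[OF A, of c] by simp
    then have "ennreal (c ^ card I) * emeasure (span_lborel I) A
        \<le> ennreal (c ^ card I) * (ennreal ((1 / c) ^ card I) * emeasure (span_lborel I) ((\<lambda>x. c *\<^sub>R x) ` A))"
      by (rule mult_left_mono) simp
    also have "\<dots> = emeasure (span_lborel I) ((\<lambda>x. c *\<^sub>R x) ` A)"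
      using \<open>0 < c\<close> by (simp add: mult.assoc[symmetric] ennreal_mult'[symmetric] power_divide)
    finally show "ennreal (c ^ card I) * emeasure (span_lborel I) A
        \<le> emeasure (span_lborel I) ((\<lambda>x. c *\<^sub>R x) ` A)" .
  qed
qed

lemma orthonormal_basis_subspace_exists:
  assumes "subspace (S :: 'a::euclidean_space set)"
  obtains B where "orthonormal B" "span B = S"
proof -
  obtain B where "B \<subseteq> S" "pairwise orthogonal B" "\<And>x. x \<in> B \<Longrightarrow> norm x = 1" "independent B" "span B = S"
    using orthonormal_basis_subspace[OF assms] by metis
  then show ?thesis
    by (intro that[of B]) (auto simp: orthonormal_def dest: independent_imp_finite)
qed

text \<open>Adapts the basis to the pole \<open>p\<close> of a spherical cap: \<open>Q\<close> spans
  the directions tangent to the unit sphere at \<open>p\<close>.\<close>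

lemma orthonormal_extend_unit:
  assumes I: "orthonormal (I :: 'a::euclidean_space set)" and p: "p \<in> span I" "norm p = 1"
  obtains Q where "orthonormal (insert p Q)" "p \<notin> Q" "span (insert p Q) = span I"
    "card I = Suc (card Q)" "span Q = {y \<in> span I. y \<bullet> p = 0}"
proof -
  define S where "S = {y \<in> span I. y \<bullet> p = 0}"
  have "subspace S" unfolding S_def subspace_def
    by (auto simp: span_zero span_add span_scale inner_add_left)
  then obtain Q where Q: "orthonormal Q" "span Q = S"
    by (rule orthonormal_basis_subspace_exists)
  have QS: "Q \<subseteq> S" using Q span_superset by blast
  have pQ: "p \<notin> Q" using QS p by (auto simp: S_def norm_eq_1)
  have on: "orthonormal (insert p Q)"
    using Q(1) QS p by (auto simp: orthonormal_def S_def pairwise_insert orthogonal_def inner_commute)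
  have "span (insert p Q) \<subseteq> span I"
    using p QS by (intro span_minimal) (auto simp: S_def)
  moreover have "x \<in> span (insert p Q)" if "x \<in> span I" for x
  proof -
    have "x - (x \<bullet> p) *\<^sub>R p \<in> span Q"
      using that p by (auto simp: Q(2) S_def span_diff span_scale inner_diff_left norm_eq_1)
    then have "x - (x \<bullet> p) *\<^sub>R p \<in> span (insert p Q)" using span_mono[of Q "insert p Q"] by auto
    moreover have "(x \<bullet> p) *\<^sub>R p \<in> span (insert p Q)" by (intro span_scale span_base) simp
    ultimately show ?thesis using span_add by fastforce
  qed
  ultimately have sp: "span (insert p Q) = span I" by blast
  have "card I = card (insert p Q)" using I on sp by (metis orthonormal_dim)
  then have "card I = Suc (card Q)" using pQ Q(1) by (simp add: orthonormal_def)
  then show ?thesis using that on pQ sp Q(2) by (simp add: S_def)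
qed

section \<open>Spherical caps, their cones and their tangent spaces\<close>

definition unit_cone :: "'a::euclidean_space set \<Rightarrow> 'a set" where
  "unit_cone A = {x. x \<noteq> 0 \<and> norm x \<le> 1 \<and> sgn x \<in> A}"

lemma borel_measurable_sgn_euclidean [measurable]:
  "(sgn :: 'a::euclidean_space \<Rightarrow> 'a) \<in> borel_measurable borel"
  unfolding sgn_div_norm[abs_def] by measurable

lemma sets_unit_cone [measurable]: "A \<in> sets borel \<Longrightarrow> unit_cone A \<in> sets borel"
proof -
  assume A: "A \<in> sets borel"
  have "unit_cone A = (sgn -` A \<inter> space borel) \<inter> (cball 0 1 - {0})" by (auto simp: unit_cone_def)
  also have "\<dots> \<in> sets borel"
    by (intro sets.Int measurable_sets[OF borel_measurable_sgn_euclidean A]) auto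
  finally show ?thesis .
qed

text \<open>With x = a u and y = b v for unit vectors u and v, the squared distances differ by (a -
  b)^2 + (a b - 1) (2 - 2 u.v). Both terms are nonnegative, since a b \<ge> 1 and u.v \<le>
  1.\<close>

lemma dist_sgn_le:
  fixes x y :: "'a::euclidean_space"
  assumes "1 \<le> norm x" "1 \<le> norm y"
  shows "dist (sgn x) (sgn y) \<le> dist x y"
proof -
  define a b u v where "a = norm x" "b = norm y" "u = sgn x" "v = sgn y"
  have xy: "x = a *\<^sub>R u" "y = b *\<^sub>R v"
    unfolding a_b_u_v_def sgn_div_norm using assms by (smt (verit) norm_scaleR real_vector.scale_scale right_inverse scaleR_one)+
  have uv: "u \<bullet> u = 1" "v \<bullet> v = 1"
    using assms by (auto simp: a_b_u_v_def norm_sgn norm_eq_1[symmetric])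
  have le1: "u \<bullet> v \<le> 1" using norm_cauchy_schwarz[of u v] uv by (simp add: norm_eq_1[symmetric])
  have ab: "1 \<le> a * b" using assms mult_mono[of 1 a 1 b] by (simp add: a_b_u_v_def)
  have "(dist x y)\<^sup>2 - (dist u v)\<^sup>2 = (a - b)\<^sup>2 + (a * b - 1) * (2 - 2 * (u \<bullet> v))"
    unfolding xy dist_norm power2_norm_eq_inner
    by (simp add: inner_diff_left inner_diff_right uv inner_commute power2_eq_square algebra_simps)
  also have "\<dots> \<ge> 0" using le1 ab by (intro add_nonneg_nonneg mult_nonneg_nonneg) auto
  finally have "(dist u v)\<^sup>2 \<le> (dist x y)\<^sup>2" by simp
  then show ?thesis unfolding a_b_u_v_def by (rule power2_le_imp_le) simp
qed

text \<open>The gnomonic chart \<open>u \<mapsto> u / (u \<bullet> p) - p\<close> of the cap of \<open>u\<close> with \<open>c \<le> u \<bullet> p\<close>; as \<open>u - v\<close> is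
  orthogonal to \<open>u + v\<close>, the denominators differ only by \<open>(u - v) \<bullet> (p - (u + v) / 2)\<close>.\<close>

lemma dist_gnomonic_le:
  fixes u v p :: "'a::euclidean_space"
  assumes unit: "norm u = 1" "norm v = 1" "norm p = 1" and c: "0 < c" "c \<le> u \<bullet> p" "c \<le> v \<bullet> p"
  shows "dist ((1 / (u \<bullet> p)) *\<^sub>R u - p) ((1 / (v \<bullet> p)) *\<^sub>R v - p)
    \<le> (1 / c + sqrt (2 - 2 * c) / c\<^sup>2) * dist u v"
proof -
  define a b where "a = u \<bullet> p" "b = v \<bullet> p"
  have ab: "c \<le> a" "c \<le> b" "0 < a" "0 < b" using c by (auto simp: a_b_def)
  have near: "norm (w - p) \<le> sqrt (2 - 2 * c)" if "norm w = 1" "c \<le> w \<bullet> p" for w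
  proof -
    have "(norm (w - p))\<^sup>2 = 2 - 2 * (w \<bullet> p)"
      using that unit by (simp add: power2_norm_eq_inner inner_diff_left inner_diff_right inner_commute norm_eq_1)
    also have "\<dots> \<le> 2 - 2 * c" using that by simp
    finally show ?thesis by (rule real_le_rsqrt)
  qed
  have "norm (p - (1/2) *\<^sub>R (u + v)) = norm ((1/2) *\<^sub>R (u - p) + (1/2) *\<^sub>R (v - p))"
    by (subst norm_minus_cancel[symmetric]) (simp add: algebra_simps flip: scaleR_left_distrib)
  also have "\<dots> \<le> norm ((1/2) *\<^sub>R (u - p)) + norm ((1/2) *\<^sub>R (v - p))" by (rule norm_triangle_ineq)
  also have "\<dots> \<le> sqrt (2 - 2 * c)" using near[of u] near[of v] unit c by simp
  finally have mid: "norm (p - (1/2) *\<^sub>R (u + v)) \<le> sqrt (2 - 2 * c)" .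
  have "a - b = (u - v) \<bullet> (p - (1/2) *\<^sub>R (u + v))"
    using unit by (simp add: a_b_def inner_diff_left inner_diff_right inner_add_right inner_commute norm_eq_1 field_simps)
  then have "\<bar>a - b\<bar> \<le> norm (u - v) * norm (p - (1/2) *\<^sub>R (u + v))"
    using Cauchy_Schwarz_ineq2 by metis
  also have "\<dots> \<le> norm (u - v) * sqrt (2 - 2 * c)" by (intro mult_left_mono mid) simp
  finally have dab: "\<bar>a - b\<bar> \<le> norm (u - v) * sqrt (2 - 2 * c)" .
  \<comment> \<open>The first term changes the direction at a fixed scale, the second the scale at a
    fixed direction. As all denominators are at least \<open>c\<close>, this gives the constant of
    the statement, which tends to 1 as \<open>c\<close> tends to 1.\<close>
  have "(1 / a) *\<^sub>R u - (1 / b) *\<^sub>R v = (1 / a) *\<^sub>R (u - v) + (1 / a - 1 / b) *\<^sub>R v"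
    by (simp add: algebra_simps)
  then have "norm ((1 / a) *\<^sub>R u - (1 / b) *\<^sub>R v) \<le> norm ((1 / a) *\<^sub>R (u - v)) + norm ((1 / a - 1 / b) *\<^sub>R v)"
    by (metis norm_triangle_ineq)
  also have "\<dots> = (1 / a) * norm (u - v) + \<bar>a - b\<bar> / (a * b)"
  proof -
    have "1 / a - 1 / b = (b - a) / (a * b)" using ab by (simp add: field_simps)
    then have "\<bar>1 / a - 1 / b\<bar> = \<bar>a - b\<bar> / (a * b)"
      using ab by (simp add: abs_minus_commute)
    then show ?thesis using ab unit by simp
  qed
  also have "\<dots> \<le> (1 / c) * norm (u - v) + (norm (u - v) * sqrt (2 - 2 * c)) / (c * c)"
    using ab c dab by (intro add_mono mult_right_mono frac_le mult_mono) auto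
  also have "\<dots> = (1 / c + sqrt (2 - 2 * c) / c\<^sup>2) * norm (u - v)"
    by (simp add: power2_eq_square algebra_simps)
  finally show ?thesis by (simp add: dist_norm a_b_def)
qed

lemma nn_integral_power_interval:
  assumes "0 < R"
  shows "(\<integral>\<^sup>+t. indicator {0<..R} t * ennreal (t ^ q) \<partial>lborel) = ennreal (R ^ Suc q / real (Suc q))"
proof -
  have "(\<integral>\<^sup>+t. indicator {0<..R} t * ennreal (t ^ q) \<partial>lborel) =
      (\<integral>\<^sup>+t. ennreal (t ^ q) * indicator {0..R} t \<partial>lborel)"
    by (intro nn_integral_cong_AE AE_I[of _ _ "{0}"]) (auto simp: indicator_def)
  also have "\<dots> = ennreal (R ^ Suc q / real (Suc q) - 0 ^ Suc q / real (Suc q))"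
    using assms
    by (intro nn_integral_FTC_Icc) (auto intro!: derivative_eq_intros simp del: power_Suc of_nat_Suc)
  finally show ?thesis by simp
qed

text \<open>Cavalieri along the axis \<open>p\<close>: with q = card Q, the slice at height t is
  \<open>E\<close> scaled by t and has t^q times its measure; the integral of t^q over (0, 1] is 1 /
  (q + 1).\<close>

lemma emeasure_truncated_cone:
  assumes on: "orthonormal (insert p Q)" and "p \<notin> Q" and E: "E \<in> sets borel"
  shows "emeasure (span_lborel (insert p Q)) {x. 0 < x \<bullet> p \<and> x \<bullet> p \<le> 1 \<and> (1 / (x \<bullet> p)) *\<^sub>R x - p \<in> E}
    = ennreal (1 / real (Suc (card Q))) * emeasure (span_lborel Q) E"
proof -
  define C where "C = {x. 0 < x \<bullet> p \<and> x \<bullet> p \<le> 1 \<and> (1 / (x \<bullet> p)) *\<^sub>R x - p \<in> E}"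
  have Q: "orthonormal Q" and p: "orthonormal {p}" and pp: "p \<bullet> p = 1"
    using on by (auto simp: orthonormal_def pairwise_insert norm_eq_1)
  have Qp: "y \<bullet> p = 0" if "y \<in> span Q" for y
  proof -
    have "orthogonal p y" using on that \<open>p \<notin> Q\<close>
      by (intro orthogonal_to_span[OF that]) (auto simp: orthonormal_def pairwise_insert)
    then show ?thesis by (simp add: orthogonal_def inner_commute)
  qed
  have [measurable]: "C \<in> sets borel" unfolding C_def using E by measurable
  have sec: "emeasure (span_lborel Q) {y. t *\<^sub>R p + y \<in> C} =
      indicator {0<..1} t * ennreal (t ^ card Q) * emeasure (span_lborel Q) E" for t
  proof -
    have m: "{y. t *\<^sub>R p + y \<in> C} \<in> sets borel" by measurable
    show ?thesis
    proof (cases "t \<in> {0<..1}")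
      case True
      have "{y. t *\<^sub>R p + y \<in> C} \<inter> span Q = (\<lambda>x. t *\<^sub>R x) ` E \<inter> span Q"
      proof -
        have "t *\<^sub>R p + y \<in> C \<longleftrightarrow> (1 / t) *\<^sub>R y \<in> E" if "y \<in> span Q" for y
          using True by (simp add: C_def inner_add_left Qp[OF that] pp algebra_simps)
        moreover have "(1 / t) *\<^sub>R y \<in> E \<longleftrightarrow> y \<in> (\<lambda>x. t *\<^sub>R x) ` E" for y
          using True by (force simp: image_iff)
        ultimately show ?thesis by blast
      qed
      then have "emeasure (span_lborel Q) {y. t *\<^sub>R p + y \<in> C} = emeasure (span_lborel Q) ((\<lambda>x. t *\<^sub>R x) ` E)"
        using True emeasure_span_lborel_Int_span[OF m, of Q]
          emeasure_span_lborel_Int_span[OF borel_scaleR_image[OF E, of t], of Q] by simp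
      then show ?thesis using True by (simp add: emeasure_span_lborel_scaleR[OF Q E])
    next
      case False
      then have "{y. t *\<^sub>R p + y \<in> C} \<inter> span Q = {}" by (auto simp: C_def inner_add_left Qp pp)
      then show ?thesis using False emeasure_span_lborel_Int_span[OF m, of Q] by simp
    qed
  qed
  have "emeasure (span_lborel (insert p Q)) C = (\<integral>\<^sup>+x. indicator C x \<partial>span_lborel ({p} \<union> Q))"
    by simp
  also have "\<dots> = (\<integral>\<^sup>+x. \<integral>\<^sup>+y. indicator C (x + y) \<partial>span_lborel Q \<partial>span_lborel {p})"
    using \<open>p \<notin> Q\<close> by (intro nn_integral_span_lborel_Un p Q) auto
  also have "\<dots> = (\<integral>\<^sup>+t. \<integral>\<^sup>+y. indicator C (t *\<^sub>R p + y) \<partial>span_lborel Q \<partial>lborel)"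
    by (intro nn_integral_span_lborel_singleton
        sigma_finite_measure.borel_measurable_nn_integral[OF sigma_finite_span_lborel[OF Q]]) measurable
  also have "\<dots> = (\<integral>\<^sup>+t. emeasure (span_lborel Q) {y. t *\<^sub>R p + y \<in> C} \<partial>lborel)"
  proof (rule nn_integral_cong)
    fix t
    have "{y. t *\<^sub>R p + y \<in> C} \<in> sets (span_lborel Q)" by measurable
    then have "emeasure (span_lborel Q) {y. t *\<^sub>R p + y \<in> C} =
        (\<integral>\<^sup>+y. indicator {y. t *\<^sub>R p + y \<in> C} y \<partial>span_lborel Q)" by simp
    then show "(\<integral>\<^sup>+y. indicator C (t *\<^sub>R p + y) \<partial>span_lborel Q) = emeasure (span_lborel Q) {y. t *\<^sub>R p + y \<in> C}"
      by (simp add: indicator_def)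
  qed
  also have "\<dots> = (\<integral>\<^sup>+t. indicator {0<..1} t * ennreal (t ^ card Q) \<partial>lborel) * emeasure (span_lborel Q) E"
    unfolding sec by (rule nn_integral_multc) measurable
  finally show ?thesis using nn_integral_power_interval[of 1 "card Q"] by (simp add: C_def del: of_nat_Suc)
qed

text \<open>Let E be the gnomonic image of \<open>A\<close> in the tangent space at
  \<open>p\<close>, and C the cone over p + E up to height 1, whose volume times
  \<open>card I\<close> is the measure of E. The cone over \<open>A\<close> lies in C and contains C
  shrunk by \<open>c\<close>. The measures of E and \<open>A\<close> are comparable because central
  projection from the tangent space to the sphere is 1-Lipschitz and its inverse on the cap
  satisfies \<open>dist_gnomonic_le\<close>.\<close>

lemma cap_comparison:
  assumes I: "orthonormal (I :: 'a::euclidean_space set)" and p: "p \<in> span I" "norm p = 1"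
    and c: "0 < c" "c < 1" and A: "A \<in> sets borel" "A \<subseteq> sphere 0 1 \<inter> span I" "\<And>u. u \<in> A \<Longrightarrow> c \<le> u \<bullet> p"
    and card: "card I = Suc q"
  shows "ennreal (c ^ card I) * hausdorff_outer (real q) A \<le> ennreal (real (card I)) * emeasure (span_lborel I) (unit_cone A)"
    and "ennreal (real (card I)) * emeasure (span_lborel I) (unit_cone A)
      \<le> ennreal ((1 / c + sqrt (2 - 2 * c) / c\<^sup>2) ^ q) * hausdorff_outer (real q) A"
proof -
  obtain Q where Q: "orthonormal (insert p Q)" "p \<notin> Q" "span (insert p Q) = span I"
    "card I = Suc (card Q)" "span Q = {y \<in> span I. y \<bullet> p = 0}"
    by (rule orthonormal_extend_unit[OF I p])
  have q: "card Q = q" using Q(4) card by simp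
  have onQ: "orthonormal Q" using Q(1) by (auto simp: orthonormal_def pairwise_insert)
  have pp: "p \<bullet> p = 1" using p by (simp add: norm_eq_1)
  let ?\<Gamma> = "\<lambda>u. (1 / (u \<bullet> p)) *\<^sub>R u - p"
  define E where "E = {y \<in> span Q. sgn (y + p) \<in> A}"
  have E: "E \<in> sets borel" unfolding E_def using A(1) by measurable
  have norm_ge: "1 \<le> norm (y + p)" "(y + p) \<bullet> p = 1" if "y \<in> span Q" for y
  proof -
    show "(y + p) \<bullet> p = 1" using that Q(5) pp by (simp add: inner_add_left)
    then show "1 \<le> norm (y + p)" using norm_cauchy_schwarz[of "y + p" p] p by simp
  qed
  have sgn_\<Gamma>: "sgn (?\<Gamma> u + p) = u" "?\<Gamma> u \<in> span Q" if "u \<in> A" for u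
  proof -
    have u: "norm u = 1" "u \<in> span I" "0 < u \<bullet> p" using that A(2) A(3)[OF that] c by auto
    show "sgn (?\<Gamma> u + p) = u" using u by (simp add: sgn_scaleR sgn_div_norm)
    show "?\<Gamma> u \<in> span Q" using u p pp Q(5)
      by (auto simp: inner_diff_left intro: span_diff span_scale)
  qed
  have \<Gamma>_sgn: "?\<Gamma> (sgn (y + p)) = y" if "y \<in> span Q" for y
  proof -
    have "y + p \<noteq> 0" using norm_ge[OF that] by auto
    then show ?thesis using norm_ge[OF that] by (simp add: sgn_div_norm)
  qed
  have EA: "E = ?\<Gamma> ` A" "A = (\<lambda>y. sgn (y + p)) ` E"
  proof -
    have "y \<in> ?\<Gamma> ` A" if "y \<in> E" for y
      using that \<Gamma>_sgn[of y] unfolding E_def by (metis (mono_tags, lifting) imageI mem_Collect_eq)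
    moreover have "?\<Gamma> u \<in> E" if "u \<in> A" for u using sgn_\<Gamma>[OF that] that by (simp add: E_def)
    ultimately show "E = ?\<Gamma> ` A" by blast
    show "A = (\<lambda>y. sgn (y + p)) ` E"
    proof
      show "A \<subseteq> (\<lambda>y. sgn (y + p)) ` E"
      proof
        fix u assume "u \<in> A"
        with sgn_\<Gamma>[OF this] have "?\<Gamma> u \<in> E" "u = sgn (?\<Gamma> u + p)" by (simp_all add: E_def)
        then show "u \<in> (\<lambda>y. sgn (y + p)) ` E" by blast
      qed
    qed (auto simp: E_def)
  qed
  have HE: "emeasure (span_lborel Q) E = hausdorff_outer (real q) E"
  proof -
    have "E \<inter> span Q = E" by (auto simp: E_def)
    then show ?thesis using hausdorff_outer_span[OF onQ E] q by simp
  qed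
  have AE: "hausdorff_outer (real q) A \<le> hausdorff_outer (real q) E"
  proof -
    have "hausdorff_outer (real q) ((\<lambda>y. sgn (y + p)) ` E) \<le> ennreal (1 ^ q) * hausdorff_outer (real q) E"
    proof (rule hausdorff_outer_Lipschitz_image)
      fix x y assume "x \<in> E" "y \<in> E"
      then have "dist (sgn (x + p)) (sgn (y + p)) \<le> dist (x + p) (y + p)"
        using norm_ge by (intro dist_sgn_le) (auto simp: E_def)
      then show "dist (sgn (x + p)) (sgn (y + p)) \<le> 1 * dist x y" by (simp add: dist_norm)
    qed simp
    then show ?thesis using EA(2) by simp
  qed
  have EA_le: "hausdorff_outer (real q) E \<le> ennreal ((1 / c + sqrt (2 - 2 * c) / c\<^sup>2) ^ q) * hausdorff_outer (real q) A"
    unfolding EA(1)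
  proof (rule hausdorff_outer_Lipschitz_image)
    show "0 < 1 / c + sqrt (2 - 2 * c) / c\<^sup>2"
      using c by (intro add_pos_nonneg divide_nonneg_nonneg) auto
    fix u v assume "u \<in> A" "v \<in> A"
    then show "dist (?\<Gamma> u) (?\<Gamma> v) \<le> (1 / c + sqrt (2 - 2 * c) / c\<^sup>2) * dist u v"
      using A p c by (intro dist_gnomonic_le) auto
  qed
  define C where "C = {x. 0 < x \<bullet> p \<and> x \<bullet> p \<le> 1 \<and> (1 / (x \<bullet> p)) *\<^sub>R x - p \<in> E}"
  have [measurable]: "C \<in> sets borel" unfolding C_def using E by measurable
  have eqI: "span_lborel (insert p Q) = span_lborel I"
    using span_lborel_cong_span[OF Q(1) I Q(3)] .
  have "emeasure (span_lborel I) C = ennreal (1 / real (Suc q)) * hausdorff_outer (real q) E"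
    using emeasure_truncated_cone[OF Q(1,2) E] unfolding eqI HE q C_def .
  then have vC: "ennreal (real (card I)) * emeasure (span_lborel I) C = hausdorff_outer (real q) E"
    unfolding card by (simp add: mult.assoc[symmetric] ennreal_mult'[symmetric] del: of_nat_Suc)
  have "unit_cone A \<subseteq> C"
  proof
    fix x assume "x \<in> unit_cone A"
    then have x: "x \<noteq> 0" "norm x \<le> 1" "sgn x \<in> A" by (auto simp: unit_cone_def)
    have xs: "x = norm x *\<^sub>R sgn x" using x by (simp add: sgn_div_norm)
    have s: "0 < sgn x \<bullet> p" using A(3)[OF x(3)] c by simp
    have "sgn x \<bullet> p \<le> 1" using norm_cauchy_schwarz[of "sgn x" p] p x by (simp add: norm_sgn)
    then have "norm x * (sgn x \<bullet> p) \<le> 1" using x s by (intro mult_le_one) auto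
    moreover have xp: "x \<bullet> p = norm x * (sgn x \<bullet> p)" by (subst xs) simp
    moreover have "0 < norm x * (sgn x \<bullet> p)" using x s by simp
    moreover have "(1 / (x \<bullet> p)) *\<^sub>R x = (1 / (sgn x \<bullet> p)) *\<^sub>R sgn x"
      unfolding xp using x s by (subst (2) xs) simp
    moreover have "?\<Gamma> (sgn x) \<in> E" using x(3) EA(1) by blast
    ultimately show "x \<in> C" by (simp add: C_def)
  qed
  then have "emeasure (span_lborel I) (unit_cone A) \<le> emeasure (span_lborel I) C"
    by (intro emeasure_mono) auto
  then have "ennreal (real (card I)) * emeasure (span_lborel I) (unit_cone A) \<le> hausdorff_outer (real q) E"
    unfolding vC[symmetric] by (intro mult_left_mono) auto
  with EA_le show "ennreal (real (card I)) * emeasure (span_lborel I) (unit_cone A)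
      \<le> ennreal ((1 / c + sqrt (2 - 2 * c) / c\<^sup>2) ^ q) * hausdorff_outer (real q) A"
    by (rule order_trans[rotated])
  \<comment> \<open>Over the cap the height along \<open>p\<close> is at least \<open>c\<close>
    times the norm, so height at most 1 forces norm at most 1/c.\<close>
  have "(\<lambda>x. c *\<^sub>R x) ` C \<subseteq> unit_cone A"
  proof clarify
    fix z assume "z \<in> C"
    then have z: "0 < z \<bullet> p" "z \<bullet> p \<le> 1" "(1 / (z \<bullet> p)) *\<^sub>R z - p \<in> E" by (auto simp: C_def)
    define t where "t = z \<bullet> p"
    have "sgn ((1 / t) *\<^sub>R z) \<in> A" using z(3) by (simp add: E_def t_def)
    then have sz: "sgn z \<in> A" using z by (simp add: sgn_scaleR t_def)
    have "norm z * c \<le> norm z * (sgn z \<bullet> p)" using A(3)[OF sz] by (intro mult_left_mono) auto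
    also have "\<dots> = z \<bullet> p" using z by (cases "z = 0") (auto simp: sgn_div_norm)
    also have "\<dots> \<le> 1" by (rule z(2))
    finally have "norm (c *\<^sub>R z) \<le> 1" using c by (simp add: mult.commute)
    moreover have "z \<noteq> 0" using z by auto
    ultimately show "c *\<^sub>R z \<in> unit_cone A" using sz c by (simp add: unit_cone_def sgn_scaleR)
  qed
  then have "emeasure (span_lborel I) ((\<lambda>x. c *\<^sub>R x) ` C) \<le> emeasure (span_lborel I) (unit_cone A)"
    using A(1) by (intro emeasure_mono) auto
  then have cC: "ennreal (c ^ card I) * emeasure (span_lborel I) C \<le> emeasure (span_lborel I) (unit_cone A)"
    using c by (simp add: emeasure_span_lborel_scaleR[OF I])
  have "ennreal (c ^ card I) * hausdorff_outer (real q) A \<le> ennreal (c ^ card I) * hausdorff_outer (real q) E"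
    by (intro mult_left_mono AE) simp
  also have "\<dots> = ennreal (real (card I)) * (ennreal (c ^ card I) * emeasure (span_lborel I) C)"
    unfolding vC[symmetric] by (simp add: mult_ac)
  also have "\<dots> \<le> ennreal (real (card I)) * emeasure (span_lborel I) (unit_cone A)"
    by (intro mult_left_mono cC) simp
  finally show "ennreal (c ^ card I) * hausdorff_outer (real q) A
      \<le> ennreal (real (card I)) * emeasure (span_lborel I) (unit_cone A)" .
qed

text \<open>By compactness finitely many caps cover the sphere. The constants are the same for all
  caps, and both Hausdorff measure and the volume of the cone are additive over a disjoint
  decomposition of \<open>A\<close> into pieces inside caps.\<close>

lemma sphere_comparison:
  assumes I: "orthonormal (I :: 'a::euclidean_space set)" and card: "card I = Suc q"
    and c: "0 < c" "c < 1" and A: "A \<in> sets borel" "A \<subseteq> sphere 0 1 \<inter> span I"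
  shows "ennreal (c ^ card I) * hausdorff_outer (real q) A \<le> ennreal (real (card I)) * emeasure (span_lborel I) (unit_cone A)"
    and "ennreal (real (card I)) * emeasure (span_lborel I) (unit_cone A)
      \<le> ennreal ((1 / c + sqrt (2 - 2 * c) / c\<^sup>2) ^ q) * hausdorff_outer (real q) A"
proof -
  let ?S = "sphere 0 1 \<inter> span I"
  let ?cap = "\<lambda>p. {u. c < u \<bullet> p}"
  have "compact ?S" by (intro compact_Int_closed closed_subspace) auto
  moreover have "open (?cap p)" for p by (intro open_Collect_less continuous_intros)
  moreover have "?S \<subseteq> (\<Union>p\<in>?S. ?cap p)"
    using c by (auto simp: norm_eq_1)
  ultimately obtain F where F: "F \<subseteq> ?S" "finite F" "?S \<subseteq> (\<Union>p\<in>F. ?cap p)"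
    by (rule compactE_image)
  obtain P and N :: nat where P: "F = P ` {i. i < N}"
    using finite_imp_nat_seg_image_inj_on[OF F(2)] by blast
  \<comment> \<open>Empty sets beyond \<open>N\<close> turn the finite cover into a sequence, as
    \<open>disjointed\<close> expects.\<close>
  define B where "B n = (if n < N then A \<inter> ?cap (P n) else {})" for n
  define D where "D = disjointed B"
  have B_borel: "B n \<in> sets borel" for n using A(1) by (auto simp: B_def)
  then have D_borel [measurable]: "D n \<in> sets borel" for n
    unfolding D_def using sets.range_disjointed_sets[of B borel] by auto
  have UD: "(\<Union>n. D n) = A"
  proof -
    have "(\<Union>n. D n) = (\<Union>n. B n)" unfolding D_def by (rule UN_disjointed_eq)
    also have "\<dots> = A"
    proof
      show "A \<subseteq> (\<Union>n. B n)"
      proof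
        fix x assume "x \<in> A"
        then obtain n where "n < N" "x \<in> ?cap (P n)" using A(2) F(3) P by blast
        then have "x \<in> B n" using \<open>x \<in> A\<close> by (simp add: B_def)
        then show "x \<in> (\<Union>n. B n)" by blast
      qed
    qed (auto simp: B_def split: if_splits)
    finally show ?thesis .
  qed
  have disj: "disjoint_family D" unfolding D_def by (rule disjoint_family_disjointed)
  have DB: "D n \<subseteq> B n" for n unfolding D_def by (rule disjointed_subset)
  have H: "hausdorff_outer (real q) A = (\<Sum>n. hausdorff_outer (real q) (D n))"
  proof -
    have "emeasure (hausdorff_measure (real q)) (\<Union>n. D n) = (\<Sum>n. emeasure (hausdorff_measure (real q)) (D n))"
      using disj by (intro suminf_emeasure[symmetric]) auto
    then show ?thesis using A(1) by (simp add: emeasure_hausdorff_measure UD)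
  qed
  have V: "emeasure (span_lborel I) (unit_cone A) = (\<Sum>n. emeasure (span_lborel I) (unit_cone (D n)))"
  proof -
    have "unit_cone A = (\<Union>n. unit_cone (D n))" unfolding UD[symmetric] by (auto simp: unit_cone_def)
    moreover have "disjoint_family (\<lambda>n. unit_cone (D n))"
      using disj by (auto simp: disjoint_family_on_def unit_cone_def)
    ultimately show ?thesis by (subst suminf_emeasure) auto
  qed
  have cmp: "ennreal (c ^ card I) * hausdorff_outer (real q) (D n) \<le> ennreal (real (card I)) * emeasure (span_lborel I) (unit_cone (D n))
    \<and> ennreal (real (card I)) * emeasure (span_lborel I) (unit_cone (D n))
      \<le> ennreal ((1 / c + sqrt (2 - 2 * c) / c\<^sup>2) ^ q) * hausdorff_outer (real q) (D n)" for n
  proof (cases "n < N")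
    case True
    then have "P n \<in> F" using P by auto
    then have p: "P n \<in> span I" "norm (P n) = 1" using F(1) by auto
    have "D n \<subseteq> sphere 0 1 \<inter> span I" "\<And>u. u \<in> D n \<Longrightarrow> c \<le> u \<bullet> P n"
      using DB[of n] True A(2) by (auto simp: B_def)
    then show ?thesis using cap_comparison[OF I p c D_borel _ _ card] by blast
  next
    case False
    then have "D n = {}" using DB[of n] by (simp add: B_def)
    then show ?thesis by (simp add: unit_cone_def)
  qed
  show "ennreal (c ^ card I) * hausdorff_outer (real q) A \<le> ennreal (real (card I)) * emeasure (span_lborel I) (unit_cone A)"
    unfolding H V ennreal_suminf_cmult[symmetric] using cmp by (intro suminf_le) auto
  show "ennreal (real (card I)) * emeasure (span_lborel I) (unit_cone A)
      \<le> ennreal ((1 / c + sqrt (2 - 2 * c) / c\<^sup>2) ^ q) * hausdorff_outer (real q) A"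
    unfolding H V ennreal_suminf_cmult[symmetric] using cmp by (intro suminf_le) auto
qed

text \<open>Both comparison constants tend to 1 as c tends to 1 from below. The case
  \<open>q = 0\<close> is included: the sphere of a line has two points and carries counting
  measure.\<close>

theorem hausdorff_outer_sphere:
  assumes I: "orthonormal (I :: 'a::euclidean_space set)" and card: "card I = Suc q"
    and A: "A \<in> sets borel" "A \<subseteq> sphere 0 1 \<inter> span I"
  shows "hausdorff_outer (real q) A = ennreal (real (card I)) * emeasure (span_lborel I) (unit_cone A)"
proof -
  let ?n = "card I"
  note cmp = sphere_comparison[OF I card _ _ A]
  have "bounded (unit_cone A)" by (rule bounded_subset[OF bounded_cball[of 0 1]]) (auto simp: unit_cone_def)
  then have "emeasure (span_lborel I) (unit_cone A) < \<infinity>" by (rule emeasure_span_lborel_bounded[OF I])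
  then have fin: "ennreal (real ?n) * emeasure (span_lborel I) (unit_cone A) < top"
    by (simp add: ennreal_mult_less_top)
  then obtain s where s: "ennreal (real ?n) * emeasure (span_lborel I) (unit_cone A) = ennreal s" "0 \<le> s"
    by (metis less_top_ennreal)
  \<comment> \<open>Finiteness is needed to take the limit in the reals; the first comparison at any
    one value of c, here 1/2, yields it.\<close>
  have "hausdorff_outer (real q) A < top"
  proof (rule ccontr)
    assume "\<not> ?thesis"
    then have "hausdorff_outer (real q) A = top" by (simp add: less_top[symmetric])
    then show False using cmp(1)[of "1/2"] fin by (simp add: ennreal_mult_top)
  qed
  then obtain h where h: "hausdorff_outer (real q) A = ennreal h" "0 \<le> h"
    by (metis less_top_ennreal)
  have ineq: "c ^ ?n * h \<le> s \<and> s \<le> (1 / c + sqrt (2 - 2 * c) / c\<^sup>2) ^ q * h" if "0 < c" "c < 1" for c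
  proof -
    have "0 \<le> 1 / c + sqrt (2 - 2 * c) / c\<^sup>2" using that by (intro add_nonneg_nonneg divide_nonneg_nonneg) auto
    then show ?thesis using cmp[OF that] s h that
      by (simp add: ennreal_mult'[symmetric] ennreal_le_iff)
  qed
  have ev: "eventually (\<lambda>c. 0 < c \<and> c < 1) (at_left (1::real))"
    using eventually_at_left_real[of 0 1] by (simp add: greaterThanLessThan_def)
  have "((\<lambda>c::real. c ^ ?n * h) \<longlongrightarrow> 1 ^ ?n * h) (at_left 1)"
    by (intro tendsto_intros)
  then have "1 ^ ?n * h \<le> s"
    by (rule tendsto_upperbound) (use ev ineq in \<open>auto elim!: eventually_mono\<close>)
  moreover have "((\<lambda>c::real. (1 / c + sqrt (2 - 2 * c) / c\<^sup>2) ^ q * h) \<longlongrightarrow> (1 / 1 + sqrt (2 - 2 * 1) / 1\<^sup>2) ^ q * h) (at_left 1)"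
    by (intro tendsto_intros) auto
  then have "s \<le> (1 / 1 + sqrt (2 - 2 * 1) / 1\<^sup>2) ^ q * h"
    by (rule tendsto_lowerbound) (use ev ineq in \<open>auto elim!: eventually_mono\<close>)
  ultimately have "h = s" by simp
  then show ?thesis using s h by simp
qed

subsection \<open>Polar coordinates\<close>

lemma AE_span_lborel_in_span: "AE x in span_lborel I. x \<in> span I"
proof (rule AE_I[of _ _ "- span I"])
  have "- span I \<in> sets borel" using borel_span[of I] by (simp add: borel_comp)
  then show "emeasure (span_lborel I) (- span I) = 0"
    using emeasure_span_lborel_Int_span[of "- span I" I] by simp
  show "- span I \<in> sets (span_lborel I)" using borel_span[of I] by (simp add: borel_comp)
qed auto

lemma emeasure_polar_cone:
  assumes I: "orthonormal (I :: 'a::euclidean_space set)" and card: "card I = Suc q"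
    and A: "A \<in> sets borel" "A \<subseteq> sphere 0 1 \<inter> span I" and "0 < R"
  shows "emeasure (span_lborel I) {x. x \<noteq> 0 \<and> norm x \<le> R \<and> sgn x \<in> A} =
    ennreal (R ^ Suc q / real (Suc q)) * hausdorff_outer (real q) A"
proof -
  have "{x. x \<noteq> 0 \<and> norm x \<le> R \<and> sgn x \<in> A} = (\<lambda>x. R *\<^sub>R x) ` unit_cone A"
  proof safe
    fix x :: 'a assume x: "x \<noteq> 0" "norm x \<le> R" "sgn x \<in> A"
    then have "(1 / R) *\<^sub>R x \<in> unit_cone A" using \<open>0 < R\<close> by (simp add: unit_cone_def sgn_scaleR)
    moreover have "x = R *\<^sub>R ((1 / R) *\<^sub>R x)" using \<open>0 < R\<close> by simp
    ultimately show "x \<in> (\<lambda>x. R *\<^sub>R x) ` unit_cone A" by blast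
  next
    fix x :: 'a assume "x \<in> unit_cone A"
    then have x: "x \<noteq> 0" "norm x \<le> 1" "sgn x \<in> A" by (auto simp: unit_cone_def)
    show "norm (R *\<^sub>R x) \<le> R" using x \<open>0 < R\<close> mult_left_mono[of "norm x" 1 R] by simp
    show "sgn (R *\<^sub>R x) \<in> A" using x \<open>0 < R\<close> by (simp add: sgn_scaleR)
    show "R *\<^sub>R x = 0 \<Longrightarrow> False" using x \<open>0 < R\<close> by simp
  qed
  then have "emeasure (span_lborel I) {x. x \<noteq> 0 \<and> norm x \<le> R \<and> sgn x \<in> A} =
      ennreal (R ^ Suc q) * emeasure (span_lborel I) (unit_cone A)"
    using emeasure_span_lborel_scaleR[OF I sets_unit_cone[OF A(1)] \<open>0 < R\<close>] card by simp
  also have "\<dots> = ennreal (R ^ Suc q / real (Suc q)) * hausdorff_outer (real q) A"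
    unfolding hausdorff_outer_sphere[OF I card A] card using \<open>0 < R\<close>
    by (simp add: mult.assoc[symmetric] ennreal_mult'[symmetric] del: power_Suc of_nat_Suc)
  finally show ?thesis .
qed

text \<open>For fixed \<open>A\<close>, the image under the norm of Lebesgue measure on the cone
  over \<open>A\<close> is compared with the density t^q times the measure of \<open>A\<close>. The
  two measures on the line agree on the rays \<open>{..R}\<close> by the volume of truncated
  cones.\<close>

lemma nn_integral_polar_indicator:
  fixes \<phi> :: "real \<Rightarrow> ennreal"
  assumes I: "orthonormal (I :: 'a::euclidean_space set)" and card: "card I = Suc q"
    and A: "A \<in> sets borel" "A \<subseteq> sphere 0 1 \<inter> span I" and [measurable]: "\<phi> \<in> borel_measurable borel"
  shows "(\<integral>\<^sup>+x. \<phi> (norm x) * indicator {x. x \<noteq> 0 \<and> sgn x \<in> A} x \<partial>span_lborel I) =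
    (\<integral>\<^sup>+t. \<phi> t * (indicator {0<..} t * ennreal (t ^ q)) \<partial>lborel) * hausdorff_outer (real q) A"
proof -
  define W where "W = {x::'a. x \<noteq> 0 \<and> sgn x \<in> A}"
  have W: "W \<in> sets borel"
  proof -
    have "W = (sgn -` A \<inter> space borel) - {0}" by (auto simp: W_def)
    also have "\<dots> \<in> sets borel"
      by (intro sets.Diff measurable_sets[OF borel_measurable_sgn_euclidean A(1)]) auto
    finally show ?thesis .
  qed
  note [measurable] = W
  define h where "h = hausdorff_outer (real q) A"
  \<comment> \<open>Makes both measures finite on the rays, as uniqueness from a generator
    requires.\<close>
  have hfin: "h < top"
  proof -
    have "bounded (unit_cone A)" by (rule bounded_subset[OF bounded_cball[of 0 1]]) (auto simp: unit_cone_def)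
    from emeasure_span_lborel_bounded[OF I this] show ?thesis
      unfolding h_def hausdorff_outer_sphere[OF I card A] by (simp add: ennreal_mult_less_top)
  qed
  define N1 where "N1 = distr (density (span_lborel I) (indicator W)) borel norm"
  define N2 where "N2 = density lborel (\<lambda>t::real. h * (indicator {0<..} t * ennreal (t ^ q)))"
  have e1: "emeasure N1 {..R} = (if 0 < R then ennreal (R ^ Suc q / real (Suc q)) * h else 0)" for R
  proof -
    have "emeasure N1 {..R} = emeasure (density (span_lborel I) (indicator W)) (norm -` {..R} \<inter> space (span_lborel I))"
      unfolding N1_def by (subst emeasure_distr) auto
    also have "\<dots> = emeasure (span_lborel I) (W \<inter> norm -` {..R})"
      by (subst emeasure_restricted) (auto intro: measurable_sets[of norm borel borel "{..R}", simplified])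
    also have "\<dots> = (if 0 < R then ennreal (R ^ Suc q / real (Suc q)) * h else 0)"
    proof (cases "0 < R")
      case True
      have "W \<inter> norm -` {..R} = {x. x \<noteq> 0 \<and> norm x \<le> R \<and> sgn x \<in> A}" by (auto simp: W_def)
      then show ?thesis using emeasure_polar_cone[OF I card A True] True by (simp add: h_def)
    next
      case False
      then have "W \<inter> norm -` {..R} = {}"
        by (auto simp: W_def) (metis norm_le_zero_iff order_trans not_less)
      then show ?thesis using False by simp
    qed
    finally show ?thesis .
  qed
  have e2: "emeasure N2 {..R} = (if 0 < R then ennreal (R ^ Suc q / real (Suc q)) * h else 0)" for R
  proof -
    have "emeasure N2 {..R} = (\<integral>\<^sup>+t. h * (indicator {0<..R} t * ennreal (t ^ q)) \<partial>lborel)"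
      unfolding N2_def by (subst emeasure_density) (auto intro!: nn_integral_cong simp: indicator_def)
    also have "\<dots> = h * (\<integral>\<^sup>+t. indicator {0<..R} t * ennreal (t ^ q) \<partial>lborel)"
      by (rule nn_integral_cmult) measurable
    also have "\<dots> = (if 0 < R then ennreal (R ^ Suc q / real (Suc q)) * h else 0)"
    proof (cases "0 < R")
      case True
      then show ?thesis unfolding nn_integral_power_interval[OF True]
        by (simp add: mult.commute del: power_Suc of_nat_Suc)
    qed simp
    finally show ?thesis .
  qed
  have "N1 = N2"
  proof (rule measure_eqI_generator_eq[of "range (\<lambda>R::real. {..R})" UNIV])
    show "Int_stable (range (\<lambda>R::real. {..R}))"
      by (auto simp: Int_stable_def)
    show "sets N1 = sigma_sets UNIV (range (\<lambda>R::real. {..R}))" "sets N2 = sigma_sets UNIV (range (\<lambda>R::real. {..R}))"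
      by (simp_all add: N1_def N2_def borel_eq_atMost)
    show "emeasure N1 X = emeasure N2 X" if "X \<in> range (\<lambda>R::real. {..R})" for X
      using that e1 e2 by auto
    show "(\<Union>i::nat. {..real i}) = UNIV" using real_arch_simple by auto
    show "emeasure N1 {..real i} \<noteq> \<infinity>" for i
      unfolding e1 using hfin by (auto simp: ennreal_mult_eq_top_iff)
  qed auto
  have "(\<integral>\<^sup>+x. \<phi> (norm x) * indicator W x \<partial>span_lborel I) =
      (\<integral>\<^sup>+x. \<phi> (norm x) \<partial>density (span_lborel I) (indicator W))"
    by (subst nn_integral_density) (auto simp: mult.commute)
  also have "\<dots> = (\<integral>\<^sup>+t. \<phi> t \<partial>N1)"
    unfolding N1_def by (subst nn_integral_distr) auto
  also have "\<dots> = (\<integral>\<^sup>+t. h * (\<phi> t * (indicator {0<..} t * ennreal (t ^ q))) \<partial>lborel)"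
    unfolding \<open>N1 = N2\<close> N2_def by (subst nn_integral_density) (auto simp: mult_ac)
  also have "\<dots> = (\<integral>\<^sup>+t. \<phi> t * (indicator {0<..} t * ennreal (t ^ q)) \<partial>lborel) * h"
    by (subst nn_integral_cmult) (auto simp: mult.commute)
  finally show ?thesis by (simp add: W_def h_def)
qed

text \<open>With the radial profile fixed, both sides integrate \<open>G\<close> against a measure
  on directions, and these measures agree by the indicator case. The condition
  \<open>\<phi> 0 = 0\<close> disposes of the origin, which has no direction.\<close>

theorem nn_integral_polar:
  fixes \<phi> :: "real \<Rightarrow> ennreal" and G :: "'a::euclidean_space \<Rightarrow> ennreal"
  assumes I: "orthonormal I" and card: "card I = Suc q"
    and [measurable]: "\<phi> \<in> borel_measurable borel" "G \<in> borel_measurable borel" and "\<phi> 0 = 0"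
  shows "(\<integral>\<^sup>+x. \<phi> (norm x) * G (sgn x) \<partial>span_lborel I) =
    (\<integral>\<^sup>+t. \<phi> t * (indicator {0<..} t * ennreal (t ^ q)) \<partial>lborel) *
    (\<integral>\<^sup>+u\<in>sphere 0 1 \<inter> span I. G u \<partial>hausdorff_measure (real q))"
proof -
  define c where "c = (\<integral>\<^sup>+t. \<phi> t * (indicator {0<..} t * ennreal (t ^ q)) \<partial>lborel)"
  let ?S = "sphere 0 1 \<inter> span I"
  have S [measurable]: "?S \<in> sets borel" by (intro sets.Int borel_span borel_closed) auto
  define M1 where "M1 = distr (density (span_lborel I) (\<lambda>x. \<phi> (norm x))) borel sgn"
  define M2 where "M2 = density (hausdorff_measure (real q)) (\<lambda>u. c * indicator ?S u)"
  have "M1 = M2"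
  proof (rule measure_eqI)
    fix A assume "A \<in> sets M1"
    then have A [measurable]: "A \<in> sets borel" by (simp add: M1_def)
    have AS [measurable]: "A \<inter> ?S \<in> sets borel" by measurable
    have m: "sgn -` A \<in> sets borel"
      using measurable_sets[OF borel_measurable_sgn_euclidean A] by simp
    have "emeasure M1 A = (\<integral>\<^sup>+x. \<phi> (norm x) * indicator (sgn -` A) x \<partial>span_lborel I)"
      unfolding M1_def using m by (subst emeasure_distr) (auto simp: emeasure_density)
    also have "\<dots> = (\<integral>\<^sup>+x. \<phi> (norm x) * indicator {x. x \<noteq> 0 \<and> sgn x \<in> A \<inter> ?S} x \<partial>span_lborel I)"
    proof (rule nn_integral_cong_AE)
      have "\<phi> (norm x) * indicator (sgn -` A) x = \<phi> (norm x) * indicator {x. x \<noteq> 0 \<and> sgn x \<in> A \<inter> ?S} x"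
        if "x \<in> span I" for x
      proof (cases "x = 0")
        case False
        then have "sgn x \<in> ?S" using that by (auto simp: norm_sgn) (simp add: sgn_div_norm span_scale)
        then show ?thesis using False by (simp add: indicator_def)
      qed (simp add: \<open>\<phi> 0 = 0\<close>)
      then show "AE x in span_lborel I. \<phi> (norm x) * indicator (sgn -` A) x =
          \<phi> (norm x) * indicator {x. x \<noteq> 0 \<and> sgn x \<in> A \<inter> ?S} x"
        using AE_span_lborel_in_span[of I] by (auto elim: eventually_mono)
    qed
    also have "\<dots> = c * hausdorff_outer (real q) (A \<inter> ?S)"
      unfolding c_def by (rule nn_integral_polar_indicator[OF I card AS]) auto
    also have "\<dots> = c * (\<integral>\<^sup>+u. indicator (A \<inter> ?S) u \<partial>hausdorff_measure (real q))"
      using AS by (simp add: emeasure_hausdorff_measure)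
    also have "\<dots> = (\<integral>\<^sup>+u. c * indicator (A \<inter> ?S) u \<partial>hausdorff_measure (real q))"
      by (rule nn_integral_cmult[symmetric]) (use AS in auto)
    also have "\<dots> = emeasure M2 A"
      unfolding M2_def using S
      by (subst emeasure_density) (auto intro!: nn_integral_cong simp: indicator_def)
    finally show "emeasure M1 A = emeasure M2 A" .
  qed (simp add: M1_def M2_def)
  have "(\<integral>\<^sup>+x. \<phi> (norm x) * G (sgn x) \<partial>span_lborel I) = (\<integral>\<^sup>+u. G u \<partial>M1)"
    unfolding M1_def by (subst nn_integral_distr) (auto simp: nn_integral_density)
  also have "\<dots> = (\<integral>\<^sup>+u. c * (G u * indicator ?S u) \<partial>hausdorff_measure (real q))"
    unfolding \<open>M1 = M2\<close> M2_def using S by (subst nn_integral_density) (auto simp: mult_ac)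
  also have "\<dots> = c * (\<integral>\<^sup>+u. G u * indicator ?S u \<partial>hausdorff_measure (real q))"
    using S by (intro nn_integral_cmult) auto
  finally show ?thesis by (simp add: c_def)
qed

section \<open>Gaussian integrals and projection of the sphere to a subspace\<close>

lemma nn_integral_Gamma_gaussian:
  assumes "0 < s"
  shows "(\<integral>\<^sup>+t. ennreal (t powr (s - 1) * exp (- t\<^sup>2)) * indicator {0<..} t \<partial>lborel) = ennreal (Gamma (s / 2) / 2)"
proof -
  let ?f = "\<lambda>x::real. x powr (s / 2 - 1) / exp x"
  let ?g = "\<lambda>t::real. t powr (s - 1) * exp (- t\<^sup>2)"
  \<comment> \<open>Substitution x = t^2 in Euler's integral, on compact intervals as the
    substitution rule demands: the bound N for t corresponds to N^2 for x. Monotone convergence then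
    removes the bound.\<close>
  have fin: "(\<integral>\<^sup>+x. ennreal (?f x) * indicator {0..(real N)\<^sup>2} x \<partial>lborel) =
      (\<integral>\<^sup>+t. ennreal (2 * ?g t) * indicator {0..real N} t \<partial>lborel)" for N
  proof -
    have "(\<integral>\<^sup>+x. ennreal (?f x) * indicator {0\<^sup>2..(real N)\<^sup>2} x \<partial>lborel) =
        (\<integral>\<^sup>+x. ennreal (?f x * indicator {0\<^sup>2..(real N)\<^sup>2} x) \<partial>lborel)"
      by (intro nn_integral_cong) (auto simp: indicator_def)
    also have "\<dots> = (\<integral>\<^sup>+t. ennreal (?f (t\<^sup>2) * (2 * t) * indicator {0..real N} t) \<partial>lborel)"
      by (subst nn_integral_substitution[where g = "\<lambda>x. x ^ 2" and g' = "\<lambda>x. 2 * x"])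
         (auto intro!: derivative_eq_intros continuous_intros simp: set_borel_measurable_def)
    also have "\<dots> = (\<integral>\<^sup>+t. ennreal (2 * ?g t) * indicator {0..real N} t \<partial>lborel)"
    proof (rule nn_integral_cong)
      fix t :: real
      show "ennreal (?f (t\<^sup>2) * (2 * t) * indicator {0..real N} t) = ennreal (2 * ?g t) * indicator {0..real N} t"
      proof (cases "0 < t")
        case True
        have "t\<^sup>2 = t powr 2" using True by (simp add: powr_numeral)
        then have "(t\<^sup>2) powr (s / 2 - 1) = t powr (s - 2)"
          by (simp add: powr_powr algebra_simps)
        moreover have "t powr (s - 2) * t = t powr (s - 1)"
          using True powr_mult_base[of t "s - 2"] by (simp add: mult.commute)
        ultimately show ?thesis by (auto simp: indicator_def exp_minus field_simps)
      next
        case False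
        then show ?thesis by (cases "t = 0") (auto simp: indicator_def)
      qed
    qed
    finally show ?thesis by simp
  qed
  have inc: "incseq (\<lambda>N x. ennreal (f x) * indicator {0..real N} x)" for f :: "real \<Rightarrow> real"
    by (auto simp: incseq_def le_fun_def indicator_def)
  have inc2: "incseq (\<lambda>N x. ennreal (f x) * indicator {0..(real N)\<^sup>2} x)" for f :: "real \<Rightarrow> real"
  proof -
    have "(real m)\<^sup>2 \<le> (real n)\<^sup>2" if "m \<le> n" for m n :: nat using that by (intro power_mono) auto
    then show ?thesis
      by (intro monoI le_funI mult_left_mono) (auto simp: indicator_def intro: order_trans)
  qed
  have sup: "(SUP N. ennreal (f x) * indicator {0..real N} x) = ennreal (f x) * indicator {0..} x"
    for f :: "real \<Rightarrow> real" and x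
  proof (cases "0 \<le> x")
    case True
    obtain N where "x \<le> real N" using real_arch_simple by blast
    have "ennreal (f x) * indicator {0..real N} x \<le> (SUP N. ennreal (f x) * indicator {0..real N} x)"
      by (rule SUP_upper) simp
    then have "ennreal (f x) \<le> (SUP N. ennreal (f x) * indicator {0..real N} x)"
      using True \<open>x \<le> real N\<close> by simp
    then show ?thesis using True
      by (intro antisym SUP_least) (auto simp: indicator_def)
  qed auto
  have sup2: "(SUP N. ennreal (f x) * indicator {0..(real N)\<^sup>2} x) = ennreal (f x) * indicator {0..} x"
    for f :: "real \<Rightarrow> real" and x
  proof (cases "0 \<le> x")
    case True
    obtain N where N: "sqrt x \<le> real N" using real_arch_simple by blast
    then have "x \<le> (real N)\<^sup>2" using True real_sqrt_le_iff' of_nat_0_le_iff by blast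
    have "ennreal (f x) * indicator {0..(real N)\<^sup>2} x \<le> (SUP N. ennreal (f x) * indicator {0..(real N)\<^sup>2} x)"
      by (rule SUP_upper) simp
    then have "ennreal (f x) \<le> (SUP N. ennreal (f x) * indicator {0..(real N)\<^sup>2} x)"
      using True \<open>x \<le> (real N)\<^sup>2\<close> by simp
    then show ?thesis using True
      by (intro antisym SUP_least) (auto simp: indicator_def)
  qed auto
  have "ennreal (Gamma (s / 2)) = (\<integral>\<^sup>+x. ennreal (?f x) * indicator {0..} x \<partial>lborel)"
    using assms by (subst Gamma_conv_nn_integral_real) (auto intro!: nn_integral_cong simp: indicator_def)
  also have "\<dots> = (SUP N. \<integral>\<^sup>+x. ennreal (?f x) * indicator {0..(real N)\<^sup>2} x \<partial>lborel)"
    unfolding sup2[of ?f, symmetric] by (intro nn_integral_monotone_convergence_SUP inc2) auto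
  also have "\<dots> = (SUP N. \<integral>\<^sup>+t. ennreal (2 * ?g t) * indicator {0..real N} t \<partial>lborel)"
    unfolding fin ..
  also have "\<dots> = (\<integral>\<^sup>+t. ennreal (2 * ?g t) * indicator {0..} t \<partial>lborel)"
    unfolding sup[of "\<lambda>t. 2 * ?g t", symmetric]
    by (intro nn_integral_monotone_convergence_SUP[symmetric] inc) auto
  also have "\<dots> = (\<integral>\<^sup>+t. 2 * (ennreal (?g t) * indicator {0<..} t) \<partial>lborel)"
    by (intro nn_integral_cong_AE AE_I[of _ _ "{0}"]) (auto simp: indicator_def ennreal_mult')
  also have "\<dots> = 2 * (\<integral>\<^sup>+t. ennreal (?g t) * indicator {0<..} t \<partial>lborel)"
    by (rule nn_integral_cmult) auto
  finally have "ennreal (1 / 2) * ennreal (Gamma (s / 2)) =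
      ennreal (1 / 2) * (2 * (\<integral>\<^sup>+t. ennreal (?g t) * indicator {0<..} t \<partial>lborel))" by simp
  moreover have "ennreal (1 / 2) * (2 * z) = z" for z :: ennreal
  proof -
    have "ennreal (1 / 2) * 2 = ennreal (1 / 2) * ennreal 2" by simp
    also have "\<dots> = 1" by (subst ennreal_mult'[symmetric]) auto
    finally show ?thesis by (simp add: mult.assoc[symmetric])
  qed
  moreover have "ennreal (1 / 2) * ennreal (Gamma (s / 2)) = ennreal (Gamma (s / 2) / 2)"
    by (subst ennreal_mult'[symmetric]) auto
  ultimately show ?thesis by (simp only:)
qed

lemma nn_integral_gaussian_span_lborel:
  assumes "orthonormal (J :: 'a::euclidean_space set)"
  shows "(\<integral>\<^sup>+y. ennreal (exp (- (norm y)\<^sup>2)) \<partial>span_lborel J) = ennreal (pi powr (real (card J) / 2))"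
proof -
  interpret product_sigma_finite "\<lambda>_::'a. lborel :: real measure" by standard
  have "has_bochner_integral lborel (\<lambda>x::real. exp (- x\<^sup>2)) (sqrt pi)"
    using has_bochner_integral_even_function[OF gaussian_moment_0] by simp
  then have g: "(\<integral>\<^sup>+t. ennreal (exp (- (t::real)\<^sup>2)) \<partial>lborel) = ennreal (sqrt pi)"
    by (simp add: has_bochner_integral_iff nn_integral_eq_integral)
  have "(\<integral>\<^sup>+y. ennreal (exp (- (norm y)\<^sup>2)) \<partial>span_lborel J) =
      (\<integral>\<^sup>+f. (\<Prod>b\<in>J. ennreal (exp (- (f b)\<^sup>2))) \<partial>Pi\<^sub>M J (\<lambda>_. lborel))"
    unfolding span_lborel_def using assms
    by (subst nn_integral_distr)
       (auto simp: norm_coord_comb orthonormal_def sum_negf[symmetric] exp_sum prod_ennreal intro!: nn_integral_cong)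
  also have "\<dots> = (\<Prod>b\<in>J. ennreal (sqrt pi))"
    using assms by (subst product_nn_integral_prod) (auto simp: g orthonormal_def)
  also have "\<dots> = ennreal (sqrt pi ^ card J)" by (simp add: ennreal_power)
  also have "sqrt pi ^ card J = pi powr (real (card J) / 2)"
    by (simp add: powr_half_sqrt[symmetric] powr_realpow[symmetric] powr_powr)
  finally show ?thesis .
qed

definition span_proj :: "'a::euclidean_space set \<Rightarrow> 'a \<Rightarrow> 'a" where
  "span_proj I x = (\<Sum>b\<in>I. (x \<bullet> b) *\<^sub>R b)"

lemma measurable_span_proj [measurable]: "span_proj I \<in> borel_measurable borel"
  unfolding span_proj_def[abs_def] by measurable

lemma span_proj_in_span: "span_proj I x \<in> span I"
  unfolding span_proj_def by (intro span_sum span_scale span_base)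

lemma span_proj_add:
  assumes IJ: "orthonormal (I \<union> J)" "I \<inter> J = {}" and x: "x \<in> span I" and y: "y \<in> span J"
  shows "span_proj I (x + y) = x" "x \<bullet> y = 0"
proof -
  have I: "orthonormal I" using IJ by (auto simp: orthonormal_def pairwise_def)
  have orth: "orthogonal b y" if "b \<in> I" for b
  proof (rule orthogonal_to_span[OF y])
    fix z assume z: "z \<in> J"
    then have "b \<noteq> z" using that IJ(2) by blast
    then show "orthogonal b z" using IJ(1) that z unfolding orthonormal_def pairwise_def by blast
  qed
  then have "(x + y) \<bullet> b = x \<bullet> b" if "b \<in> I" for b
    using that by (simp add: inner_add_left orthogonal_def inner_commute[of y])
  then have "span_proj I (x + y) = coord_comb I (\<lambda>b. x \<bullet> b)"
    by (simp add: span_proj_def coord_comb_def)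
  then show "span_proj I (x + y) = x" using coord_comb_of_span[OF I x] by simp
  have "orthogonal y x" by (rule orthogonal_to_span[OF x]) (use orth in \<open>simp add: orthogonal_commute\<close>)
  then show "x \<bullet> y = 0" by (simp add: orthogonal_def inner_commute)
qed

lemma sphere_const_pos: "0 < s \<Longrightarrow> 0 < sphere_const s"
  by (simp add: sphere_const_def)

lemma Gamma_half_eq_sphere_const: "0 < s \<Longrightarrow> Gamma (s / 2) / 2 = pi powr (s / 2) / sphere_const s"
  by (simp add: sphere_const_def Gamma_real_pos)

text \<open>
  Both sides arise from integrating the function \<open>exp (- |x|\<^sup>2) |Px|\<^sup>r g (Px / |Px|)\<close>, once in polar
  coordinates of the whole space and once as a product over \<open>span I\<close> and its orthogonal complement.
\<close>

theorem nn_integral_sphere_span_proj: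
  fixes I J :: "'a::euclidean_space set" and g :: "'a \<Rightarrow> ennreal"
  assumes on: "orthonormal (I \<union> J)" and "I \<inter> J = {}" and cardI: "card I = Suc q" and "0 < r"
    and [measurable]: "g \<in> borel_measurable borel"
  shows "(\<integral>\<^sup>+u\<in>sphere 0 1 \<inter> span (I \<union> J). ennreal (norm (span_proj I u) powr r) * g (sgn (span_proj I u))
      \<partial>hausdorff_measure (real (card (I \<union> J) - 1))) =
    ennreal (sphere_const (real (card (I \<union> J)) + r) / sphere_const (real (card I) + r)) *
    (\<integral>\<^sup>+u\<in>sphere 0 1 \<inter> span I. g u \<partial>hausdorff_measure (real q))"
proof -
  have I: "orthonormal I" and J: "orthonormal J" using on by (auto simp: orthonormal_def pairwise_def)
  define n where "n = card (I \<union> J)"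
  have n: "n = card I + card J"
    using on \<open>I \<inter> J = {}\<close> by (simp add: n_def card_Un_disjoint orthonormal_def)
  then have cardn: "card (I \<union> J) = Suc (n - 1)" using cardI n_def by simp
  \<comment> \<open>The same radial profile serves both spaces: the power t^r comes from the factor
    |Px|^r, on the whole space by homogeneity and on \<open>span I\<close> because P is the identity
    there.\<close>
  define \<phi> where "\<phi> t = ennreal (t powr r * exp (- t\<^sup>2))" for t :: real
  have [measurable]: "\<phi> \<in> borel_measurable borel" unfolding \<phi>_def[abs_def] by measurable
  have \<phi>0: "\<phi> 0 = 0" by (simp add: \<phi>_def)
  have \<phi>int: "(\<integral>\<^sup>+t. \<phi> t * (indicator {0<..} t * ennreal (t ^ k)) \<partial>lborel) =
      ennreal (pi powr ((real (Suc k) + r) / 2) / sphere_const (real (Suc k) + r))" for k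
  proof -
    have "(\<integral>\<^sup>+t. \<phi> t * (indicator {0<..} t * ennreal (t ^ k)) \<partial>lborel) =
        (\<integral>\<^sup>+t. ennreal (t powr (real (Suc k) + r - 1) * exp (- t\<^sup>2)) * indicator {0<..} t \<partial>lborel)"
      by (intro nn_integral_cong)
         (auto simp: \<phi>_def indicator_def ennreal_mult'[symmetric] powr_add powr_realpow mult_ac)
    also have "\<dots> = ennreal (Gamma ((real (Suc k) + r) / 2) / 2)"
      using \<open>0 < r\<close> by (intro nn_integral_Gamma_gaussian) simp
    also have "\<dots> = ennreal (pi powr ((real (Suc k) + r) / 2) / sphere_const (real (Suc k) + r))"
      using \<open>0 < r\<close> by (subst Gamma_half_eq_sphere_const) auto
    finally show ?thesis .
  qed
  define G where "G u = ennreal (norm (span_proj I u) powr r) * g (sgn (span_proj I u))" for u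
  have [measurable]: "G \<in> borel_measurable borel" unfolding G_def[abs_def] by measurable
  define F where "F x = ennreal (exp (- (norm x)\<^sup>2)) * G x" for x
  have [measurable]: "F \<in> borel_measurable borel" unfolding F_def[abs_def] by measurable
  \<comment> \<open>Homogeneity of degree \<open>r\<close>: the projection is linear and
    \<open>sgn\<close> ignores positive factors.\<close>
  have G_scale: "G (t *\<^sub>R u) = ennreal (t powr r) * G u" if "0 < t" for t u
  proof -
    have "span_proj I (t *\<^sub>R u) = t *\<^sub>R span_proj I u"
      by (simp add: span_proj_def scaleR_sum_right)
    then show ?thesis using that
      by (simp add: G_def sgn_scaleR powr_mult ennreal_mult' mult.assoc)
  qed
  have F_polar: "F x = \<phi> (norm x) * G (sgn x)" for x
  proof (cases "x = 0")
    case True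
    then show ?thesis by (simp add: F_def G_def span_proj_def \<phi>0)
  next
    case False
    then have "G x = ennreal (norm x powr r) * G (sgn x)"
      using G_scale[of "norm x" "sgn x"] by (simp add: sgn_div_norm)
    then show ?thesis by (simp add: F_def \<phi>_def ennreal_mult' mult_ac)
  qed
  have "(\<integral>\<^sup>+x. F x \<partial>span_lborel (I \<union> J)) =
      ennreal (pi powr ((real n + r) / 2) / sphere_const (real n + r)) *
      (\<integral>\<^sup>+u\<in>sphere 0 1 \<inter> span (I \<union> J). G u \<partial>hausdorff_measure (real (n - 1)))"
    unfolding F_polar using cardn n_def nn_integral_polar[OF on cardn, of \<phi> G] \<phi>int[of "n - 1"] \<phi>0 by simp
  moreover have "(\<integral>\<^sup>+x. F x \<partial>span_lborel (I \<union> J)) =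
      ennreal (pi powr (real (card J) / 2)) * (ennreal (pi powr ((real (card I) + r) / 2) / sphere_const (real (card I) + r)) *
      (\<integral>\<^sup>+u\<in>sphere 0 1 \<inter> span I. g u \<partial>hausdorff_measure (real q)))"
  proof -
    have "(\<integral>\<^sup>+x. F x \<partial>span_lborel (I \<union> J)) = (\<integral>\<^sup>+x. \<integral>\<^sup>+y. F (x + y) \<partial>span_lborel J \<partial>span_lborel I)"
      by (rule nn_integral_span_lborel_Un[OF I J \<open>I \<inter> J = {}\<close>]) measurable
    also have "\<dots> = (\<integral>\<^sup>+x. ennreal (pi powr (real (card J) / 2)) * (\<phi> (norm x) * g (sgn x)) \<partial>span_lborel I)"
    proof (rule nn_integral_cong_AE)
      have "(\<integral>\<^sup>+y. F (x + y) \<partial>span_lborel J) = ennreal (pi powr (real (card J) / 2)) * (\<phi> (norm x) * g (sgn x))"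
        if x: "x \<in> span I" for x
      proof -
        \<comment> \<open>The projection of x + y is x, and by Pythagoras the Gaussian factors, so
          the integral over the complement splits off as a constant.\<close>
        have "F (x + y) = (\<phi> (norm x) * g (sgn x)) * ennreal (exp (- (norm y)\<^sup>2))" if y: "y \<in> span J" for y
        proof -
          have "(norm (x + y))\<^sup>2 = (norm x)\<^sup>2 + (norm y)\<^sup>2"
            using span_proj_add(2)[OF on \<open>I \<inter> J = {}\<close> x y]
            by (simp add: power2_norm_eq_inner inner_add_left inner_add_right inner_commute)
          then have "exp (- (norm (x + y))\<^sup>2) = exp (- (norm x)\<^sup>2) * exp (- (norm y)\<^sup>2)"
            by (simp add: mult_exp_exp)
          then show ?thesis
            by (simp add: F_def G_def \<phi>_def span_proj_add(1)[OF on \<open>I \<inter> J = {}\<close> x y] ennreal_mult' mult_ac)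
        qed
        then have "(\<integral>\<^sup>+y. F (x + y) \<partial>span_lborel J) =
            (\<integral>\<^sup>+y. (\<phi> (norm x) * g (sgn x)) * ennreal (exp (- (norm y)\<^sup>2)) \<partial>span_lborel J)"
          using AE_span_lborel_in_span[of J] by (intro nn_integral_cong_AE) (auto elim: eventually_mono)
        also have "\<dots> = (\<phi> (norm x) * g (sgn x)) * (\<integral>\<^sup>+y. ennreal (exp (- (norm y)\<^sup>2)) \<partial>span_lborel J)"
          by (rule nn_integral_cmult) measurable
        finally show ?thesis by (simp add: nn_integral_gaussian_span_lborel[OF J] mult.commute)
      qed
      then show "AE x in span_lborel I. (\<integral>\<^sup>+y. F (x + y) \<partial>span_lborel J) =
          ennreal (pi powr (real (card J) / 2)) * (\<phi> (norm x) * g (sgn x))"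
        using AE_span_lborel_in_span[of I] by (auto elim: eventually_mono)
    qed
    also have "\<dots> = ennreal (pi powr (real (card J) / 2)) * (\<integral>\<^sup>+x. \<phi> (norm x) * g (sgn x) \<partial>span_lborel I)"
      by (rule nn_integral_cmult) measurable
    finally show ?thesis
      using nn_integral_polar[OF I cardI, of \<phi> g] \<phi>int[of q] \<phi>0 cardI by simp
  qed
  ultimately have eq: "ennreal (pi powr ((real n + r) / 2) / sphere_const (real n + r)) *
      (\<integral>\<^sup>+u\<in>sphere 0 1 \<inter> span (I \<union> J). G u \<partial>hausdorff_measure (real (n - 1))) =
      ennreal (pi powr (real (card J) / 2)) * (ennreal (pi powr ((real (card I) + r) / 2) / sphere_const (real (card I) + r)) *
      (\<integral>\<^sup>+u\<in>sphere 0 1 \<inter> span I. g u \<partial>hausdorff_measure (real q)))"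
    (is "ennreal ?a * ?X = ennreal ?b * (ennreal ?c * ?Y)") by simp
  have pos: "0 < sphere_const (real n + r)" "0 < sphere_const (real (card I) + r)"
    using \<open>0 < r\<close> by (auto intro!: sphere_const_pos)
  \<comment> \<open>The integrals may be infinite; the positive finite constant is removed by
    multiplication with its inverse.\<close>
  have "?X = ennreal (1 / ?a) * (ennreal ?a * ?X)"
    using pos by (simp add: mult.assoc[symmetric] ennreal_mult'[symmetric])
  also have "\<dots> = ennreal (1 / ?a * ?b * ?c) * ?Y"
    unfolding eq using pos by (simp add: mult.assoc[symmetric] ennreal_mult'[symmetric] del: times_divide_eq_left times_divide_eq_right)
  also have "1 / ?a * ?b * ?c = sphere_const (real n + r) / sphere_const (real (card I) + r)"
  proof -
    have "pi powr ((real n + r) / 2) = pi powr (real (card J) / 2) * pi powr ((real (card I) + r) / 2)"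
      by (simp add: powr_add[symmetric] n field_simps)
    then show ?thesis by simp
  qed
  finally show ?thesis by (simp add: G_def n_def)
qed

lemma orthonormal_complement_exists:
  assumes I: "orthonormal (I :: 'a::euclidean_space set)"
  obtains J where "orthonormal (I \<union> J)" "I \<inter> J = {}" "span (I \<union> J) = UNIV"
proof -
  define S where "S = {y. \<forall>b\<in>I. b \<bullet> y = 0}"
  have "subspace S" unfolding S_def subspace_def by (auto simp: inner_add_right)
  then obtain J where J: "orthonormal J" "span J = S" by (rule orthonormal_basis_subspace_exists)
  have JS: "J \<subseteq> S" using J span_superset by blast
  have disj: "I \<inter> J = {}"
  proof (rule ccontr)
    assume "I \<inter> J \<noteq> {}"
    then obtain b where "b \<in> I" "b \<in> S" using JS by blast
    then have "b \<bullet> b = 0" by (simp add: S_def)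
    then show False using I \<open>b \<in> I\<close> by (auto simp: orthonormal_def)
  qed
  have orth: "orthogonal b y" "orthogonal y b" if "b \<in> I" "y \<in> J" for b y
    using that JS by (auto simp: S_def orthogonal_def inner_commute)
  have on: "orthonormal (I \<union> J)"
    using I J(1) orth by (auto simp: orthonormal_def pairwise_def)
  have "x \<in> span (I \<union> J)" for x
  proof -
    have "x - span_proj I x \<in> S"
    proof -
      have "b \<bullet> (x - span_proj I x) = 0" if "b \<in> I" for b
        using coord_comb_inner[OF I that, of "\<lambda>b. x \<bullet> b"]
        by (simp add: span_proj_def coord_comb_def inner_diff_right inner_commute[of b])
      then show ?thesis by (simp add: S_def)
    qed
    then have "x - span_proj I x \<in> span (I \<union> J)" using J(2) span_mono[of J "I \<union> J"] by auto
    moreover have "span_proj I x \<in> span (I \<union> J)" using span_proj_in_span span_mono[of I "I \<union> J"] by blast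
    ultimately show ?thesis using span_add by fastforce
  qed
  then show ?thesis using that on disj by blast
qed

text \<open>By \<open>hausdorff_outer_sphere\<close> the area is a multiple of the volume of a
  bounded cone. It enters the local finiteness of the hyperplane intensity.\<close>

lemma emeasure_hausdorff_sphere_finite:
  "emeasure (hausdorff_measure (real (DIM('a) - 1))) (sphere 0 1 :: 'a::euclidean_space set) < \<infinity>"
proof -
  have on: "orthonormal (Basis :: 'a set)"
    by (auto simp: orthonormal_def pairwise_def orthogonal_def inner_Basis)
  have card: "card (Basis :: 'a set) = Suc (DIM('a) - 1)" using DIM_positive[where 'a='a] by linarith
  have "bounded (unit_cone (sphere 0 1) :: 'a set)"
    by (rule bounded_subset[OF bounded_cball[of 0 1]]) (auto simp: unit_cone_def)
  from emeasure_span_lborel_bounded[OF on this] show ?thesis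
    using hausdorff_outer_sphere[OF on card, of "sphere 0 1"]
    by (simp add: emeasure_hausdorff_measure ennreal_mult_less_top)
qed

subsection \<open>Spaces of flats\<close>

lemma space_flat_space [simp]: "space (flat_space V k) = affine_flats V k"
  unfolding flat_space_def by (rule space_measure_of) auto

lemma sets_flat_space_hit:
  "compact C \<Longrightarrow> {E \<in> affine_flats V k. E \<inter> C \<noteq> {}} \<in> sets (flat_space V k)"
  unfolding flat_space_def by (rule in_measure_of) auto

lemma measurable_flat_spaceI:
  assumes "\<And>x. x \<in> space N \<Longrightarrow> f x \<in> affine_flats V k"
    and "\<And>C. compact C \<Longrightarrow> {x \<in> space N. f x \<inter> C \<noteq> {}} \<in> sets N"
  shows "f \<in> measurable N (flat_space V k)"
  unfolding flat_space_def
proof (rule measurable_measure_of)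
  fix y assume "y \<in> {{E \<in> affine_flats V k. E \<inter> C \<noteq> {}} |C. compact C}"
  then obtain C where C: "compact C" "y = {E \<in> affine_flats V k. E \<inter> C \<noteq> {}}" by blast
  have "f -` y \<inter> space N = {x \<in> space N. f x \<inter> C \<noteq> {}}" using C(2) assms(1) by auto
  then show "f -` y \<inter> space N \<in> sets N" using assms(2)[OF C(1)] by simp
qed (use assms(1) in auto)

text \<open>A common form for the hyperplanes of the whole space and the flats t u + (u^\<bottom>
  \<inter> L) of the section. The vector \<open>u\<close> need not be a unit vector, so traces of
  hyperplanes, whose normal is a projection, are level flats as well.\<close>

definition level_flat :: "'a::euclidean_space set \<Rightarrow> 'a \<Rightarrow> real \<Rightarrow> 'a set" where
  "level_flat L u t = {x \<in> L. x \<bullet> u = t}"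

lemma hyperplane_eq_level_flat: "hyperplane u t = level_flat UNIV u t"
  by (simp add: hyperplane_def level_flat_def)

lemma translated_section_eq_level_flat:
  assumes "subspace L" "u \<in> L" "norm u = 1"
  shows "(\<lambda>x. t *\<^sub>R u + x) ` ({x. x \<bullet> u = 0} \<inter> L) = level_flat L u t"
proof -
  have uu: "u \<bullet> u = 1" using assms by (simp add: norm_eq_1)
  have "x \<in> (\<lambda>x. t *\<^sub>R u + x) ` ({x. x \<bullet> u = 0} \<inter> L)" if "x \<in> L" "x \<bullet> u = t" for x
  proof (rule image_eqI)
    show "x = t *\<^sub>R u + (x - t *\<^sub>R u)" by simp
    show "x - t *\<^sub>R u \<in> {x. x \<bullet> u = 0} \<inter> L"
      using that assms uu by (auto simp: inner_diff_left intro: subspace_diff subspace_scale)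
  qed
  moreover have "t *\<^sub>R u + x \<in> L \<and> (t *\<^sub>R u + x) \<bullet> u = t" if "x \<in> L" "x \<bullet> u = 0" for x
    using that assms uu by (simp add: inner_add_left subspace_add subspace_scale)
  ultimately show ?thesis unfolding level_flat_def by blast
qed

lemma level_flat_in_affine_flats:
  assumes "subspace L" "u \<in> L" "u \<noteq> 0"
  shows "level_flat L u t \<in> affine_flats L (dim L - 1)"
proof -
  have eq: "level_flat L u t = L \<inter> {x. u \<bullet> x = t}" by (auto simp: level_flat_def inner_commute)
  have aff: "affine L" using assms subspace_imp_affine by blast
  \<comment> \<open>The multiples of \<open>u\<close> at the levels t and t + 1 show that the
    hyperplane meets \<open>L\<close> without containing it.\<close>
  have "(t / (u \<bullet> u)) *\<^sub>R u \<in> L \<inter> {x. u \<bullet> x = t}"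
    using assms by (auto intro: subspace_scale)
  then have ne: "L \<inter> {x. u \<bullet> x = t} \<noteq> {}" by blast
  have "((t + 1) / (u \<bullet> u)) *\<^sub>R u \<in> L - {x. u \<bullet> x = t}"
    using assms by (auto intro: subspace_scale)
  then have nsub: "\<not> L \<subseteq> {x. u \<bullet> x = t}" by blast
  have "dim L \<noteq> 0" using assms by (auto simp: dim_eq_0)
  then have "int (dim L - 1) = int (dim L) - 1" by linarith
  then have "aff_dim (L \<inter> {x. u \<bullet> x = t}) = int (dim L - 1)"
    using aff_dim_affine_Int_hyperplane[OF aff, of u t] ne nsub assms(1) by (simp only: aff_dim_subspace if_False)
  moreover have "affine (L \<inter> {x. u \<bullet> x = t})" using aff by (intro affine_Int affine_hyperplane)
  ultimately show ?thesis unfolding affine_flats_def eq by blast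
qed

text \<open>The restriction to unit vectors of \<open>L\<close> is part of the set, so that it is
  Borel in the full product; for \<open>u = 0\<close> the level set would be \<open>L\<close> or
  empty.\<close>

definition flat_params :: "'a::euclidean_space set \<Rightarrow> 'a set set \<Rightarrow> ('a \<times> real) set" where
  "flat_params L B = {(u, t). u \<in> sphere 0 1 \<inter> L \<and> level_flat L u t \<in> B}"

text \<open>A level flat hits a compact C iff its parameters lie in the projection of the closed set
  x.u = t along the compact set C \<inter> L. Such a projection is closed, so the parametrization is
  measurable with respect to the hitting sets.\<close>

lemma sets_flat_params:
  assumes L: "subspace L" and B: "B \<in> sets (flat_space L (dim L - 1))"
  shows "flat_params L B \<in> sets (borel \<Otimes>\<^sub>M borel)"
proof -
  let ?D = "(sphere 0 1 \<inter> L) \<times> (UNIV :: real set)"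
  have clL: "closed L" using L by (rule closed_subspace)
  have D: "?D \<in> sets borel"
    by (intro borel_closed closed_Times closed_Int clL) auto
  let ?N = "restrict_space borel ?D"
  have "(\<lambda>(u, t). level_flat L u t) \<in> measurable ?N (flat_space L (dim L - 1))"
  proof (rule measurable_flat_spaceI)
    fix z assume "z \<in> space ?N"
    then obtain u t where z: "z = (u, t)" "u \<in> sphere 0 1 \<inter> L" by (auto simp: space_restrict_space)
    then have "u \<in> L" "u \<noteq> 0" by auto
    then show "(\<lambda>(u, t). level_flat L u t) z \<in> affine_flats L (dim L - 1)"
      using level_flat_in_affine_flats[OF L, of u t] z(1) by simp
  next
    fix C :: "'a set" assume "compact C"
    have "closed {(x, u, t). x \<bullet> u = (t::real)}" for x
      unfolding case_prod_beta by (intro closed_Collect_eq continuous_intros)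
    then have "closed {z. \<exists>x. x \<in> C \<inter> L \<and> (x, z) \<in> {(x, u, t). x \<bullet> u = t}}"
      using \<open>compact C\<close> clL by (intro closed_compact_projection compact_Int_closed) auto
    then have Z: "{z. \<exists>x. x \<in> C \<inter> L \<and> x \<bullet> fst z = snd z} \<in> sets borel"
      by (intro borel_closed) (simp add: case_prod_beta)
    have "{z \<in> space ?N. (\<lambda>(u, t). level_flat L u t) z \<inter> C \<noteq> {}} = ?D \<inter> {z. \<exists>x. x \<in> C \<inter> L \<and> x \<bullet> fst z = snd z}"
      by (auto simp: space_restrict_space level_flat_def)
    then show "{z \<in> space ?N. (\<lambda>(u, t). level_flat L u t) z \<inter> C \<noteq> {}} \<in> sets ?N"
      using D Z by (subst sets_restrict_space_iff) auto
  qed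
  from measurable_sets[OF this B]
  have "(\<lambda>(u, t). level_flat L u t) -` B \<inter> space ?N \<in> sets borel"
    using D by (subst (asm) sets_restrict_space_iff) auto
  moreover have "(\<lambda>(u, t). level_flat L u t) -` B \<inter> space ?N = flat_params L B"
    by (auto simp: flat_params_def space_restrict_space)
  ultimately show ?thesis unfolding borel_prod by simp
qed

text \<open>Through \<open>flat_params\<close> this is a Borel function of \<open>u\<close> on the
  whole space, which vanishes off the unit sphere of \<open>L\<close> and is the inner integral of
  the theorem on it.\<close>

definition level_mass :: "real \<Rightarrow> 'a::euclidean_space set \<Rightarrow> 'a set set \<Rightarrow> 'a \<Rightarrow> ennreal" where
  "level_mass r L B u = (\<integral>\<^sup>+t. indicator (flat_params L B) (u, t) * ennreal (\<bar>t\<bar> powr (r - 1)) \<partial>lborel)"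

lemma measurable_level_mass:
  assumes "subspace L" "B \<in> sets (flat_space L (dim L - 1))"
  shows "level_mass r L B \<in> borel_measurable borel"
proof -
  have [measurable]: "flat_params L B \<in> sets (borel \<Otimes>\<^sub>M borel)" by (rule sets_flat_params[OF assms])
  have "(\<lambda>(u, t). indicator (flat_params L B) (u, t) * ennreal (\<bar>t\<bar> powr (r - 1)))
      \<in> borel_measurable (borel \<Otimes>\<^sub>M lborel)"
    by measurable
  then show ?thesis unfolding level_mass_def[abs_def]
    by (rule sigma_finite_measure.borel_measurable_nn_integral[OF sigma_finite_lborel])
qed

lemma level_mass_eq:
  assumes "u \<in> sphere 0 1 \<inter> L"
  shows "level_mass r L B u = (\<integral>\<^sup>+t. indicator B (level_flat L u t) * ennreal (\<bar>t\<bar> powr (r - 1)) \<partial>lborel)"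
  using assms unfolding level_mass_def by (intro nn_integral_cong) (auto simp: flat_params_def indicator_def)

section \<open>Traces of hyperplanes on a subspace\<close>

lemma sets_hit_subspace:
  assumes "subspace (L :: 'a::euclidean_space set)"
  shows "{H \<in> affine_flats UNIV k. H \<inter> L \<noteq> {}} \<in> sets (flat_space UNIV k)"
    and "{H \<in> affine_flats UNIV k. L \<subseteq> H} \<in> sets (flat_space UNIV k)"
proof -
  have clL: "closed L" using assms by (rule closed_subspace)
  \<comment> \<open>\<open>L\<close> need not be compact, but it is exhausted by its intersections
    with balls.\<close>
  have "{H \<in> affine_flats UNIV k. H \<inter> L \<noteq> {}} =
      (\<Union>N::nat. {H \<in> affine_flats UNIV k. H \<inter> (cball 0 (real N) \<inter> L) \<noteq> {}})"
  proof -
    have "\<exists>N::nat. x \<in> cball 0 (real N)" for x :: 'a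
      using real_arch_simple[of "norm x"] by auto
    then show ?thesis by blast
  qed
  also have "\<dots> \<in> sets (flat_space UNIV k)"
    using clL by (intro sets.countable_UN image_subsetI sets_flat_space_hit compact_Int_closed) auto
  finally show "{H \<in> affine_flats UNIV k. H \<inter> L \<noteq> {}} \<in> sets (flat_space UNIV k)" .
  obtain I where I: "orthonormal I" "span I = L" using orthonormal_basis_subspace_exists[OF assms] .
  \<comment> \<open>An affine set through 0 is a subspace, so containing \<open>L\<close> means
    hitting finitely many singletons, which are compact: those of 0 and of the basis
    vectors.\<close>
  have "L \<subseteq> H \<longleftrightarrow> (\<forall>x\<in>insert 0 I. H \<inter> {x} \<noteq> {})" if "affine H" for H
  proof
    assume "\<forall>x\<in>insert 0 I. H \<inter> {x} \<noteq> {}"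
    then have "subspace H" "I \<subseteq> H" using that by (auto simp: subspace_affine)
    then show "L \<subseteq> H" using I(2) span_minimal by blast
  next
    assume "L \<subseteq> H"
    then show "\<forall>x\<in>insert 0 I. H \<inter> {x} \<noteq> {}" using I(2) span_superset span_zero[of I] by auto
  qed
  then have "{H \<in> affine_flats UNIV k. L \<subseteq> H} = (\<Inter>x\<in>insert 0 I. {H \<in> affine_flats UNIV k. H \<inter> {x} \<noteq> {}})"
    by (auto simp: affine_flats_def)
  also have "\<dots> \<in> sets (flat_space UNIV k)"
    using I(1) by (intro sets.finite_INT sets_flat_space_hit) (auto simp: orthonormal_def)
  finally show "{H \<in> affine_flats UNIV k. L \<subseteq> H} \<in> sets (flat_space UNIV k)" .
qed

lemma hyperplane_Int_subspace_in_affine_flats: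
  assumes L: "subspace L" and H: "H \<in> affine_flats UNIV (DIM('a) - 1)"
    and "H \<inter> L \<noteq> {}" "\<not> L \<subseteq> H"
  shows "H \<inter> (L :: 'a::euclidean_space set) \<in> affine_flats L (dim L - 1)"
proof -
  have H': "affine H" "aff_dim H = int (DIM('a) - 1)" using H by (auto simp: affine_flats_def)
  have "aff_dim H = int DIM('a) - 1" using H'(2) DIM_positive[where 'a='a] by linarith
  then have "\<exists>a b. a \<noteq> 0 \<and> affine hull H = {x. a \<bullet> x = b}"
    by (intro aff_dim_eq_hyperplane[THEN iffD1]) simp
  moreover have "affine hull H = H" using H'(1) by simp
  ultimately obtain a b where ab: "a \<noteq> 0" "H = {x. a \<bullet> x = b}" by auto
  have affL: "affine L" using L subspace_imp_affine by blast
  \<comment> \<open>Rules out truncation in the natural subtraction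
    \<open>dim L - 1\<close>.\<close>
  have "dim L \<noteq> 0"
  proof
    assume "dim L = 0"
    then have "L \<subseteq> {0}" by (simp add: dim_eq_0)
    then show False using assms(3,4) by blast
  qed
  then have "int (dim L - 1) = int (dim L) - 1" by linarith
  moreover have "L \<inter> H \<noteq> {}" using assms(3) by blast
  ultimately have "aff_dim (L \<inter> H) = int (dim L - 1)"
    using aff_dim_affine_Int_hyperplane[OF affL, of a b] assms(4) aff_dim_subspace[OF L]
    unfolding ab(2)[symmetric] by (simp only: if_False)
  moreover have "affine (H \<inter> L)" using H'(1) affL by (rule affine_Int)
  ultimately show ?thesis by (simp add: affine_flats_def Int_commute)
qed

text \<open>On the measurable set of hyperplanes that hit \<open>L\<close> without containing it,
  the trace is a flat of the right dimension and hits C iff the hyperplane hits the compact set L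
  \<inter> C. For all others the trace is empty or \<open>L\<close> itself; since
  \<open>0 < dim L\<close>, neither has dimension \<open>dim L - 1\<close>, so neither belongs to
  \<open>B\<close>.\<close>

lemma sets_trace_hyperplanes:
  assumes L: "subspace (L :: 'a::euclidean_space set)" and "0 < dim L"
    and B: "B \<in> sets (flat_space L (dim L - 1))"
  shows "{H \<in> affine_flats UNIV (DIM('a) - 1). H \<inter> L \<in> B} \<in> sets (hyperplane_space :: 'a set measure)"
proof -
  let ?P = "hyperplane_space :: 'a set measure"
  let ?\<Omega> = "affine_flats UNIV (DIM('a) - 1) :: 'a set set"
  define W where "W = {H \<in> ?\<Omega>. H \<inter> L \<noteq> {}} - {H \<in> ?\<Omega>. L \<subseteq> H}"
  have W: "W \<in> sets ?P" unfolding W_def by (intro sets.Diff sets_hit_subspace[OF L])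
  have sp: "W \<inter> space ?P \<in> sets ?P" by (intro sets.Int W sets.top)
  have "(\<lambda>H. H \<inter> L) \<in> measurable (restrict_space ?P W) (flat_space L (dim L - 1))"
  proof (rule measurable_flat_spaceI)
    fix H assume "H \<in> space (restrict_space ?P W)"
    then show "H \<inter> L \<in> affine_flats L (dim L - 1)"
      by (intro hyperplane_Int_subspace_in_affine_flats[OF L]) (auto simp: space_restrict_space W_def)
  next
    fix C :: "'a set" assume "compact C"
    then have "compact (L \<inter> C)" using closed_subspace[OF L] by (simp add: closed_Int_compact)
    then have "W \<inter> {H \<in> ?\<Omega>. H \<inter> (L \<inter> C) \<noteq> {}} \<in> sets ?P"
      using W by (intro sets.Int sets_flat_space_hit)
    moreover have "{H \<in> space (restrict_space ?P W). H \<inter> L \<inter> C \<noteq> {}} = W \<inter> {H \<in> ?\<Omega>. H \<inter> (L \<inter> C) \<noteq> {}}"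
      by (auto simp: space_restrict_space W_def)
    ultimately show "{H \<in> space (restrict_space ?P W). H \<inter> L \<inter> C \<noteq> {}} \<in> sets (restrict_space ?P W)"
      using sp by (subst sets_restrict_space_iff) auto
  qed
  from measurable_sets[OF this B] have "(\<lambda>H. H \<inter> L) -` B \<inter> space (restrict_space ?P W) \<in> sets ?P"
    using sp by (subst (asm) sets_restrict_space_iff) auto
  moreover have "(\<lambda>H. H \<inter> L) -` B \<inter> space (restrict_space ?P W) = {H \<in> ?\<Omega>. H \<inter> L \<in> B}"
  proof -
    have "H \<in> W" if "H \<in> ?\<Omega>" "H \<inter> L \<in> B" for H
    proof -
      have "H \<inter> L \<in> affine_flats L (dim L - 1)" using that(2) sets.sets_into_space[OF B] by auto
      then have d: "aff_dim (H \<inter> L) = int (dim L) - 1" using \<open>0 < dim L\<close> by (auto simp: affine_flats_def)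
      have "H \<inter> L \<noteq> {}"
      proof
        assume "H \<inter> L = {}"
        then have "aff_dim (H \<inter> L) = - 1" by simp
        then show False using d \<open>0 < dim L\<close> by linarith
      qed
      moreover have "\<not> L \<subseteq> H"
      proof
        assume "L \<subseteq> H"
        then have "H \<inter> L = L" by blast
        then show False using d aff_dim_subspace[OF L] by simp
      qed
      ultimately show ?thesis using that by (simp add: W_def)
    qed
    then show ?thesis by (auto simp: space_restrict_space W_def)
  qed
  ultimately show ?thesis by simp
qed

subsection \<open>The intensity measure of the hyperplane process\<close>

text \<open>For r < 1 the density is unbounded at 0, where \<open>0 < r\<close> makes it integrable.
  The negative half-line is reflected to the positive one.\<close>

lemma nn_integral_abs_powr_finite:
  assumes "0 < r"
  shows "(\<integral>\<^sup>+t. indicator {-N..N} t * ennreal (\<bar>t\<bar> powr (r - 1)) \<partial>lborel) < \<infinity>"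
proof (cases "0 \<le> N")
  case True
  let ?I = "\<integral>\<^sup>+t. ennreal (t powr (r - 1)) * indicator {0..N} t \<partial>lborel"
  have "((\<lambda>t. t powr (r - 1)) has_integral (N powr r / r)) {0..N}"
    using has_integral_powr_from_0[of "r - 1" N] assms True by simp
  then have fin: "?I < \<infinity>"
    using nn_integral_has_integral_lebesgue[of "{0..N}" "\<lambda>t. t powr (r - 1)"]
    by (simp add: ennreal_mult' ennreal_indicator mult.commute)
  have "(\<integral>\<^sup>+t. indicator {-N..N} t * ennreal (\<bar>t\<bar> powr (r - 1)) \<partial>lborel) \<le>
      (\<integral>\<^sup>+t. ennreal (t powr (r - 1)) * indicator {0..N} t + ennreal ((- t) powr (r - 1)) * indicator {0..N} (- t) \<partial>lborel)"
    by (intro nn_integral_mono) (auto simp: indicator_def abs_if)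
  also have "\<dots> = ?I + (\<integral>\<^sup>+t. ennreal ((- t) powr (r - 1)) * indicator {0..N} (- t) \<partial>lborel)"
    by (rule nn_integral_add) auto
  also have "(\<integral>\<^sup>+t. ennreal ((- t) powr (r - 1)) * indicator {0..N} (- t) \<partial>lborel) = ?I"
    by (subst (2) nn_integral_real_affine[of _ "-1" 0]) auto
  finally show ?thesis using fin by (auto simp: order.strict_trans1)
qed simp

text \<open>\<open>measure_of\<close> takes the prescribed values once they are countably additive.
  This holds because disjoint sets of hyperplanes have disjoint sets of parameters, so that monotone
  convergence applies to both integrals.\<close>

lemma emeasure_hyperplane_intensity:
  assumes B: "B \<in> sets (hyperplane_space :: 'a::euclidean_space set measure)"
  shows "emeasure (hyperplane_intensity \<gamma> r) B = ennreal (\<gamma> / sphere_const (real DIM('a))) *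
    (\<integral>\<^sup>+u\<in>sphere 0 1. level_mass r UNIV B u \<partial>hausdorff_measure (real (DIM('a) - 1)))"
proof -
  let ?P = "hyperplane_space :: 'a set measure"
  let ?\<sigma> = "hausdorff_measure (real (DIM('a) - 1)) :: 'a measure"
  let ?c = "ennreal (\<gamma> / sphere_const (real DIM('a)))"
  define \<mu> where "\<mu> B = ?c * (\<integral>\<^sup>+u\<in>sphere 0 1. level_mass r UNIV B u \<partial>?\<sigma>)" for B :: "'a set set"
  have eq: "?c * (\<integral>\<^sup>+u\<in>sphere 0 1. (\<integral>\<^sup>+t. indicator B (hyperplane u t) * ennreal (\<bar>t\<bar> powr (r - 1)) \<partial>lborel) \<partial>?\<sigma>) = \<mu> B"
    for B :: "'a set set"
    unfolding \<mu>_def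
  proof (rule arg_cong[of _ _ "(*) ?c"], rule nn_integral_cong)
    fix u :: 'a
    show "(\<integral>\<^sup>+t. indicator B (hyperplane u t) * ennreal (\<bar>t\<bar> powr (r - 1)) \<partial>lborel) * indicator (sphere 0 1) u =
        level_mass r UNIV B u * indicator (sphere 0 1) u"
      by (cases "u \<in> sphere 0 1") (simp_all add: level_mass_eq hyperplane_eq_level_flat)
  qed
  have m [measurable]: "level_mass r UNIV B \<in> borel_measurable borel" if "B \<in> sets ?P" for B :: "'a set set"
    by (rule measurable_level_mass) (use that in auto)
  have par [measurable]: "flat_params UNIV B \<in> sets (borel \<Otimes>\<^sub>M borel)" if "B \<in> sets ?P" for B :: "'a set set"
    by (rule sets_flat_params) (use that in auto)
  show ?thesis
    unfolding hyperplane_intensity_def eq \<mu>_def[symmetric]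
  proof (rule emeasure_measure_of_sigma)
    show "sigma_algebra (space ?P) (sets ?P)" by (rule sets.sigma_algebra_axioms)
    show "positive (sets ?P) \<mu>"
      by (simp add: positive_def \<mu>_def level_mass_def flat_params_def)
    show "countably_additive (sets ?P) \<mu>"
    proof (rule countably_additiveI)
      fix F :: "nat \<Rightarrow> 'a set set"
      assume F: "range F \<subseteq> sets ?P" "disjoint_family F"
      then have Fi: "F i \<in> sets ?P" for i by auto
      have slice: "(\<lambda>t. indicator (flat_params UNIV (F i)) (u, t) * ennreal (\<bar>t\<bar> powr (r - 1))) \<in> borel_measurable lborel" for u i
        using par[OF Fi[of i]] by measurable
      have "level_mass r UNIV (\<Union>i. F i) u = (\<Sum>i. level_mass r UNIV (F i) u)" for u
      proof -
        have "disjoint_family (\<lambda>i. flat_params UNIV (F i))"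
          using F(2) by (auto simp: disjoint_family_on_def flat_params_def)
        moreover have "flat_params UNIV (\<Union>i. F i) = (\<Union>i. flat_params UNIV (F i))"
          by (auto simp: flat_params_def)
        ultimately have "indicator (flat_params UNIV (\<Union>i. F i)) z = (\<Sum>i. indicator (flat_params UNIV (F i)) z :: ennreal)" for z
          by (simp add: suminf_indicator)
        then show ?thesis
          unfolding level_mass_def using slice
          by (subst nn_integral_suminf[symmetric]) auto
      qed
      then have "\<mu> (\<Union>i. F i) = ?c * (\<integral>\<^sup>+u. (\<Sum>i. level_mass r UNIV (F i) u * indicator (sphere 0 1) u) \<partial>?\<sigma>)"
        by (simp add: \<mu>_def)
      also have "\<dots> = (\<Sum>i. \<mu> (F i))"
      proof -
        have [measurable]: "sphere 0 1 \<in> sets (borel :: 'a measure)" by (intro borel_closed) simp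
        have "(\<lambda>u. level_mass r UNIV (F i) u * indicator (sphere 0 1) u) \<in> borel_measurable ?\<sigma>" for i
          using m[OF Fi[of i]] by measurable
        then show ?thesis unfolding \<mu>_def by (subst nn_integral_suminf) (assumption, simp)
      qed
      finally show "(\<Sum>i. \<mu> (F i)) = \<mu> (\<Union>i. F i)" ..
    qed
  qed (rule B)
qed

lemma sets_hyperplane_intensity [simp]:
  "sets (hyperplane_intensity \<gamma> r) = sets (hyperplane_space :: 'a::euclidean_space set measure)"
  unfolding hyperplane_intensity_def by (rule sets.sets_measure_of_eq)

text \<open>A hyperplane H(u,t) with unit normal hits the ball of radius N about 0 only if |t| \<le>
  N, by Cauchy-Schwarz.\<close>

lemma emeasure_hyperplane_intensity_hit_finite:
  assumes "0 < r"
  shows "emeasure (hyperplane_intensity \<gamma> r) {H \<in> affine_flats UNIV (DIM('a) - 1). H \<inter> cball (0 :: 'a::euclidean_space) N \<noteq> {}} < \<infinity>"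
proof -
  let ?D = "{H \<in> affine_flats UNIV (DIM('a) - 1). H \<inter> cball (0 :: 'a) N \<noteq> {}}"
  let ?\<sigma> = "hausdorff_measure (real (DIM('a) - 1)) :: 'a measure"
  let ?K = "\<integral>\<^sup>+t. indicator {-N..N} t * ennreal (\<bar>t\<bar> powr (r - 1)) \<partial>lborel"
  have "level_mass r UNIV ?D u \<le> ?K" for u
    unfolding level_mass_def
  proof (intro nn_integral_mono mult_right_mono)
    fix t
    have "t \<in> {-N..N}" if "norm u = 1" "x \<bullet> u = t" "norm x \<le> N" for x
      using that Cauchy_Schwarz_ineq2[of x u] by auto
    then show "indicator (flat_params UNIV ?D) (u, t) \<le> (indicator {-N..N} t :: ennreal)"
      by (auto simp: flat_params_def level_flat_def indicator_def)
  qed simp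
  then have "(\<integral>\<^sup>+u\<in>sphere 0 1. level_mass r UNIV ?D u \<partial>?\<sigma>) \<le> (\<integral>\<^sup>+u. ?K * indicator (sphere 0 1) u \<partial>?\<sigma>)"
    by (intro nn_integral_mono mult_right_mono) auto
  also have "\<dots> = ?K * emeasure ?\<sigma> (sphere 0 1)"
    by (rule nn_integral_cmult_indicator) simp
  also have "\<dots> < \<infinity>"
    using nn_integral_abs_powr_finite[OF assms, of N] emeasure_hausdorff_sphere_finite[where 'a='a]
    by (simp add: ennreal_mult_less_top)
  finally show ?thesis
    by (subst emeasure_hyperplane_intensity)
       (auto simp: ennreal_mult_less_top intro!: sets_flat_space_hit)
qed

subsection \<open>Expectation of a Poisson process\<close>

lemma poisson_mean_sums: "(\<lambda>k. real k * (exp (- \<mu>) * \<mu> ^ k / fact k)) sums \<mu>"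
proof (rule sums_Suc_imp)
  have "(\<lambda>k. \<mu> ^ k / fact k) sums exp \<mu>" using exp_converges[of \<mu>] by (simp add: divide_inverse mult.commute)
  then have "(\<lambda>k. (\<mu> * exp (- \<mu>)) * (\<mu> ^ k / fact k)) sums ((\<mu> * exp (- \<mu>)) * exp \<mu>)"
    by (rule sums_mult)
  moreover have "(\<mu> * exp (- \<mu>)) * exp \<mu> = \<mu>" by (simp add: exp_minus)
  moreover have "real (Suc k) * (exp (- \<mu>) * \<mu> ^ Suc k / fact (Suc k)) = (\<mu> * exp (- \<mu>)) * (\<mu> ^ k / fact k)" for k
    by (simp add: field_simps del: of_nat_Suc)
  ultimately show "(\<lambda>k. real (Suc k) * (exp (- \<mu>) * \<mu> ^ Suc k / fact (Suc k))) sums \<mu>" by (simp only:)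
qed simp

text \<open>The Poisson weights sum to 1, so the value infinity has probability 0 and
  \<open>Y\<close> is almost surely the sum of k times the indicator of Y = k.\<close>

lemma (in prob_space) nn_integral_poisson:
  fixes Y :: "'a \<Rightarrow> ennreal"
  assumes Y [measurable]: "Y \<in> borel_measurable M"
    and range: "\<And>\<omega>. \<omega> \<in> space M \<Longrightarrow> Y \<omega> \<in> insert \<infinity> (range of_nat)"
    and dist: "\<And>k::nat. prob {\<omega> \<in> space M. Y \<omega> = of_nat k} = exp (- \<mu>) * \<mu> ^ k / fact k"
    and "0 \<le> \<mu>"
  shows "(\<integral>\<^sup>+\<omega>. Y \<omega> \<partial>M) = ennreal \<mu>"
proof -
  define A where "A k = {\<omega> \<in> space M. Y \<omega> = of_nat k}" for k :: nat
  have A [measurable]: "A k \<in> events" for k unfolding A_def by measurable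
  have pA: "emeasure M (A k) = ennreal (exp (- \<mu>) * \<mu> ^ k / fact k)" for k
    using dist[of k] by (simp add: emeasure_eq_measure A_def)
  have disj: "disjoint_family A" by (auto simp: disjoint_family_on_def A_def)
  have "emeasure M (\<Union>k. A k) = (\<Sum>k. ennreal (exp (- \<mu>) * \<mu> ^ k / fact k))"
    using disj by (subst suminf_emeasure[symmetric]) (auto simp: pA)
  also have "\<dots> = ennreal 1"
  proof (rule sums_unique[symmetric])
    have "(\<lambda>k. exp (- \<mu>) * (\<mu> ^ k / fact k)) sums (exp (- \<mu>) * exp \<mu>)"
      using exp_converges[of \<mu>] by (intro sums_mult) (simp add: divide_inverse mult.commute)
    then have "(\<lambda>k. exp (- \<mu>) * \<mu> ^ k / fact k) sums 1" by (simp add: exp_minus)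
    then show "(\<lambda>k. ennreal (exp (- \<mu>) * \<mu> ^ k / fact k)) sums ennreal 1"
      using \<open>0 \<le> \<mu>\<close> by (subst sums_ennreal) auto
  qed
  finally have "prob (\<Union>k. A k) = 1" by (simp add: emeasure_eq_measure)
  then have "AE \<omega> in M. \<omega> \<in> (\<Union>k. A k)" by (subst (asm) prob_eq_1) auto
  then have "AE \<omega> in M. Y \<omega> = (\<Sum>k. of_nat k * indicator (A k) \<omega>)"
  proof eventually_elim
    case (elim \<omega>)
    then obtain k where k: "\<omega> \<in> A k" by blast
    have "(\<Sum>j. of_nat j * indicator (A j) \<omega> :: ennreal) = (\<Sum>j\<in>{k}. of_nat j * indicator (A j) \<omega>)"
      using k by (intro suminf_finite) (auto simp: A_def indicator_def)
    also have "\<dots> = of_nat k" using k by simp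
    also have "\<dots> = Y \<omega>" using k by (simp add: A_def)
    finally show ?case ..
  qed
  then have "(\<integral>\<^sup>+\<omega>. Y \<omega> \<partial>M) = (\<integral>\<^sup>+\<omega>. (\<Sum>k. of_nat k * indicator (A k) \<omega>) \<partial>M)"
    by (rule nn_integral_cong_AE)
  also have "\<dots> = (\<Sum>k. of_nat k * emeasure M (A k))"
    by (subst nn_integral_suminf) (auto simp: nn_integral_cmult_indicator)
  also have "\<dots> = (\<Sum>k. ennreal (real k * (exp (- \<mu>) * \<mu> ^ k / fact k)))"
  proof -
    have "of_nat k * ennreal x = ennreal (real k * x)" for k x
      by (simp add: ennreal_mult' ennreal_of_nat_eq_real_of_nat)
    then show ?thesis unfolding pA by simp
  qed
  also have "\<dots> = ennreal \<mu>"
    using poisson_mean_sums[of \<mu>] \<open>0 \<le> \<mu>\<close> by (intro sums_unique[symmetric]) (subst sums_ennreal, auto)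
  finally show ?thesis .
qed

lemma nn_integral_poisson_process:
  assumes P: "poisson_process M \<Theta> X" and A: "A \<in> sets \<Theta>" and fin: "emeasure \<Theta> A < \<infinity>"
  shows "(\<integral>\<^sup>+\<omega>. emeasure (X \<omega>) A \<partial>M) = emeasure \<Theta> A"
proof -
  interpret prob_space M using P by (simp add: poisson_process_def point_process_def)
  have "(\<integral>\<^sup>+\<omega>. emeasure (X \<omega>) A \<partial>M) = ennreal (measure \<Theta> A)"
    using P A fin by (intro nn_integral_poisson) (auto simp: poisson_process_def point_process_def)
  then show ?thesis using fin by (simp add: emeasure_eq_ennreal_measure)
qed

text \<open>\<open>poisson_process\<close> prescribes the counting distribution only for finite
  intensity. Sets of infinite intensity are reached along the exhaustion \<open>D\<close> by
  monotone convergence, both for almost every outcome and for the intensity.\<close>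

lemma nn_integral_poisson_process_sigma_finite:
  assumes P: "poisson_process M \<Theta> X" and A: "A \<in> sets \<Theta>"
    and D: "range D \<subseteq> sets \<Theta>" "incseq D" "(\<Union>N. D N) = space \<Theta>" "\<And>N::nat. emeasure \<Theta> (D N) < \<infinity>"
  shows "(\<integral>\<^sup>+\<omega>. emeasure (X \<omega>) A \<partial>M) = emeasure \<Theta> A"
proof -
  have AD: "A \<inter> D N \<in> sets \<Theta>" for N using A D(1) by auto
  have U: "(\<Union>N. A \<inter> D N) = A" using D(3) sets.sets_into_space[OF A] by auto
  have inc: "incseq (\<lambda>N. A \<inter> D N)" using D(2) by (auto simp: incseq_def)
  have PX: "sets (X \<omega>) = sets \<Theta>" if "\<omega> \<in> space M" for \<omega>
    using P that by (simp add: poisson_process_def point_process_def)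
  have meas: "(\<lambda>\<omega>. emeasure (X \<omega>) (A \<inter> D N)) \<in> borel_measurable M" for N
    using P AD by (simp add: poisson_process_def point_process_def)
  have "(\<integral>\<^sup>+\<omega>. emeasure (X \<omega>) A \<partial>M) = (\<integral>\<^sup>+\<omega>. (SUP N. emeasure (X \<omega>) (A \<inter> D N)) \<partial>M)"
  proof (rule nn_integral_cong)
    fix \<omega> assume "\<omega> \<in> space M"
    then have "range (\<lambda>N. A \<inter> D N) \<subseteq> sets (X \<omega>)" using PX AD by auto
    from SUP_emeasure_incseq[OF this inc] show "emeasure (X \<omega>) A = (SUP N. emeasure (X \<omega>) (A \<inter> D N))"
      unfolding U by (rule sym)
  qed
  also have "\<dots> = (SUP N. \<integral>\<^sup>+\<omega>. emeasure (X \<omega>) (A \<inter> D N) \<partial>M)"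
  proof (rule nn_integral_monotone_convergence_SUP_AE)
    show "AE \<omega> in M. emeasure (X \<omega>) (A \<inter> D i) \<le> emeasure (X \<omega>) (A \<inter> D (Suc i))" for i
      using D(2) AD PX by (intro AE_I2 emeasure_mono) (auto simp: incseq_Suc_iff)
  qed (rule meas)
  also have "\<dots> = (SUP N. emeasure \<Theta> (A \<inter> D N))"
  proof (intro SUP_cong refl nn_integral_poisson_process[OF P AD])
    fix N
    have "emeasure \<Theta> (A \<inter> D N) \<le> emeasure \<Theta> (D N)" using D(1) by (intro emeasure_mono) auto
    then show "emeasure \<Theta> (A \<inter> D N) < \<infinity>" using D(4)[of N] by simp
  qed
  also have "\<dots> = emeasure \<Theta> A"
    using SUP_emeasure_incseq[of "\<lambda>N. A \<inter> D N" \<Theta>] AD inc U by auto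
  finally show ?thesis .
qed

lemma nn_integral_poisson_hyperplane_process:
  fixes X :: "'w \<Rightarrow> 'a::euclidean_space set measure"
  assumes "poisson_hyperplane_process M \<gamma> r X" "0 < r" and A: "A \<in> sets hyperplane_space"
  shows "(\<integral>\<^sup>+\<omega>. emeasure (X \<omega>) A \<partial>M) = emeasure (hyperplane_intensity \<gamma> r) A"
proof (rule nn_integral_poisson_process_sigma_finite)
  let ?\<Omega> = "affine_flats UNIV (DIM('a) - 1) :: 'a set set"
  let ?D = "\<lambda>N::nat. {H \<in> ?\<Omega>. H \<inter> cball 0 (real N) \<noteq> {}}"
  show "poisson_process M (hyperplane_intensity \<gamma> r) X"
    using assms(1) by (simp add: poisson_hyperplane_process_def)
  show "A \<in> sets (hyperplane_intensity \<gamma> r)" using A by simp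
  show "range ?D \<subseteq> sets (hyperplane_intensity \<gamma> r)"
    by (auto intro: sets_flat_space_hit)
  show "incseq ?D"
  proof (rule incseq_SucI)
    fix N
    have "cball (0 :: 'a) (real N) \<subseteq> cball 0 (real (Suc N))" by (rule subset_cball) simp
    then show "?D N \<subseteq> ?D (Suc N)" by blast
  qed
  show "(\<Union>N. ?D N) = space (hyperplane_intensity \<gamma> r)"
  proof -
    have "\<exists>N. H \<in> ?D N" if "H \<in> ?\<Omega>" for H
    proof -
      have "H \<noteq> {}" using that by (auto simp: affine_flats_def)
      then obtain x where "x \<in> H" by blast
      moreover obtain N :: nat where "norm x \<le> real N" using real_arch_simple by blast
      ultimately have "x \<in> H \<inter> cball 0 (real N)" by simp
      then show ?thesis using that by blast
    qed
    moreover have "space (hyperplane_intensity \<gamma> r) = ?\<Omega>"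
      using sets_eq_imp_space_eq[OF sets_hyperplane_intensity] by simp
    ultimately show ?thesis by auto
  qed
  show "emeasure (hyperplane_intensity \<gamma> r) (?D N) < \<infinity>" for N
    by (rule emeasure_hyperplane_intensity_hit_finite[OF assms(2)])
qed

subsection \<open>The sectional process\<close>

lemma emeasure_section_measure:
  assumes L: "subspace (L :: 'a::euclidean_space set)" "0 < dim L"
    and N: "sets N = sets (hyperplane_space :: 'a set measure)"
    and B: "B \<in> sets (section_space L)"
  shows "emeasure (section_measure L N) B = emeasure N {H \<in> affine_flats UNIV (DIM('a) - 1). H \<inter> L \<in> B}"
proof -
  let ?\<Omega> = "affine_flats UNIV (DIM('a) - 1) :: 'a set set"
  let ?S = "section_space L"
  define D where "D B = {H \<in> ?\<Omega>. H \<inter> L \<in> B}" for B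
  define f where "f B = (\<integral>\<^sup>+H. indicator {H. H \<inter> L \<noteq> {}} H * emeasure (return ?S (H \<inter> L)) B \<partial>N)" for B
  have D: "D B \<in> sets N" if "B \<in> sets ?S" for B
    unfolding D_def N using that by (intro sets_trace_hyperplanes L) (simp add: section_space_def)
  have spN: "space N = ?\<Omega>" using sets_eq_imp_space_eq[OF N] by simp
  have f: "f B = emeasure N (D B)" if B: "B \<in> sets ?S" for B
  proof -
    \<comment> \<open>The empty set is no flat of dimension \<open>dim L - 1\<close>, so the
      indicator of hitting \<open>L\<close> is implied by membership of the trace in
      \<open>B\<close>. Hyperplanes containing \<open>L\<close> drop out through
      \<open>return\<close>, since \<open>B\<close> consists of flats of lower dimension.\<close>
    have "{} \<notin> B"
    proof
      assume "{} \<in> B"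
      then have "{} \<in> affine_flats L (dim L - 1)"
        using sets.sets_into_space[OF B] by (auto simp: section_space_def)
      then show False by (simp add: affine_flats_def)
    qed
    then have "f B = (\<integral>\<^sup>+H. indicator (D B) H \<partial>N)"
      unfolding f_def using B by (intro nn_integral_cong) (auto simp: indicator_def D_def spN)
    then show ?thesis using D[OF B] by simp
  qed
  have "emeasure (section_measure L N) B = f B"
    unfolding section_measure_def f_def[symmetric]
  proof (rule emeasure_measure_of_sigma)
    show "sigma_algebra (space ?S) (sets ?S)" by (rule sets.sigma_algebra_axioms)
    show "positive (sets ?S) f" by (simp add: positive_def f D_def)
    show "countably_additive (sets ?S) f"
    proof (rule countably_additiveI)
      fix F :: "nat \<Rightarrow> 'a set set"
      assume F: "range F \<subseteq> sets ?S" "disjoint_family F"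
      have "(\<Sum>i. emeasure N (D (F i))) = emeasure N (\<Union>i. D (F i))"
        using F D by (intro suminf_emeasure) (auto simp: disjoint_family_on_def D_def)
      moreover have "(\<Union>i. D (F i)) = D (\<Union>i. F i)" by (auto simp: D_def)
      moreover have "(\<Union>i. F i) \<in> sets ?S" using F by auto
      ultimately show "(\<Sum>i. f (F i)) = f (\<Union>i. F i)" using F(1) by (simp add: f range_subsetD)
    qed
  qed (rule B)
  then show ?thesis using f[OF B] by (simp add: D_def)
qed

text \<open>The section counts in \<open>B\<close> the hyperplanes whose trace lies in
  \<open>B\<close>, so its mean is the intensity of that preimage. Preimages of disjoint sets are
  disjoint, which supplies the additivity demanded by \<open>measure_of\<close>.\<close>

lemma emeasure_intensity_sectional_process:
  fixes X :: "'w \<Rightarrow> 'a::euclidean_space set measure"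
  assumes X: "poisson_hyperplane_process M \<gamma> r X" and "0 < r" and L: "subspace L" "0 < dim L"
    and B: "B \<in> sets (section_space L)"
  shows "emeasure (intensity_measure M (section_space L) (sectional_process L X)) B =
    emeasure (hyperplane_intensity \<gamma> r) {H \<in> affine_flats UNIV (DIM('a) - 1). H \<inter> L \<in> B}"
proof -
  let ?\<Omega> = "affine_flats UNIV (DIM('a) - 1) :: 'a set set"
  let ?S = "section_space L"
  let ?\<Theta> = "hyperplane_intensity \<gamma> r :: 'a set measure"
  define D where "D B = {H \<in> ?\<Omega>. H \<inter> L \<in> B}" for B
  define f where "f B = (\<integral>\<^sup>+\<omega>. emeasure (sectional_process L X \<omega>) B \<partial>M)" for B
  have D: "D B \<in> sets hyperplane_space" if "B \<in> sets ?S" for B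
    unfolding D_def using that by (intro sets_trace_hyperplanes L) (simp add: section_space_def)
  have setsX: "sets (X \<omega>) = sets hyperplane_space" if "\<omega> \<in> space M" for \<omega>
    using X that by (simp add: poisson_hyperplane_process_def poisson_process_def point_process_def)
  have f: "f B = emeasure ?\<Theta> (D B)" if B: "B \<in> sets ?S" for B
  proof -
    have "f B = (\<integral>\<^sup>+\<omega>. emeasure (X \<omega>) (D B) \<partial>M)"
      unfolding f_def sectional_process_def D_def
      by (intro nn_integral_cong emeasure_section_measure L setsX B)
    then show ?thesis using nn_integral_poisson_hyperplane_process[OF X \<open>0 < r\<close> D[OF B]] by simp
  qed
  have "emeasure (intensity_measure M ?S (sectional_process L X)) B = f B"
    unfolding intensity_measure_def f_def[symmetric]
  proof (rule emeasure_measure_of_sigma)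
    show "sigma_algebra (space ?S) (sets ?S)" by (rule sets.sigma_algebra_axioms)
    show "positive (sets ?S) f" by (simp add: positive_def f D_def)
    show "countably_additive (sets ?S) f"
    proof (rule countably_additiveI)
      fix F :: "nat \<Rightarrow> 'a set set"
      assume F: "range F \<subseteq> sets ?S" "disjoint_family F"
      have "(\<Sum>i. emeasure ?\<Theta> (D (F i))) = emeasure ?\<Theta> (\<Union>i. D (F i))"
        using F D by (intro suminf_emeasure) (auto simp: disjoint_family_on_def D_def)
      moreover have "(\<Union>i. D (F i)) = D (\<Union>i. F i)" by (auto simp: D_def)
      moreover have "(\<Union>i. F i) \<in> sets ?S" using F by auto
      ultimately show "(\<Sum>i. f (F i)) = f (\<Union>i. F i)" using F(1) by (simp add: f range_subsetD)
    qed
  qed (rule B)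
  then show ?thesis using f[OF B] by (simp add: D_def)
qed

text \<open>On \<open>span I\<close> the inner products with \<open>u\<close> and with its
  projection p agree, so the trace of H(u,t) has unit normal p / |p| and parameter t / |p|.
  Substituting |p| t for t gives |p| from the differential and |p|^(r-1) from the density, together
  |p|^r.\<close>

lemma level_mass_trace:
  assumes I: "orthonormal (I :: 'a::euclidean_space set)" "I \<noteq> {}"
    and B: "B \<in> sets (flat_space (span I) (dim (span I) - 1))" and u: "norm u = 1"
  shows "level_mass r UNIV {H \<in> affine_flats UNIV (DIM('a) - 1). H \<inter> span I \<in> B} u =
    ennreal (norm (span_proj I u) powr r) * level_mass r (span I) B (sgn (span_proj I u))"
proof -
  let ?D = "{H \<in> affine_flats UNIV (DIM('a) - 1). H \<inter> span I \<in> B}"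
  let ?Z = "flat_params (span I) B"
  define p where "p = span_proj I u"
  have "u \<noteq> 0" using u by auto
  have pI: "p \<in> span I" unfolding p_def by (rule span_proj_in_span)
  have dimI: "0 < dim (span I)" using I unfolding orthonormal_dim[OF I(1)] by (simp add: orthonormal_def card_gt_0_iff)
  have inner: "x \<bullet> u = x \<bullet> p" if x: "x \<in> span I" for x
  proof -
    have "x \<bullet> u = coord_comb I (\<lambda>b. x \<bullet> b) \<bullet> u" by (simp add: coord_comb_of_span[OF I(1) x])
    also have "\<dots> = x \<bullet> p"
      by (simp add: coord_comb_def p_def span_proj_def inner_sum_left inner_sum_right inner_commute mult.commute)
    finally show ?thesis .
  qed
  have "level_flat UNIV u t \<inter> span I = level_flat (span I) p t" for t
    using inner by (auto simp: level_flat_def)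
  moreover have "level_flat UNIV u t \<in> affine_flats UNIV (DIM('a) - 1)" for t
    using level_flat_in_affine_flats[of UNIV u t] \<open>u \<noteq> 0\<close> by simp
  ultimately have par: "(u, t) \<in> flat_params UNIV ?D \<longleftrightarrow> level_flat (span I) p t \<in> B" for t
    using u by (simp add: flat_params_def)
  show ?thesis
  proof (cases "p = 0")
    \<comment> \<open>Here \<open>u\<close> is orthogonal to \<open>span I\<close> and every trace
      is empty or the whole span, never a flat in \<open>B\<close>; the other side vanishes because
      \<open>0 powr r = 0\<close>.\<close>
    case True
    have "level_flat (span I) p t \<notin> B" for t
    proof
      assume "level_flat (span I) p t \<in> B"
      then have "level_flat (span I) p t \<in> affine_flats (span I) (dim (span I) - 1)"
        using sets.sets_into_space[OF B] by auto
      then have d: "aff_dim (level_flat (span I) p t) = int (dim (span I) - 1)" by (simp add: affine_flats_def)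
      show False
      proof (cases "t = 0")
        case True
        then have "level_flat (span I) p t = span I" using \<open>p = 0\<close> by (auto simp: level_flat_def)
        then show False using d dimI aff_dim_subspace[OF subspace_span, of I] by simp
      next
        case False
        then have "level_flat (span I) p t = {}" using \<open>p = 0\<close> by (auto simp: level_flat_def)
        then show False using d by simp
      qed
    qed
    then have "(u, t) \<notin> flat_params UNIV ?D" for t using par by blast
    then have "level_mass r UNIV ?D u = 0" by (simp add: level_mass_def)
    then show ?thesis using True by (simp add: p_def)
  next
    case False
    define s where "s = norm p"
    have s: "0 < s" "p = s *\<^sub>R sgn p" using False by (auto simp: s_def sgn_div_norm)
    have v: "sgn p \<in> sphere 0 1 \<inter> span I"
      using False pI by (auto simp: norm_sgn) (simp add: sgn_div_norm span_scale)
    have [measurable]: "?Z \<in> sets (borel \<Otimes>\<^sub>M borel)" by (rule sets_flat_params[OF subspace_span B])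
    have lf: "level_flat (span I) p (s * t) = level_flat (span I) (sgn p) t" for t
      by (subst s(2)) (use s(1) in \<open>auto simp: level_flat_def\<close>)
    have par': "(u, t) \<in> flat_params UNIV ?D \<longleftrightarrow> (sgn p, t / s) \<in> ?Z" for t
      unfolding par using lf[of "t / s"] s(1) v by (simp add: flat_params_def)
    have "level_mass r UNIV ?D u =
        (\<integral>\<^sup>+t. indicator ?Z (sgn p, t / s) * ennreal (\<bar>t\<bar> powr (r - 1)) \<partial>lborel)"
      unfolding level_mass_def
    proof (rule nn_integral_cong)
      fix t
      show "indicator (flat_params UNIV ?D) (u, t) * ennreal (\<bar>t\<bar> powr (r - 1)) =
          indicator ?Z (sgn p, t / s) * ennreal (\<bar>t\<bar> powr (r - 1))"
        using par'[of t] by (cases "(sgn p, t / s) \<in> ?Z") simp_all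
    qed
    also have "\<dots> = ennreal \<bar>s\<bar> * (\<integral>\<^sup>+t. indicator ?Z (sgn p, (0 + s * t) / s) * ennreal (\<bar>0 + s * t\<bar> powr (r - 1)) \<partial>lborel)"
      using s(1) by (intro nn_integral_real_affine) auto
    also have "\<dots> = ennreal s * (\<integral>\<^sup>+t. ennreal (s powr (r - 1)) * (indicator ?Z (sgn p, t) * ennreal (\<bar>t\<bar> powr (r - 1))) \<partial>lborel)"
    proof (rule arg_cong2[of _ _ _ _ "(*)"], use s(1) in simp, rule nn_integral_cong)
      fix t
      show "indicator ?Z (sgn p, (0 + s * t) / s) * ennreal (\<bar>0 + s * t\<bar> powr (r - 1)) =
          ennreal (s powr (r - 1)) * (indicator ?Z (sgn p, t) * ennreal (\<bar>t\<bar> powr (r - 1)))"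
        using s(1) by (simp add: abs_mult powr_mult ennreal_mult' mult_ac)
    qed
    also have "\<dots> = ennreal s * (ennreal (s powr (r - 1)) * level_mass r (span I) B (sgn p))"
      unfolding level_mass_def by (subst nn_integral_cmult) auto
    also have "\<dots> = ennreal (s powr r) * level_mass r (span I) B (sgn p)"
    proof -
      have "ennreal s * ennreal (s powr (r - 1)) = ennreal (s powr r)"
        using s(1) powr_mult_base[of s "r - 1"] by (simp add: ennreal_mult'[symmetric])
      then show ?thesis by (simp add: mult.assoc[symmetric])
    qed
    finally show ?thesis by (simp add: s_def p_def)
  qed
qed

theorem proposition3p12:
  fixes M :: "'w measure"
    and X :: "'w \<Rightarrow> 'a::euclidean_space set measure"
    and L :: "'a set"
    and r \<gamma> \<gamma>\<^sub>m :: real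
    and m :: nat
  assumes "2 \<le> DIM('a)"
    and "0 < r" and "0 < \<gamma>"
    and "poisson_hyperplane_process M \<gamma> r X"
    and "m \<in> {1..DIM('a) - 1}"
    and "subspace L" and "dim L = m"
    and "\<gamma>\<^sub>m = sphere_const (real m) * sphere_const (real DIM('a) + r) /
              (sphere_const (real DIM('a)) * sphere_const (real m + r)) * \<gamma>"
  shows "\<forall>B \<in> sets (flat_space L (m - 1)).
    emeasure (intensity_measure M (flat_space L (m - 1)) (sectional_process L X)) B =
      ennreal (\<gamma>\<^sub>m / sphere_const (real m)) *
      (\<integral>\<^sup>+u\<in>sphere 0 1 \<inter> L.
         (\<integral>\<^sup>+t. indicator B ((\<lambda>x. t *\<^sub>R u + x) ` ({x. x \<bullet> u = 0} \<inter> L)) *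
               ennreal (\<bar>t\<bar> powr (r - 1)) \<partial>lborel)
       \<partial>hausdorff_measure (real (m - 1)))"
proof
  fix B assume B: "B \<in> sets (flat_space L (m - 1))"
  obtain I where I: "orthonormal I" "span I = L"
    using orthonormal_basis_subspace_exists[OF \<open>subspace L\<close>] .
  obtain J where J: "orthonormal (I \<union> J)" "I \<inter> J = {}" "span (I \<union> J) = UNIV"
    using orthonormal_complement_exists[OF I(1)] .
  have cardI: "card I = m" using orthonormal_dim[OF I(1)] I(2) \<open>dim L = m\<close> by simp
  have cardI': "card I = Suc (m - 1)" using cardI \<open>m \<in> {1..DIM('a) - 1}\<close> by simp
  have "I \<noteq> {}" using cardI' by auto
  have cardIJ: "card (I \<union> J) = DIM('a)" using orthonormal_dim[OF J(1)] J(3) by simp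
  have dimL: "0 < dim L" using \<open>dim L = m\<close> \<open>m \<in> {1..DIM('a) - 1}\<close> by simp
  have S: "section_space L = flat_space L (m - 1)" by (simp add: section_space_def \<open>dim L = m\<close>)
  have B': "B \<in> sets (flat_space (span I) (dim (span I) - 1))" using B I(2) \<open>dim L = m\<close> by simp
  let ?D = "{H \<in> affine_flats UNIV (DIM('a) - 1). H \<inter> L \<in> B}"
  let ?\<omega> = "\<lambda>s. sphere_const s"
  let ?g = "level_mass r L B"
  have g: "?g \<in> borel_measurable borel"
    by (rule measurable_level_mass) (use B \<open>subspace L\<close> \<open>dim L = m\<close> in auto)
  have pos: "0 < ?\<omega> (real m)" "0 < ?\<omega> (real DIM('a))" "0 < ?\<omega> (real m + r)" "0 < ?\<omega> (real DIM('a) + r)"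
    using \<open>0 < r\<close> \<open>m \<in> {1..DIM('a) - 1}\<close> by (auto intro!: sphere_const_pos)
  have "emeasure (intensity_measure M (flat_space L (m - 1)) (sectional_process L X)) B =
      emeasure (hyperplane_intensity \<gamma> r) ?D"
    using emeasure_intensity_sectional_process[OF assms(4) \<open>0 < r\<close> \<open>subspace L\<close> dimL, of B] B by (simp add: S)
  also have "\<dots> = ennreal (\<gamma> / ?\<omega> (real DIM('a))) *
      (\<integral>\<^sup>+u\<in>sphere 0 1. level_mass r UNIV ?D u \<partial>hausdorff_measure (real (DIM('a) - 1)))"
    using B \<open>dim L = m\<close> by (intro emeasure_hyperplane_intensity sets_trace_hyperplanes \<open>subspace L\<close> dimL) simp
  also have "(\<integral>\<^sup>+u\<in>sphere 0 1. level_mass r UNIV ?D u \<partial>hausdorff_measure (real (DIM('a) - 1))) =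
      (\<integral>\<^sup>+u\<in>sphere 0 1 \<inter> span (I \<union> J). ennreal (norm (span_proj I u) powr r) * ?g (sgn (span_proj I u))
        \<partial>hausdorff_measure (real (card (I \<union> J) - 1)))"
    unfolding J(3) cardIJ
    using level_mass_trace[OF I(1) \<open>I \<noteq> {}\<close> B'] unfolding I(2)
    by (intro nn_integral_cong) (auto simp: indicator_def)
  also have "\<dots> = ennreal (?\<omega> (real DIM('a) + r) / ?\<omega> (real m + r)) *
      (\<integral>\<^sup>+u\<in>sphere 0 1 \<inter> L. ?g u \<partial>hausdorff_measure (real (m - 1)))"
    using nn_integral_sphere_span_proj[OF J(1,2) cardI' \<open>0 < r\<close> g] unfolding cardIJ cardI I(2) .
  \<comment> \<open>Back to the integrand of the statement: on the unit sphere of \<open>L\<close>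
    the translated sections are level flats.\<close>
  also have "(\<integral>\<^sup>+u\<in>sphere 0 1 \<inter> L. ?g u \<partial>hausdorff_measure (real (m - 1))) =
      (\<integral>\<^sup>+u\<in>sphere 0 1 \<inter> L.
         (\<integral>\<^sup>+t. indicator B ((\<lambda>x. t *\<^sub>R u + x) ` ({x. x \<bullet> u = 0} \<inter> L)) *
               ennreal (\<bar>t\<bar> powr (r - 1)) \<partial>lborel)
       \<partial>hausdorff_measure (real (m - 1)))"
    by (intro nn_integral_cong)
       (auto simp: indicator_def level_mass_eq translated_section_eq_level_flat[OF \<open>subspace L\<close>])
  \<comment> \<open>The factor \<omega>_m in \<gamma>_m cancels against the prefactor, which leaves
    \<gamma> \<omega>_(n+r) / (\<omega>_n \<omega>_(m+r)).\<close>
  also have "ennreal (\<gamma> / ?\<omega> (real DIM('a))) * (ennreal (?\<omega> (real DIM('a) + r) / ?\<omega> (real m + r)) * Y) =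
      ennreal (\<gamma>\<^sub>m / ?\<omega> (real m)) * Y" for Y
  proof -
    have "\<gamma> / ?\<omega> (real DIM('a)) * (?\<omega> (real DIM('a) + r) / ?\<omega> (real m + r)) = \<gamma>\<^sub>m / ?\<omega> (real m)"
      using pos by (simp add: assms(8) field_simps)
    then show ?thesis
      using pos \<open>0 < \<gamma>\<close> by (simp add: mult.assoc[symmetric] ennreal_mult'[symmetric])
  qed
  finally show "emeasure (intensity_measure M (flat_space L (m - 1)) (sectional_process L X)) B =
      ennreal (\<gamma>\<^sub>m / sphere_const (real m)) *
      (\<integral>\<^sup>+u\<in>sphere 0 1 \<inter> L.
         (\<integral>\<^sup>+t. indicator B ((\<lambda>x. t *\<^sub>R u + x) ` ({x. x \<bullet> u = 0} \<inter> L)) *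
               ennreal (\<bar>t\<bar> powr (r - 1)) \<partial>lborel)
       \<partial>hausdorff_measure (real (m - 1)))" .
qed

end
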